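(* Let $\{x^k\}_{k\in\mathbb N}$ be generated by the inexact MBA algorithm described in the context, and suppose that: (1) for all $k,j\in\mathbb{N}$ arising in the algorithm, the multifunction $x\mapsto G(x,x^k,L^{k,j})-\mathbb{R}_-^m$ is metrically subregular at $(\overline{x}^{k,j},0)$; (2) $\{x^k\}_{k\in\mathbb N}$ is bounded; (3) the system $H(u,x)\in\mathbb{R}_-^m$ satisfies the partial bounded multiplier property (BMP) with respect to $x$ at every $(u^*,\overline{x}^* )\in\Omega^*$; (4) $g$ is twice differentiable; (5) the function $\Phi_{\widetilde c}$ has the KL property at every point of $W^*$, the set of cluster points of $\{w^k\}_{k\in\mathbb N}$. Then $\sum_{k=0}^{\infty}\|x^{k+1}-x^k\|<\infty$, and consequently $\{x^k\}_{k\in\mathbb N}$ converges to some $x^*\in\omega(x^0)\subset X_s^*$, where $\omega(x^0)$ is the set of cluster points of $\{x^k\}_{k\in\mathbb N}$ and $X_s^*$ is the set of strong stationary points.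
   Context: Problem and standing assumptions. Consider $\min_{x\in\mathbb{R}^n}F(x):=f(x)+\phi(x)-\psi(x)+\delta_{\mathbb{R}_-^m}(g(x))$, where $\delta_C$ is the indicator function of $C$ and: (i) $g:\mathbb{R}^n\to\mathbb{R}^m$ is $\mathcal{C}^{1,1}$ (differentiable with locally Lipschitz derivative) and $\Gamma:=g^{-1}(\mathbb{R}_-^m)\neq\emptyset$; (ii) $f:\mathbb{R}^n\to(-\infty,\infty]$ is proper lsc and $\mathcal{C}^{1,1}$ on an open convex set $\mathcal{O}\supset\Gamma$; (iii) $\phi,\psi:\mathbb{R}^n\to\mathbb{R}$ are convex; (iv) $\inf_{\Gamma}F>-\infty$. $\widehat\partial$ and $\partial$ denote the regular and the limiting subdifferentials, $\mathcal{N}_C$ the limiting normal cone, $\nabla g(x):=g'(x)^\top$, $t_+=\max\{0,t\}$ (componentwise for vectors), $\psi^*$ the conjugate of $\psi$. A point $x\in\Gamma$ is a strong stationary point ($x\in X_s^*$) if $0\in\nabla f(x)+\partial\phi(x)+\partial(-\psi)(x)+\nabla g(x)\mathcal{N}_{\mathbb{R}_-^m}(g(x))$. A multifunction $\mathcal{F}$ is metrically subregular at $(\overline x,\overline y)\in{\rm gph}\,\mathcal F$ if there are $\kappa,\delta>0$ with ${\rm dist}(x,\mathcal{F}^{-1}(\overline y))\le\kappa\,{\rm dist}(\overline y,\mathcal{F}(x))$ for all $x$ with $\|x-\overline x\|\le\delta$. Algorithm (inexact MBA). Let $G(x,s,L):=g(s)+g'(s)(x-s)+\frac12\|x-s\|^2L$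 for $x,s\in\mathbb{R}^n$, $L\in\mathbb{R}^m_{++}$. Input: $0<\mu_{\min}\le\mu_{\max}$, $0<L_{\min}\le L_{\max}$, $M,\beta_R,\beta_F,\alpha>0$, $\tau>1$, $x^0\in\Gamma$. For $k=0,1,2,\ldots$: choose $\xi^k\in\partial(-\psi)(x^k)$, $\mu_{k,0}\in[\mu_{\min},\mu_{\max}]$, $L^{k,0}\in\mathbb{R}^m$ with entries in $[L_{\min},L_{\max}]$. Inner loop, $j=0,1,2,\ldots$: choose a self-adjoint linear $\mathcal{Q}_{k,j}:\mathbb{R}^n\to\mathbb{R}^n$ with $\mu_{k,j}\mathcal{I}\preceq\mathcal{Q}_{k,j}\preceq(\mu_{k,j}+M)\mathcal{I}$; put $\vartheta_{k,j}(x):=f(x^k)-\psi(x^k)+\langle\nabla f(x^k)+\xi^k,x-x^k\rangle+\frac12\langle x-x^k,\mathcal{Q}_{k,j}(x-x^k)\rangle$, $F_{k,j}:=\vartheta_{k,j}+\phi$, $\Gamma_{k,j}:=\{x: G(x,x^k,L^{k,j})\le0\}$, and let $\overline{x}^{k,j}$ be the unique minimizer of $F_{k,j}$ on $\Gamma_{k,j}$. Find $y^{k,j}\in\mathbb{R}^n$, $v^{k,j}\in\partial\phi(y^{k,j})$, $\lambda^{k,j}\in\mathbb{R}^m_+$ with $R_{k,j}(y^{k,j},v^{k,j},\lambda^{k,j})\le\frac{\beta_R}{2}\|y^{k,j}-x^k\|^2$, $F_{k,j}(y^{k,j})\le F_{k,j}(x^k)$ and $F_{k,j}(y^{k,j})-F_{k,j}(\overline{x}^{k,j})\le\frac{\beta_F}{2}\|y^{k,j}-x^k\|^2$,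 where, with $r:=\nabla\vartheta_{k,j}(x)+v+\nabla_xG(x,x^k,L^{k,j})\lambda$, $R_{k,j}(x,v,\lambda):=(\langle x,r\rangle)_++(-\langle\lambda,G(x,x^k,L^{k,j})\rangle)_++\|r\|+\|[G(x,x^k,L^{k,j})]_+\|_\infty$. If $g(y^{k,j})\le0$ and $F(y^{k,j})\le F(x^k)-\frac\alpha2\|y^{k,j}-x^k\|^2$, set $j_k:=j$ and leave the inner loop; else if $g(y^{k,j})\not\le0$, set $L^{k,j+1}=\tau L^{k,j}$, $\mu_{k,j+1}=\mu_{k,j}$; else set $L^{k,j+1}=L^{k,j}$, $\mu_{k,j+1}=\tau\mu_{k,j}$. After the inner loop set $(\mu_k,L^k,\mathcal{Q}_k,\overline{x}^k):=(\mu_{k,j_k},L^{k,j_k},\mathcal{Q}_{k,j_k},\overline{x}^{k,j_k})$ and $(x^{k+1},v^{k+1},\lambda^{k+1}):=(y^{k,j_k},v^{k,j_k},\lambda^{k,j_k})$. Partial BMP. Let $\mathbb{U}:=\mathbb{R}^m_+\times\mathbb{S}\times\mathbb{R}^n\times\mathbb{R}^n$ with $\mathbb{S}$ the set of positive definite linear mappings on $\mathbb{R}^n$; for $u=(L,\mathcal{Q},\xi,s)\in\mathbb{U}$ let $H(u,x):=G(x,s,L)$ and $\mathcal{S}(u):=\{x: H(u,x)\in\mathbb{R}^m_-\}$. The system $H(u,x)\in\mathbb{R}^m_-$ satisfies the partial BMP with respect to $x$ at $(u^*,x^* )$ with $x^*\in\mathcal{S}(u^* )$ if there are $\kappa>0$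 and neighborhoods $\mathcal{U}$ of $u^*$, $\mathcal{V}$ of $x^*$ such that for all $u\in\mathcal{U}$, $x\in\mathcal{V}\cap\mathcal{S}(u)$, $y\in\mathcal{N}_{\mathcal{S}(u)}(x)$ there is $\lambda\in\mathcal{N}_{\mathbb{R}^m_-}(H(u,x))$ with $\nabla_xH(u,x)\lambda=y$ and $\|\lambda\|\le\kappa\|y\|$. Let $u^k:=(L^k,\mathcal{Q}_k,\xi^k,x^k)$ and $\Omega^*$ the set of cluster points of $\{(u^k,\overline{x}^k)\}_{k\in\mathbb{N}}$. Potential function. For $z=(x,s,L,\xi)\in\mathbb{Z}:=\mathbb{R}^n\times\mathbb{R}^n\times\mathbb{R}^m_{++}\times\mathbb{R}^n$, $\Phi(z):=f(x)+\phi(x)+\delta_{G^{-1}(\mathbb{R}^m_-)}(x,s,L)+\langle x,\xi\rangle+\psi^*(-\xi)$; for $w=(z,d)\in\mathbb{Z}\times\mathbb{R}^n$, $\Phi_{\widetilde c}(w):=\Phi(z)+\widetilde c\|d\|^2$. Put $z^k:=(\overline{x}^k,x^k,L^k,\xi^k)$, $w^k:=(z^k,x^{k+1}-x^k)$. The constant is $\widetilde c:=(L_f+\beta_{\mathcal Q}+\beta_F/2)+(L_f+\beta_{\mathcal Q}/2)\widehat\gamma^2\beta_R$, where (such constants exist under hypotheses (1)-(3)) $\beta_{\mathcal Q}>0$ satisfies $\|\mathcal{Q}_k\|\le\beta_{\mathcal Q}$ for all $k$; $\widehat\gamma>0$ and $\widehat k\in\mathbb N$ satisfy $\|x^{k+1}-\overline{x}^k\|\le\widehat\gamma\sqrt{\beta_R/2}\,\|x^{k+1}-x^k\|$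 for $k\ge\widehat k$; and $L_f$ is a Lipschitz constant of $\nabla f$ on a compact convex set $D\subset\mathcal{O}$ containing $x^k,\overline{x}^k$ for all $k\ge\overline k$, for some $\overline k\ge\widehat k$. KL property. For $\eta>0$, $\Upsilon_\eta$ is the set of continuous concave $\varphi:[0,\eta)\to\mathbb{R}_+$, continuously differentiable on $(0,\eta)$, with $\varphi(0)=0$, $\varphi'>0$ on $(0,\eta)$. A proper function $h$ has the KL property at $\overline x\in{\rm dom}\,\partial h$ if there are $\delta>0$, $\eta\in(0,\infty]$, $\varphi\in\Upsilon_\eta$ such that $\varphi'(h(x)-h(\overline x))\,{\rm dist}(0,\partial h(x))\ge1$ for all $x$ with $\|x-\overline x\|\le\delta$ and $h(\overline x)<h(x)<h(\overline x)+\eta$. *)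

theory Defs
  imports "HOL-Analysis.Analysis"
begin

section \<open>Variational analysis\<close>

text \<open>Unlike \<open>infdist\<close>, the distance to the empty set is \<open>\<infinity>\<close>.\<close>

definition edist_set :: "'a::metric_space \<Rightarrow> 'a set \<Rightarrow> ereal" where
  "edist_set x S = (INF s\<in>S. ereal (dist x s))"

definition ind_fun :: "'a set \<Rightarrow> 'a \<Rightarrow> ereal" where
  "ind_fun C x = (if x \<in> C then 0 else \<infinity>)"

definition proper_fun :: "('a \<Rightarrow> ereal) \<Rightarrow> bool" where
  "proper_fun h \<longleftrightarrow> (\<forall>x. h x \<noteq> -\<infinity>) \<and> (\<exists>x. h x \<noteq> \<infinity>)"

definition lsc_fun :: "('a::topological_space \<Rightarrow> ereal) \<Rightarrow> bool" where
  "lsc_fun h \<longleftrightarrow> (\<forall>x. h x \<le> Liminf (at x) h)"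

definition regular_subdiff :: "('a::euclidean_space \<Rightarrow> ereal) \<Rightarrow> 'a \<Rightarrow> 'a set" where
  "regular_subdiff h x = {v. \<bar>h x\<bar> \<noteq> \<infinity> \<and>
     0 \<le> Liminf (at x) (\<lambda>y. (h y - h x - ereal (v \<bullet> (y - x))) / ereal (norm (y - x)))}"

definition limiting_subdiff :: "('a::euclidean_space \<Rightarrow> ereal) \<Rightarrow> 'a \<Rightarrow> 'a set" where
  "limiting_subdiff h x = {v. \<bar>h x\<bar> \<noteq> \<infinity> \<and>
     (\<exists>xs vs. xs \<longlonglongrightarrow> x \<and> (\<lambda>k. h (xs k)) \<longlonglongrightarrow> h x \<and>
        (\<forall>k. vs k \<in> regular_subdiff h (xs k)) \<and> vs \<longlonglongrightarrow> v)}"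

text \<open>At an isolated point of \<open>C\<close> the \<open>Limsup\<close> is taken along the trivial filter and is
  \<open>-\<infinity>\<close>, so every vector is a regular normal there.\<close>

definition regular_normal_cone :: "'a::euclidean_space set \<Rightarrow> 'a \<Rightarrow> 'a set" where
  "regular_normal_cone C x = {v. x \<in> C \<and>
     Limsup (at x within C) (\<lambda>y. ereal ((v \<bullet> (y - x)) / norm (y - x))) \<le> 0}"

definition limiting_normal_cone :: "'a::euclidean_space set \<Rightarrow> 'a \<Rightarrow> 'a set" where
  "limiting_normal_cone C x = {v. x \<in> C \<and>
     (\<exists>xs vs. xs \<longlonglongrightarrow> x \<and> (\<forall>k. vs k \<in> regular_normal_cone C (xs k)) \<and> vs \<longlonglongrightarrow> v)}"

definition conjugate_fun :: "('a::euclidean_space \<Rightarrow> real) \<Rightarrow> 'a \<Rightarrow> ereal" where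
  "conjugate_fun h y = (SUP x. ereal (y \<bullet> x - h x))"

definition cluster_points :: "(nat \<Rightarrow> 'a::topological_space) \<Rightarrow> 'a set" where
  "cluster_points X = {z. \<exists>r. strict_mono r \<and> (X \<circ> r) \<longlonglongrightarrow> z}"

definition metrically_subregular ::
  "('a::metric_space \<Rightarrow> 'b::metric_space set) \<Rightarrow> 'a \<Rightarrow> 'b \<Rightarrow> bool" where
  "metrically_subregular \<F> x\<^sub>0 y\<^sub>0 \<longleftrightarrow> y\<^sub>0 \<in> \<F> x\<^sub>0 \<and>
     (\<exists>\<kappa>>0. \<exists>\<delta>>0. \<forall>x. dist x x\<^sub>0 \<le> \<delta> \<longrightarrow>
        edist_set x {z. y\<^sub>0 \<in> \<F> z} \<le> ereal \<kappa> * edist_set y\<^sub>0 (\<F> x))"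

text \<open>The desingularizing functions \<open>\<Upsilon>\<^sub>\<eta>\<close> for \<open>\<eta> \<in> (0,\<infinity>]\<close>; only the values on
  \<open>[0,\<eta>)\<close> matter.\<close>

definition desingularizing :: "ereal \<Rightarrow> (real \<Rightarrow> real) set" where
  "desingularizing \<eta> = {\<phi>.
     continuous_on {t. 0 \<le> t \<and> ereal t < \<eta>} \<phi> \<and>
     concave_on {t. 0 \<le> t \<and> ereal t < \<eta>} \<phi> \<and>
     (\<forall>t. 0 \<le> t \<and> ereal t < \<eta> \<longrightarrow> 0 \<le> \<phi> t) \<and>
     (\<forall>t. 0 < t \<and> ereal t < \<eta> \<longrightarrow> \<phi> differentiable (at t)) \<and>
     continuous_on {t. 0 < t \<and> ereal t < \<eta>} (deriv \<phi>) \<and>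
     \<phi> 0 = 0 \<and>
     (\<forall>t. 0 < t \<and> ereal t < \<eta> \<longrightarrow> 0 < deriv \<phi> t)}"

definition KL_at :: "('a::euclidean_space \<Rightarrow> ereal) \<Rightarrow> 'a \<Rightarrow> bool" where
  "KL_at h x\<^sub>0 \<longleftrightarrow> proper_fun h \<and> limiting_subdiff h x\<^sub>0 \<noteq> {} \<and>
     (\<exists>\<delta>>0. \<exists>\<eta>>0. \<exists>\<phi>\<in>desingularizing \<eta>. \<forall>x.
        norm (x - x\<^sub>0) \<le> \<delta> \<and> h x\<^sub>0 < h x \<and> h x < h x\<^sub>0 + \<eta> \<longrightarrow>
        1 \<le> ereal (deriv \<phi> (real_of_ereal (h x - h x\<^sub>0))) * edist_set 0 (limiting_subdiff h x))"


section \<open>Smoothness and linear maps\<close>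

definition grad :: "('a::euclidean_space \<Rightarrow> real) \<Rightarrow> 'a \<Rightarrow> 'a" where
  "grad h x = (THE D. GDERIV h x :> D)"

text \<open>The transposed derivative \<open>\<nabla>h(x) = h'(x)\<^sup>T\<close> of a vector-valued map.\<close>

definition nabla :: "('a::euclidean_space \<Rightarrow> 'b::euclidean_space) \<Rightarrow> 'a \<Rightarrow> 'b \<Rightarrow> 'a" where
  "nabla h x = adjoint (frechet_derivative h (at x))"

text \<open>The derivative as a point of the normed space of linear maps.\<close>

definition derivative_map :: "('a::euclidean_space \<Rightarrow> 'b::euclidean_space) \<Rightarrow> 'a \<Rightarrow> 'a \<Rightarrow>\<^sub>L 'b" where
  "derivative_map h x = Blinfun (frechet_derivative h (at x))"

definition locally_lipschitz_on :: "'a::metric_space set \<Rightarrow> ('a \<Rightarrow> 'b::metric_space) \<Rightarrow> bool" where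
  "locally_lipschitz_on S h \<longleftrightarrow> (\<forall>x\<in>S. \<exists>\<epsilon>>0. \<exists>K. K-lipschitz_on (S \<inter> ball x \<epsilon>) h)"

definition C11_on :: "'a::euclidean_space set \<Rightarrow> ('a \<Rightarrow> 'b::euclidean_space) \<Rightarrow> bool" where
  "C11_on S h \<longleftrightarrow> (\<forall>x\<in>S. h differentiable (at x)) \<and> locally_lipschitz_on S (derivative_map h)"

definition twice_differentiable :: "('a::euclidean_space \<Rightarrow> 'b::euclidean_space) \<Rightarrow> bool" where
  "twice_differentiable h \<longleftrightarrow>
     (\<forall>x. h differentiable (at x)) \<and> (\<forall>x. derivative_map h differentiable (at x))"

definition self_adjoint :: "('a::euclidean_space \<Rightarrow>\<^sub>L 'a) \<Rightarrow> bool" where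
  "self_adjoint A \<longleftrightarrow> (\<forall>x y. A x \<bullet> y = x \<bullet> A y)"

definition loewner_le :: "('a::euclidean_space \<Rightarrow>\<^sub>L 'a) \<Rightarrow> ('a \<Rightarrow>\<^sub>L 'a) \<Rightarrow> bool" where
  "loewner_le A B \<longleftrightarrow> (\<forall>x. x \<bullet> A x \<le> x \<bullet> B x)"

definition pos_def_maps :: "('a::euclidean_space \<Rightarrow>\<^sub>L 'a) set" where
  "pos_def_maps = {A. self_adjoint A \<and> (\<forall>x. x \<noteq> 0 \<longrightarrow> 0 < x \<bullet> A x)}"

definition nonpos_orthant :: "(real^'m) set" where
  "nonpos_orthant = {y. \<forall>i. y $ i \<le> 0}"

definition nonneg_orthant :: "(real^'m) set" where
  "nonneg_orthant = {y. \<forall>i. 0 \<le> y $ i}"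

definition pos_orthant :: "(real^'m) set" where
  "pos_orthant = {y. \<forall>i. 0 < y $ i}"

definition pos_part :: "real^'m \<Rightarrow> real^'m" where
  "pos_part y = (\<chi> i. max 0 (y $ i))"


section \<open>The optimization problem\<close>

definition feasible :: "(real^'n \<Rightarrow> real^'m) \<Rightarrow> (real^'n) set" where
  "feasible g = {x. g x \<in> nonpos_orthant}"

definition objective ::
  "(real^'n \<Rightarrow> ereal) \<Rightarrow> (real^'n \<Rightarrow> real) \<Rightarrow> (real^'n \<Rightarrow> real) \<Rightarrow> (real^'n \<Rightarrow> real^'m)
    \<Rightarrow> real^'n \<Rightarrow> ereal" where
  "objective f \<phi> \<psi> g x = f x + ereal (\<phi> x) - ereal (\<psi> x) + ind_fun nonpos_orthant (g x)"

text \<open>The gradient of the extended-real-valued \<open>f\<close> at a point near which \<open>f\<close> is finite.\<close>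

definition egrad :: "('a::euclidean_space \<Rightarrow> ereal) \<Rightarrow> 'a \<Rightarrow> 'a" where
  "egrad f = grad (\<lambda>x. real_of_ereal (f x))"

definition strong_stationary ::
  "(real^'n \<Rightarrow> ereal) \<Rightarrow> (real^'n \<Rightarrow> real) \<Rightarrow> (real^'n \<Rightarrow> real) \<Rightarrow> (real^'n \<Rightarrow> real^'m)
    \<Rightarrow> (real^'n) set" where
  "strong_stationary f \<phi> \<psi> g = {x \<in> feasible g.
     \<exists>v \<in> limiting_subdiff (\<lambda>x. ereal (\<phi> x)) x.
     \<exists>\<xi> \<in> limiting_subdiff (\<lambda>x. ereal (- \<psi> x)) x.
     \<exists>\<zeta> \<in> limiting_normal_cone nonpos_orthant (g x).
       0 = egrad f x + v + \<xi> + nabla g x \<zeta>}"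

locale mba_problem =
  fixes f :: "real^'n \<Rightarrow> ereal"
    and \<phi> \<psi> :: "real^'n \<Rightarrow> real"
    and g :: "real^'n \<Rightarrow> real^'m"
    and \<O> :: "(real^'n) set"
  assumes g_C11: "C11_on UNIV g"
    and feasible_nonempty: "feasible g \<noteq> {}"
    and f_proper: "proper_fun f"
    and f_lsc: "lsc_fun f"
    and \<O>_open: "open \<O>"
    and \<O>_convex: "convex \<O>"
    and feasible_subset: "feasible g \<subseteq> \<O>"
    and f_finite: "\<And>x. x \<in> \<O> \<Longrightarrow> f x \<noteq> \<infinity>"
    and f_C11: "C11_on \<O> (\<lambda>x. real_of_ereal (f x))"
    and \<phi>_convex: "convex_on UNIV \<phi>"
    and \<psi>_convex: "convex_on UNIV \<psi>"
    and objective_bdd_below: "(INF x\<in>feasible g. objective f \<phi> \<psi> g x) > -\<infinity>"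


section \<open>The inexact moving balls approximation method\<close>

definition mba_G :: "(real^'n \<Rightarrow> real^'m) \<Rightarrow> real^'n \<Rightarrow> real^'n \<Rightarrow> real^'m \<Rightarrow> real^'m" where
  "mba_G g x s L = g s + frechet_derivative g (at s) (x - s) + ((norm (x - s))\<^sup>2 / 2) *\<^sub>R L"

text \<open>\<open>s\<close> is the current iterate \<open>x\<^sup>k\<close>.\<close>

definition mba_vartheta ::
  "(real^'n \<Rightarrow> ereal) \<Rightarrow> (real^'n \<Rightarrow> real) \<Rightarrow> real^'n \<Rightarrow> real^'n \<Rightarrow> ((real^'n) \<Rightarrow>\<^sub>L (real^'n))
    \<Rightarrow> real^'n \<Rightarrow> real" where
  "mba_vartheta f \<psi> s \<xi> Q x =
     real_of_ereal (f s) - \<psi> s + (egrad f s + \<xi>) \<bullet> (x - s) + (x - s) \<bullet> Q (x - s) / 2"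

definition mba_model ::
  "(real^'n \<Rightarrow> ereal) \<Rightarrow> (real^'n \<Rightarrow> real) \<Rightarrow> (real^'n \<Rightarrow> real) \<Rightarrow> real^'n \<Rightarrow> real^'n
    \<Rightarrow> ((real^'n) \<Rightarrow>\<^sub>L (real^'n)) \<Rightarrow> real^'n \<Rightarrow> real" where
  "mba_model f \<phi> \<psi> s \<xi> Q x = mba_vartheta f \<psi> s \<xi> Q x + \<phi> x"

definition mba_Gamma :: "(real^'n \<Rightarrow> real^'m) \<Rightarrow> real^'n \<Rightarrow> real^'m \<Rightarrow> (real^'n) set" where
  "mba_Gamma g s L = {x. mba_G g x s L \<in> nonpos_orthant}"

definition mba_residual ::
  "(real^'n \<Rightarrow> ereal) \<Rightarrow> (real^'n \<Rightarrow> real) \<Rightarrow> (real^'n \<Rightarrow> real^'m) \<Rightarrow> real^'n \<Rightarrow> real^'n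
    \<Rightarrow> ((real^'n) \<Rightarrow>\<^sub>L (real^'n)) \<Rightarrow> real^'m \<Rightarrow> real^'n \<Rightarrow> real^'n \<Rightarrow> real^'m \<Rightarrow> real" where
  "mba_residual f \<psi> g s \<xi> Q L x v lam =
     (let r = grad (mba_vartheta f \<psi> s \<xi> Q) x + v + nabla (\<lambda>x. mba_G g x s L) x lam
      in max 0 (x \<bullet> r) + max 0 (- (lam \<bullet> mba_G g x s L)) + norm r
           + infnorm (pos_part (mba_G g x s L)))"

definition mba_accept ::
  "(real^'n \<Rightarrow> ereal) \<Rightarrow> (real^'n \<Rightarrow> real) \<Rightarrow> (real^'n \<Rightarrow> real) \<Rightarrow> (real^'n \<Rightarrow> real^'m)
    \<Rightarrow> real \<Rightarrow> real^'n \<Rightarrow> real^'n \<Rightarrow> bool" where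
  "mba_accept f \<phi> \<psi> g \<alpha> s y \<longleftrightarrow> g y \<in> nonpos_orthant \<and>
     objective f \<phi> \<psi> g y \<le> objective f \<phi> \<psi> g s - ereal (\<alpha> / 2 * (norm (y - s))\<^sup>2)"

text \<open>A run of the method. The data with indices \<open>k j\<close> belong to the \<open>j\<close>-th step of the
  \<open>k\<close>-th inner loop, which is left at \<open>j = jk k\<close>; their values for \<open>j > jk k\<close> are
  irrelevant. The model is strongly convex, so its minimizer \<open>xbar k j\<close> on the convex set
  \<open>mba_Gamma g (x k) (L k j)\<close> is unique.\<close>

locale inexact_mba = mba_problem f \<phi> \<psi> g \<O>
  for f :: "real^'n \<Rightarrow> ereal"
    and \<phi> \<psi> :: "real^'n \<Rightarrow> real"
    and g :: "real^'n \<Rightarrow> real^'m"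
    and \<O> :: "(real^'n) set" +
  fixes \<mu>min \<mu>max Lmin Lmax M \<beta>R \<beta>F \<alpha> \<tau> :: real
    and x \<xi> :: "nat \<Rightarrow> real^'n"
    and jk :: "nat \<Rightarrow> nat"
    and \<mu> :: "nat \<Rightarrow> nat \<Rightarrow> real"
    and L :: "nat \<Rightarrow> nat \<Rightarrow> real^'m"
    and Q :: "nat \<Rightarrow> nat \<Rightarrow> (real^'n) \<Rightarrow>\<^sub>L (real^'n)"
    and xbar y v :: "nat \<Rightarrow> nat \<Rightarrow> real^'n"
    and lam :: "nat \<Rightarrow> nat \<Rightarrow> real^'m"
  assumes \<mu>_bounds: "0 < \<mu>min" "\<mu>min \<le> \<mu>max"
    and L_bounds: "0 < Lmin" "Lmin \<le> Lmax"
    and params_pos: "0 < M" "0 < \<beta>R" "0 < \<beta>F" "0 < \<alpha>" "1 < \<tau>"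
    and x_0: "x 0 \<in> feasible g"
    and \<xi>_subgrad: "\<And>k. \<xi> k \<in> limiting_subdiff (\<lambda>x. ereal (- \<psi> x)) (x k)"
    and \<mu>_init: "\<And>k. \<mu> k 0 \<in> {\<mu>min..\<mu>max}"
    and L_init: "\<And>k i. L k 0 $ i \<in> {Lmin..Lmax}"
    and Q_self_adjoint: "\<And>k j. j \<le> jk k \<Longrightarrow> self_adjoint (Q k j)"
    and Q_lower: "\<And>k j. j \<le> jk k \<Longrightarrow> loewner_le (\<mu> k j *\<^sub>R id_blinfun) (Q k j)"
    and Q_upper: "\<And>k j. j \<le> jk k \<Longrightarrow> loewner_le (Q k j) ((\<mu> k j + M) *\<^sub>R id_blinfun)"
    and xbar_minimizer: "\<And>k j. j \<le> jk k \<Longrightarrow>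
        is_arg_min (mba_model f \<phi> \<psi> (x k) (\<xi> k) (Q k j))
          (\<lambda>z. z \<in> mba_Gamma g (x k) (L k j)) (xbar k j)"
    and v_subgrad: "\<And>k j. j \<le> jk k \<Longrightarrow> v k j \<in> limiting_subdiff (\<lambda>x. ereal (\<phi> x)) (y k j)"
    and lam_nonneg: "\<And>k j. j \<le> jk k \<Longrightarrow> lam k j \<in> nonneg_orthant"
    and inexact_residual: "\<And>k j. j \<le> jk k \<Longrightarrow>
        mba_residual f \<psi> g (x k) (\<xi> k) (Q k j) (L k j) (y k j) (v k j) (lam k j)
          \<le> \<beta>R / 2 * (norm (y k j - x k))\<^sup>2"
    and inexact_descent: "\<And>k j. j \<le> jk k \<Longrightarrow>
        mba_model f \<phi> \<psi> (x k) (\<xi> k) (Q k j) (y k j) \<le> mba_model f \<phi> \<psi> (x k) (\<xi> k) (Q k j) (x k)"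
    and inexact_gap: "\<And>k j. j \<le> jk k \<Longrightarrow>
        mba_model f \<phi> \<psi> (x k) (\<xi> k) (Q k j) (y k j)
          - mba_model f \<phi> \<psi> (x k) (\<xi> k) (Q k j) (xbar k j) \<le> \<beta>F / 2 * (norm (y k j - x k))\<^sup>2"
    and inner_exit: "\<And>k. mba_accept f \<phi> \<psi> g \<alpha> (x k) (y k (jk k))"
    and inner_continue: "\<And>k j. j < jk k \<Longrightarrow> \<not> mba_accept f \<phi> \<psi> g \<alpha> (x k) (y k j)"
    and update_infeasible: "\<And>k j. j < jk k \<Longrightarrow> g (y k j) \<notin> nonpos_orthant \<Longrightarrow>
        L k (Suc j) = \<tau> *\<^sub>R L k j \<and> \<mu> k (Suc j) = \<mu> k j"
    and update_feasible: "\<And>k j. j < jk k \<Longrightarrow> g (y k j) \<in> nonpos_orthant \<Longrightarrow>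
        L k (Suc j) = L k j \<and> \<mu> k (Suc j) = \<tau> * \<mu> k j"
    and x_Suc: "\<And>k. x (Suc k) = y k (jk k)"


section \<open>Partial bounded multiplier property\<close>

definition bmp_U :: "((real^'m) \<times> ((real^'n) \<Rightarrow>\<^sub>L (real^'n)) \<times> (real^'n) \<times> (real^'n)) set" where
  "bmp_U = nonneg_orthant \<times> pos_def_maps \<times> UNIV \<times> UNIV"

definition bmp_H ::
  "(real^'n \<Rightarrow> real^'m) \<Rightarrow> (real^'m) \<times> ((real^'n) \<Rightarrow>\<^sub>L (real^'n)) \<times> (real^'n) \<times> (real^'n)
    \<Rightarrow> real^'n \<Rightarrow> real^'m" where
  "bmp_H g u x = (case u of (L, Q, \<xi>, s) \<Rightarrow> mba_G g x s L)"

definition bmp_S ::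
  "(real^'n \<Rightarrow> real^'m) \<Rightarrow> (real^'m) \<times> ((real^'n) \<Rightarrow>\<^sub>L (real^'n)) \<times> (real^'n) \<times> (real^'n)
    \<Rightarrow> (real^'n) set" where
  "bmp_S g u = {x. bmp_H g u x \<in> nonpos_orthant}"

text \<open>Neighbourhoods of the parameter are relative to the parameter set \<open>bmp_U\<close>.\<close>

definition partial_BMP ::
  "(real^'n \<Rightarrow> real^'m) \<Rightarrow> (real^'m) \<times> ((real^'n) \<Rightarrow>\<^sub>L (real^'n)) \<times> (real^'n) \<times> (real^'n)
    \<Rightarrow> real^'n \<Rightarrow> bool" where
  "partial_BMP g u\<^sub>0 x\<^sub>0 \<longleftrightarrow> u\<^sub>0 \<in> bmp_U \<and> x\<^sub>0 \<in> bmp_S g u\<^sub>0 \<and>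
     (\<exists>\<kappa>>0. \<exists>\<U> \<V>. open \<U> \<and> u\<^sub>0 \<in> \<U> \<and> open \<V> \<and> x\<^sub>0 \<in> \<V> \<and>
        (\<forall>u \<in> \<U> \<inter> bmp_U. \<forall>x \<in> \<V> \<inter> bmp_S g u. \<forall>y \<in> limiting_normal_cone (bmp_S g u) x.
           \<exists>\<zeta> \<in> limiting_normal_cone nonpos_orthant (bmp_H g u x).
             nabla (bmp_H g u) x \<zeta> = y \<and> norm \<zeta> \<le> \<kappa> * norm y))"


section \<open>Potential function\<close>

text \<open>The argument \<open>L\<close> ranges over the open positive orthant. Extending the function by \<open>\<infinity>\<close> outside
  changes neither the subdifferentials nor the KL property at points of the domain.\<close>

definition potential ::
  "(real^'n \<Rightarrow> ereal) \<Rightarrow> (real^'n \<Rightarrow> real) \<Rightarrow> (real^'n \<Rightarrow> real) \<Rightarrow> (real^'n \<Rightarrow> real^'m)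
    \<Rightarrow> (real^'n) \<times> (real^'n) \<times> (real^'m) \<times> (real^'n) \<Rightarrow> ereal" where
  "potential f \<phi> \<psi> g z = (case z of (x, s, L, \<xi>) \<Rightarrow>
     if L \<in> pos_orthant then
       f x + ereal (\<phi> x) + ind_fun nonpos_orthant (mba_G g x s L) + ereal (x \<bullet> \<xi>)
         + conjugate_fun \<psi> (- \<xi>)
     else \<infinity>)"

definition potential_c ::
  "(real^'n \<Rightarrow> ereal) \<Rightarrow> (real^'n \<Rightarrow> real) \<Rightarrow> (real^'n \<Rightarrow> real) \<Rightarrow> (real^'n \<Rightarrow> real^'m)
    \<Rightarrow> real \<Rightarrow> ((real^'n) \<times> (real^'n) \<times> (real^'m) \<times> (real^'n)) \<times> (real^'n) \<Rightarrow> ereal" where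
  "potential_c f \<phi> \<psi> g c w = (case w of (z, d) \<Rightarrow>
     potential f \<phi> \<psi> g z + ereal (c * (norm d)\<^sup>2))"

end

(* The potential Phi_c(w^k) is squeezed between F(x^(k+1)) and F(x^k) + C |x^(k+1) - x^k|^2, so it
   converges to lim F(x^k), which is also its value at every cluster point of w^k. The exact
   minimizer of the model has a multiplier, by convex separation and the BMP, and these multipliers
   are bounded along the run because the data u^k are bounded: L^k cannot grow since g' is Lipschitz
   on a ball containing all trial points. Freezing the multiplier gives a smooth minorant of Phi_c
   that touches it at w^k; its gradient is a subgradient of size O(|x^(k+1) - x^k|). With the
   sufficient decrease of F, the KL inequality (used on a finite cover of the compact set of cluster
   points) bounds |x^(k+2) - x^(k+1)|^2 by |x^(k+1) - x^k| times a telescoping difference, whence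
   finite length. Stationarity is the limit of the optimality conditions of the exact minimizers. *)
theory Submission
  imports Defs
begin

section \<open>Convex analysis\<close>

text \<open>The potential is evaluated at the exact minimizer of the model because the accepted
  point may violate the model constraint, and there the indicator is infinite. The price is that
  only F, not the potential, is known to decrease. The KL inequality is therefore used at the
  potential value, and concavity of the desingularizing function carries it down to the smaller
  value F(x^(k+1)), whose decrements telescope. The term c |d|^2 pays for the distance between exact
  minimizer and accepted point and for the inexactness of the model value.

  The potential is a sum of several nonsmooth terms, so a sum rule for its subdifferential would
  need a qualification condition. A smooth minorant with equality at one point avoids this: its
  gradient is a regular subgradient. That gradient is small because the optimality condition of the
  model cancels every term that does not carry a factor xbar^k - x^k or x^(k+1) - x^k.

  In the limit, xi must stay in the limiting subdifferential of -psi, which can be smaller than the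
  negated convex subdifferential of psi. Hence global subgradient inequalities serve the estimates,
  but not the stationarity of the limit.\<close>

definition convex_subgradient :: "('a::euclidean_space \<Rightarrow> real) \<Rightarrow> 'a \<Rightarrow> 'a \<Rightarrow> bool" where
  "convex_subgradient h x v \<longleftrightarrow> (\<forall>y. h x + v \<bullet> (y - x) \<le> h y)"

lemma continuous_convex:
  fixes h :: "'a::euclidean_space \<Rightarrow> real"
  assumes "convex_on UNIV h"
  shows "continuous_on UNIV h"
  using convex_on_continuous[OF open_UNIV assms] .

lemma convex_subgradient_limit:
  fixes h :: "'a::euclidean_space \<Rightarrow> real"
  assumes "continuous_on UNIV h" "\<And>k. convex_subgradient h (xs k) (vs k)" "xs \<longlonglongrightarrow> x" "vs \<longlonglongrightarrow> v"
  shows "convex_subgradient h x v"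
  unfolding convex_subgradient_def
proof
  fix y
  have "(\<lambda>k. h (xs k)) \<longlonglongrightarrow> h x"
    using continuous_on_tendsto_compose[OF assms(1) assms(3)] by simp
  then have "(\<lambda>k. h (xs k) + vs k \<bullet> (y - xs k)) \<longlonglongrightarrow> h x + v \<bullet> (y - x)"
    by (intro tendsto_intros assms)
  then show "h x + v \<bullet> (y - x) \<le> h y"
    by (rule LIMSEQ_le_const2) (use assms(2) in \<open>auto simp: convex_subgradient_def\<close>)
qed

lemma continuous_bounded_on_ball:
  fixes h :: "'a::euclidean_space \<Rightarrow> real"
  assumes "continuous_on UNIV h"
  obtains b where "\<And>x. norm x \<le> r \<Longrightarrow> \<bar>h x\<bar> \<le> b"
proof -
  have "compact (h ` cball 0 r)"
    using assms by (intro compact_continuous_image) (auto intro: continuous_on_subset)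
  then have "bounded (h ` cball 0 r)" by (rule compact_imp_bounded)
  then obtain b where "\<forall>x\<in>cball 0 r. norm (h x) \<le> b" by (auto simp: bounded_iff)
  then show ?thesis using that[of b] by simp
qed

text \<open>Testing the subgradient inequality at \<open>x + sgn v\<close> recovers
  \<open>norm v\<close> as a lower bound for a difference of two values of \<open>h\<close> on the
  ball of radius \<open>r + 1\<close>, where \<open>h\<close> is bounded by continuity.\<close>

lemma convex_subgradient_bounded:
  fixes h :: "'a::euclidean_space \<Rightarrow> real"
  assumes "convex_on UNIV h"
  obtains B where "\<And>x v. norm x \<le> r \<Longrightarrow> convex_subgradient h x v \<Longrightarrow> norm v \<le> B"
proof -
  obtain b where b: "\<And>x. norm x \<le> r + 1 \<Longrightarrow> \<bar>h x\<bar> \<le> b"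
    using continuous_bounded_on_ball[OF continuous_convex[OF assms]] by metis
  have "norm v \<le> 2 * b" if "norm x \<le> r" "convex_subgradient h x v" for x v
  proof -
    have "norm (x + sgn v) \<le> norm x + norm (sgn v)" by (rule norm_triangle_ineq)
    also have "\<dots> \<le> r + 1" using that by (auto simp: norm_sgn)
    finally have "\<bar>h (x + sgn v)\<bar> \<le> b" by (rule b)
    moreover have "\<bar>h x\<bar> \<le> b" using that by (intro b) simp
    moreover have "h x + v \<bullet> sgn v \<le> h (x + sgn v)"
      using that(2)[unfolded convex_subgradient_def, rule_format, of "x + sgn v"] by simp
    moreover have "v \<bullet> sgn v = norm v"
      by (cases "v = 0") (simp_all add: sgn_div_norm dot_square_norm power2_eq_square)
    ultimately show ?thesis by linarith
  qed
  then show ?thesis using that by blast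
qed

text \<open>Slopes of a convex function increase along a ray, so the slope from \<open>x\<close> to
  a far point \<open>y\<close> is at least the slope to the point \<open>p\<close> at distance one,
  which the bound for \<open>h\<close> on a ball controls. This keeps \<phi> from outweighing the
  quadratic term of the model.\<close>

lemma convex_on_lower_linear:
  fixes h :: "'a::euclidean_space \<Rightarrow> real"
  assumes "convex_on UNIV h"
  obtains B where "0 \<le> B" "\<And>x y. norm x \<le> r \<Longrightarrow> 1 \<le> norm (y - x) \<Longrightarrow> - B * norm (y - x) \<le> h y - h x"
proof -
  obtain b where b: "\<And>x. norm x \<le> r + 1 \<Longrightarrow> \<bar>h x\<bar> \<le> b"
    using continuous_bounded_on_ball[OF continuous_convex[OF assms]] by metis
  have "- (2 * \<bar>b\<bar>) * norm (y - x) \<le> h y - h x" if "norm x \<le> r" "1 \<le> norm (y - x)" for x y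
  proof -
    define n where "n = norm (y - x)"
    define p where "p = x + (1 / n) *\<^sub>R (y - x)"
    have n: "1 \<le> n" using that by (simp add: n_def)
    have "norm (p - x) = (1 / n) * n" using n by (simp add: p_def flip: n_def)
    then have "norm (p - x) = 1" using n by simp
    then have "norm p \<le> r + 1"
      using norm_triangle_sub[of p x] that by linarith
    then have "\<bar>h p\<bar> \<le> b" by (rule b)
    moreover have "\<bar>h x\<bar> \<le> b" using that by (intro b) simp
    moreover have "h p \<le> (1 - 1 / n) * h x + (1 / n) * h y"
      using convex_onD[OF assms, of "1/n" x y] n
      by (simp add: p_def scaleR_diff_left scaleR_diff_right algebra_simps)
    then have "n * h p \<le> n * ((1 - 1 / n) * h x + (1 / n) * h y)" using n by (intro mult_left_mono) auto
    then have "n * (h p - h x) \<le> h y - h x" using n by (simp add: algebra_simps)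
    moreover have "n * (- (2 * \<bar>b\<bar>)) \<le> n * (h p - h x)"
      using n calculation by (intro mult_left_mono) auto
    ultimately show ?thesis by (simp add: n_def mult.commute)
  qed
  then show ?thesis using that[of "2 * \<bar>b\<bar>"] by auto
qed

text \<open>Separation of the strict epigraph of \<open>\<lambda>z. q \<bullet> (z - x) + h z - h x\<close> from \<open>C \<times> (-\<infinity>, 0]\<close>;
  as \<open>h\<close> is finite everywhere, the separating hyperplane is not vertical.\<close>

lemma convex_optimality:
  fixes h :: "'a::euclidean_space \<Rightarrow> real"
  assumes h: "convex_on UNIV h" and C: "convex C" "x \<in> C"
    and min: "\<And>z. z \<in> C \<Longrightarrow> 0 \<le> q \<bullet> (z - x) + h z - h x"
  shows "\<exists>v. convex_subgradient h x v \<and> (\<forall>z\<in>C. 0 \<le> (q + v) \<bullet> (z - x))"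
proof -
  define A where "A = {(z, t). q \<bullet> (z - x) + h z - h x < t}"
  define B where "B = C \<times> {..0::real}"
  have "convex_on UNIV (\<lambda>z. q \<bullet> (z - x) + h z - h x)"
  proof (rule convex_onI)
    fix t :: real and a b :: 'a assume "0 < t" "t < 1"
    then have "h ((1 - t) *\<^sub>R a + t *\<^sub>R b) \<le> (1 - t) * h a + t * h b"
      using convex_onD[OF h, of t a b] by simp
    then show "q \<bullet> ((1 - t) *\<^sub>R a + t *\<^sub>R b - x) + h ((1 - t) *\<^sub>R a + t *\<^sub>R b) - h x
      \<le> (1 - t) * (q \<bullet> (a - x) + h a - h x) + t * (q \<bullet> (b - x) + h b - h x)"
      by (simp add: inner_simps algebra_simps)
  qed simp
  note c = this
  have "convex A"
    unfolding convex_alt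
  proof (intro ballI allI impI)
    fix p r and u :: real assume a: "p \<in> A" "r \<in> A" "0 \<le> u \<and> u \<le> 1"
    obtain z t z' t' where p: "p = (z, t)" and r: "r = (z', t')" by fastforce
    let ?h = "\<lambda>z. q \<bullet> (z - x) + h z - h x"
    have "?h ((1 - u) *\<^sub>R z + u *\<^sub>R z') \<le> (1 - u) * ?h z + u * ?h z'"
      using convex_onD[OF c, of u z z'] a by simp
    also have "\<dots> < (1 - u) * t + u * t'"
    proof (cases "u = 0")
      case True then show ?thesis using a by (simp add: A_def p r)
    next
      case False
      then have "(1 - u) * ?h z \<le> (1 - u) * t" "u * ?h z' < u * t'"
        using a by (auto simp: A_def p r intro!: mult_left_mono)
      then show ?thesis by linarith
    qed
    finally show "(1 - u) *\<^sub>R p + u *\<^sub>R r \<in> A" by (simp add: A_def p r)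
  qed
  moreover have "convex B" unfolding B_def by (intro convex_Times C) simp
  moreover have "(x, 1) \<in> A" by (simp add: A_def)
  moreover have "(x, 0) \<in> B" using C by (simp add: B_def)
  moreover have "A \<inter> B = {}" using min by (force simp: A_def B_def)
  ultimately obtain a b where ab: "a \<noteq> 0" "\<forall>w\<in>A. a \<bullet> w \<le> b" "\<forall>w\<in>B. a \<bullet> w \<ge> b"
    using separating_hyperplane_sets[of A B] by blast
  obtain a1 a2 where a: "a = (a1, a2)" by fastforce
  have upper: "a1 \<bullet> z + a2 * t \<le> b" if "q \<bullet> (z - x) + h z - h x < t" for z t
    using bspec[OF ab(2), of "(z, t)"] that by (simp add: A_def a inner_Pair)
  have lower: "b \<le> a1 \<bullet> z + a2 * t" if "z \<in> C" "t \<le> 0" for z t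
    using bspec[OF ab(3), of "(z, t)"] that by (simp add: B_def a inner_Pair)
  have "a2 \<le> 0"
    using upper[of x 1] lower[OF \<open>x \<in> C\<close>, of 0] by simp
  moreover have "a2 \<noteq> 0"
  proof
    assume 0: "a2 = 0"
    have le: "a1 \<bullet> z \<le> b" for z
      using upper[of z "q \<bullet> (z - x) + h z - h x + 1"] 0 by simp
    have ge: "b \<le> a1 \<bullet> x" using lower[OF \<open>x \<in> C\<close>, of 0] by simp
    have "a1 \<bullet> a1 \<le> 0" using le[of "x + a1"] ge by (simp add: inner_simps)
    then have "a1 = 0" by (metis inner_gt_zero_iff not_less)
    then show False using \<open>a \<noteq> 0\<close> a 0 by (simp add: zero_prod_def)
  qed
  ultimately have a2: "a2 < 0" by simp
  \<comment> \<open>\<open>A\<close> is a strict epigraph, so the hyperplane bound holds only above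
    the graph. Raising the height by \<open>e / (- a2)\<close> changes the functional by exactly
    \<open>e\<close>, and \<open>e\<close> is arbitrary.\<close>
  have upper': "a1 \<bullet> z + a2 * (q \<bullet> (z - x) + h z - h x) \<le> b" for z
  proof (rule field_le_epsilon)
    fix e :: real assume "0 < e"
    then have "a1 \<bullet> z + a2 * (q \<bullet> (z - x) + h z - h x + e / (- a2)) \<le> b"
      using a2 by (intro upper) (simp add: divide_pos_neg)
    moreover have "a2 * (q \<bullet> (z - x) + h z - h x + e / (- a2)) = a2 * (q \<bullet> (z - x) + h z - h x) - e"
      using a2 by (simp add: right_diff_distrib)
    ultimately show "a1 \<bullet> z + a2 * (q \<bullet> (z - x) + h z - h x) \<le> b + e" by linarith
  qed
  have b: "b = a1 \<bullet> x"
    using upper'[of x] lower[OF \<open>x \<in> C\<close>, of 0] by simp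
  \<comment> \<open>Normalizing the non-vertical hyperplane to a graph: \<open>w\<close> is the
    slope of an affine minorant of \<open>q \<bullet> (z - x) + h z - h x\<close> touching at
    \<open>x\<close>, so \<open>w - q\<close> is a subgradient of \<open>h\<close>.\<close>
  define w where "w = (1 / (- a2)) *\<^sub>R a1"
  have "w \<bullet> (z - x) \<le> q \<bullet> (z - x) + h z - h x" for z
  proof -
    have "a1 \<bullet> (z - x) \<le> (- a2) * (q \<bullet> (z - x) + h z - h x)"
      using upper'[of z] b by (simp add: inner_simps)
    then show ?thesis using a2 by (simp add: w_def field_simps)
  qed
  then have "convex_subgradient h x (w - q)"
    by (simp add: convex_subgradient_def inner_diff_left add_diff_eq) (smt (verit))
  moreover have "0 \<le> (q + (w - q)) \<bullet> (z - x)" if "z \<in> C" for z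
  proof -
    have "a1 \<bullet> x \<le> a1 \<bullet> z" using lower[OF that, of 0] b by simp
    then have "0 \<le> a1 \<bullet> (z - x)" by (simp add: inner_diff_right)
    then show ?thesis using a2 by (simp add: w_def field_simps)
  qed
  ultimately show ?thesis by blast
qed

section \<open>Subdifferentials and normal cones\<close>

text \<open>The difference quotient of \<open>h\<close> dominates that of \<open>m\<close>, and the
  latter tends to 0 by differentiability. Subgradients of the potential are produced in this way,
  without any sum rule.\<close>

lemma regular_subdiff_minorant:
  fixes h :: "'a::euclidean_space \<Rightarrow> ereal"
  assumes ev: "eventually (\<lambda>y. ereal (m y) \<le> h y) (at x)" and eq: "h x = ereal (m x)"
    and m: "GDERIV m x :> p"
  shows "p \<in> regular_subdiff h x"
proof -
  have "((\<lambda>y. ereal ((m y - m x - p \<bullet> (y - x)) / norm (y - x))) \<longlongrightarrow> ereal 0) (at x)"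
    using m by (simp add: gderiv_def has_derivative_at_within inner_commute divide_inverse mult.commute)
  then have "0 = Liminf (at x) (\<lambda>y. ereal ((m y - m x - p \<bullet> (y - x)) / norm (y - x)))"
    unfolding zero_ereal_def by (intro lim_imp_Liminf[symmetric]) simp_all
  also have "\<dots> \<le> Liminf (at x) (\<lambda>y. (h y - h x - ereal (p \<bullet> (y - x))) / ereal (norm (y - x)))"
  proof (rule Liminf_mono)
    show "\<forall>\<^sub>F y in at x. ereal ((m y - m x - p \<bullet> (y - x)) / norm (y - x))
      \<le> (h y - h x - ereal (p \<bullet> (y - x))) / ereal (norm (y - x))"
      using ev eventually_neq_at_within[of x x]
    proof eventually_elim
      case (elim y)
      then have "ereal (m y) - ereal (m x) - ereal (p \<bullet> (y - x)) \<le> h y - ereal (m x) - ereal (p \<bullet> (y - x))"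
        by (intro ereal_minus_mono) auto
      then have "(ereal (m y) - ereal (m x) - ereal (p \<bullet> (y - x))) / ereal (norm (y - x))
        \<le> (h y - ereal (m x) - ereal (p \<bullet> (y - x))) / ereal (norm (y - x))"
        using elim by (intro ereal_divide_right_mono) auto
      then show ?case using elim eq by simp
    qed
  qed
  finally show ?thesis using eq by (simp add: regular_subdiff_def)
qed

lemma regular_subset_limiting_subdiff: "regular_subdiff h x \<subseteq> limiting_subdiff h x"
proof
  fix v assume v: "v \<in> regular_subdiff h x"
  then have "\<bar>h x\<bar> \<noteq> \<infinity>" by (simp add: regular_subdiff_def)
  with v show "v \<in> limiting_subdiff h x"
    unfolding limiting_subdiff_def by (intro CollectI conjI exI[of _ "\<lambda>_. x"] exI[of _ "\<lambda>_. v"]) auto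
qed

lemma convex_subgradient_imp_limiting_subdiff:
  assumes "convex_subgradient h x v"
  shows "v \<in> limiting_subdiff (\<lambda>x. ereal (h x)) x"
proof -
  have "v \<in> regular_subdiff (\<lambda>x. ereal (h x)) x"
  proof (rule regular_subdiff_minorant[where m = "\<lambda>y. h x + v \<bullet> (y - x)"])
    show "GDERIV (\<lambda>y. h x + v \<bullet> (y - x)) x :> v"
      unfolding gderiv_def by (auto intro!: derivative_eq_intros simp: inner_commute)
  qed (use assms in \<open>auto simp: convex_subgradient_def\<close>)
  then show ?thesis using regular_subset_limiting_subdiff by blast
qed

lemma eventually_at_right_pos: "0 < e \<Longrightarrow> eventually (\<lambda>t. 0 < t \<and> t < e) (at_right (0::real))"
  by (auto simp: eventually_at_right_field)

text \<open>The lower limit is restricted to the ray in direction \<open>d\<close>. The denominator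
  there is \<open>t * norm d\<close>, which is why the tolerance is first divided by
  \<open>norm d\<close>.\<close>

lemma regular_subdiff_realD:
  fixes h :: "'a::euclidean_space \<Rightarrow> real"
  assumes v: "v \<in> regular_subdiff (\<lambda>x. ereal (h x)) x" and e: "0 < e"
  shows "eventually (\<lambda>t. h (x + t *\<^sub>R d) - h x - t * (v \<bullet> d) \<ge> - e * t) (at_right 0)"
proof (cases "d = 0")
  case True
  show ?thesis using eventually_at_right_pos[OF zero_less_one] by eventually_elim (use True e in auto)
next
  case False
  define e' where "e' = e / norm d"
  have e': "0 < e'" using e False by (simp add: e'_def)
  have "0 \<le> Liminf (at x) (\<lambda>y. (ereal (h y) - ereal (h x) - ereal (v \<bullet> (y - x))) / ereal (norm (y - x)))"
    using v by (simp add: regular_subdiff_def)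
  then have "eventually (\<lambda>y. ereal (- e') < (ereal (h y) - ereal (h x) - ereal (v \<bullet> (y - x))) / ereal (norm (y - x))) (at x)"
    using e' by (auto simp: le_Liminf_iff)
  moreover have "filterlim (\<lambda>t. x + t *\<^sub>R d) (at x) (at_right 0)"
    unfolding filterlim_at
  proof
    show "((\<lambda>t. x + t *\<^sub>R d) \<longlongrightarrow> x) (at_right 0)" by (auto intro!: tendsto_eq_intros)
    show "\<forall>\<^sub>F t in at_right 0. x + t *\<^sub>R d \<in> UNIV \<and> x + t *\<^sub>R d \<noteq> x"
      using eventually_at_right_pos[OF zero_less_one] by eventually_elim (use False in auto)
  qed
  ultimately have "eventually (\<lambda>t. ereal (- e') < (ereal (h (x + t *\<^sub>R d)) - ereal (h x) - ereal (v \<bullet> (x + t *\<^sub>R d - x))) / ereal (norm (x + t *\<^sub>R d - x))) (at_right 0)"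
    by (rule eventually_compose_filterlim)
  then show ?thesis
    using eventually_at_right_pos[OF zero_less_one]
    by eventually_elim (use False in \<open>simp add: e'_def field_simps\<close>)
qed

text \<open>Convexity at the midpoint \<open>x\<close> of \<open>x + t (x - y)\<close> and \<open>x + t (y - x)\<close> turns the upper
  estimate in direction \<open>x - y\<close> into a lower estimate in direction \<open>y - x\<close>.\<close>

lemma regular_subdiff_concave:
  fixes h :: "'a::euclidean_space \<Rightarrow> real"
  assumes "convex_on UNIV h" "v \<in> regular_subdiff (\<lambda>x. ereal (- h x)) x"
  shows "convex_subgradient h x (- v)"
  unfolding convex_subgradient_def
proof
  fix y
  show "h x + (- v) \<bullet> (y - x) \<le> h y"
  proof (rule field_le_epsilon)
    fix e :: real assume e: "0 < e"
    have "eventually (\<lambda>t. - h (x + t *\<^sub>R (x - y)) - (- h x) - t * (v \<bullet> (x - y)) \<ge> - e * t \<and> 0 < t \<and> t < 1) (at_right 0)"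
      using regular_subdiff_realD[OF assms(2) e, of "x - y"] eventually_at_right_pos[OF zero_less_one]
      by eventually_elim auto
    then obtain t where t: "- h (x + t *\<^sub>R (x - y)) - (- h x) - t * (v \<bullet> (x - y)) \<ge> - e * t" "0 < t" "t < 1"
      using eventually_happens'[OF trivial_limit_at_right_real] by blast
    have "h x \<le> (1 / 2) * h (x + t *\<^sub>R (x - y)) + (1 / 2) * h (x + t *\<^sub>R (y - x))"
    proof -
      have "(1 / 2) *\<^sub>R (x + t *\<^sub>R (x - y)) + (1 / 2) *\<^sub>R (x + t *\<^sub>R (y - x)) = x"
      proof -
        have "(1 / 2) *\<^sub>R (x + t *\<^sub>R (x - y)) + (1 / 2) *\<^sub>R (x + t *\<^sub>R (y - x)) = (1 / 2) *\<^sub>R (x + x)"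
          unfolding scaleR_add_right[symmetric] by (simp add: algebra_simps)
        then show ?thesis by simp
      qed
      then show ?thesis
        using convex_onD[OF assms(1), of "1/2" "x + t *\<^sub>R (x - y)" "x + t *\<^sub>R (y - x)"] by simp
    qed
    moreover have "h (x + t *\<^sub>R (y - x)) \<le> (1 - t) * h x + t * h y"
      using convex_onD[OF assms(1), of t x y] t by (simp add: algebra_simps)
    ultimately have "t * (h x + (- v) \<bullet> (y - x)) \<le> t * (h y + e)"
      using t by (simp add: algebra_simps)
    then show "h x + (- v) \<bullet> (y - x) \<le> h y + e" using t by simp
  qed
qed

text \<open>A regular subgradient of a concave function yields a global inequality, and such
  inequalities survive limits. So each chosen \<xi> gives a supporting affine function of \<psi>,
  which later bounds \<xi>, evaluates the conjugate and linearizes \<psi>.\<close>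

lemma limiting_subdiff_concave:
  fixes h :: "'a::euclidean_space \<Rightarrow> real"
  assumes h: "convex_on UNIV h" and v: "v \<in> limiting_subdiff (\<lambda>x. ereal (- h x)) x"
  shows "convex_subgradient h x (- v)"
proof -
  obtain xs vs where "xs \<longlonglongrightarrow> x" "\<And>k. vs k \<in> regular_subdiff (\<lambda>x. ereal (- h x)) (xs k)" "vs \<longlonglongrightarrow> v"
    using v unfolding limiting_subdiff_def by blast
  then show ?thesis
    using convex_subgradient_limit[OF continuous_convex[OF h], of xs "\<lambda>k. - vs k" x "- v"]
      regular_subdiff_concave[OF h] tendsto_minus by blast
qed

text \<open>A diagonal choice: the regular subgradient picked for index \<open>k\<close> lies within
  \<open>inverse (Suc k)\<close> of the pair \<open>(xs k, vs k)\<close>, and continuity of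
  \<open>h\<close> makes the function values converge too. It is applied to -\<psi>, where the
  global inequality would not be enough: for \<psi> the absolute value, every slope in [-1, 1]
  satisfies it at 0, but only -1 and 1 are limiting subgradients of -\<psi>.\<close>

lemma limiting_subdiff_closed:
  fixes h :: "'a::euclidean_space \<Rightarrow> real"
  assumes cont: "continuous_on UNIV h" and v: "\<And>k. vs k \<in> limiting_subdiff (\<lambda>x. ereal (h x)) (xs k)"
    and "xs \<longlonglongrightarrow> x" "vs \<longlonglongrightarrow> v"
  shows "v \<in> limiting_subdiff (\<lambda>x. ereal (h x)) x"
proof -
  have "\<exists>a b. dist a (xs k) < inverse (Suc k) \<and> dist b (vs k) < inverse (Suc k)
    \<and> b \<in> regular_subdiff (\<lambda>x. ereal (h x)) a" for k
  proof -
    obtain as bs where ab: "as \<longlonglongrightarrow> xs k" "\<And>n. bs n \<in> regular_subdiff (\<lambda>x. ereal (h x)) (as n)" "bs \<longlonglongrightarrow> vs k"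
      using v[of k] unfolding limiting_subdiff_def by blast
    have "eventually (\<lambda>n. dist (as n) (xs k) < inverse (Suc k) \<and> dist (bs n) (vs k) < inverse (Suc k)) sequentially"
      by (intro eventually_conj tendstoD ab) simp_all
    then show ?thesis using ab(2) eventually_happens'[OF sequentially_bot] by blast
  qed
  then obtain as bs where ab: "\<And>k. dist (as k) (xs k) < inverse (Suc k)" "\<And>k. dist (bs k) (vs k) < inverse (Suc k)"
    "\<And>k. bs k \<in> regular_subdiff (\<lambda>x. ereal (h x)) (as k)" by metis
  have lim: "cs \<longlonglongrightarrow> c" if "\<And>k. dist (cs k) (ds k) < inverse (Suc k)" "ds \<longlonglongrightarrow> c" for cs ds :: "nat \<Rightarrow> 'a" and c
  proof -
    have "(\<lambda>k. cs k - ds k) \<longlonglongrightarrow> 0"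
      by (rule tendsto_norm_zero_cancel, rule tendsto_sandwich[OF _ _ tendsto_const LIMSEQ_inverse_real_of_nat])
        (use that(1) in \<open>auto simp: dist_norm intro!: always_eventually less_imp_le\<close>)
    from tendsto_add[OF this that(2)] show ?thesis by simp
  qed
  have "as \<longlonglongrightarrow> x" "bs \<longlonglongrightarrow> v" using lim ab assms(3,4) by blast+
  moreover from this have "(\<lambda>k. ereal (h (as k))) \<longlonglongrightarrow> ereal (h x)"
    using continuous_on_tendsto_compose[OF cont, of as x sequentially] by simp
  ultimately show ?thesis using ab(3) unfolding limiting_subdiff_def by auto
qed

section \<open>Normal cones, in particular of the nonpositive orthant\<close>

lemma convex_normal:
  assumes "x \<in> C" "\<And>z. z \<in> C \<Longrightarrow> v \<bullet> (z - x) \<le> 0"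
  shows "v \<in> limiting_normal_cone C x"
proof -
  have "Limsup (at x within C) (\<lambda>y. ereal ((v \<bullet> (y - x)) / norm (y - x))) \<le> 0"
    by (rule Limsup_bounded) (use assms(2) in \<open>auto simp: eventually_at_filter divide_nonpos_nonneg\<close>)
  then have "v \<in> regular_normal_cone C x" using assms(1) by (simp add: regular_normal_cone_def)
  then show ?thesis using assms(1)
    unfolding limiting_normal_cone_def by (intro CollectI conjI exI[of _ "\<lambda>_. x"] exI[of _ "\<lambda>_. v"]) auto
qed

text \<open>Along \<open>x + t *\<^sub>R d\<close> the normal quotient has the constant value
  \<open>v \<bullet> d / norm d\<close>, so its upper limit can be nonpositive only if that constant
  is.\<close>

lemma regular_normal_cone_direction:
  assumes v: "v \<in> regular_normal_cone C x" and d: "\<And>t. 0 < t \<Longrightarrow> t < e \<Longrightarrow> x + t *\<^sub>R d \<in> C" and e: "0 < e"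
  shows "v \<bullet> d \<le> 0"
proof (rule ccontr)
  assume "\<not> v \<bullet> d \<le> 0"
  then have pos: "0 < v \<bullet> d" by simp
  then have d0: "d \<noteq> 0" by auto
  define r where "r = v \<bullet> d / norm d"
  have r: "0 < r" using pos d0 by (simp add: r_def)
  have lim: "Limsup (at x within C) (\<lambda>y. ereal ((v \<bullet> (y - x)) / norm (y - x))) \<le> 0"
    using v by (simp add: regular_normal_cone_def)
  have "eventually (\<lambda>y. ereal ((v \<bullet> (y - x)) / norm (y - x)) < ereal r) (at x within C)"
    using lim[unfolded Limsup_le_iff, rule_format, of "ereal r"] r by simp
  moreover have "filterlim (\<lambda>t. x + t *\<^sub>R d) (at x within C) (at_right 0)"
    unfolding filterlim_at
  proof
    show "((\<lambda>t. x + t *\<^sub>R d) \<longlongrightarrow> x) (at_right 0)" by (auto intro!: tendsto_eq_intros)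
    show "\<forall>\<^sub>F t in at_right 0. x + t *\<^sub>R d \<in> C \<and> x + t *\<^sub>R d \<noteq> x"
      using eventually_at_right_pos[OF e] by eventually_elim (use d0 d in auto)
  qed
  ultimately have "eventually (\<lambda>t. ereal ((v \<bullet> (x + t *\<^sub>R d - x)) / norm (x + t *\<^sub>R d - x)) < ereal r) (at_right 0)"
    by (rule eventually_compose_filterlim)
  then have "eventually (\<lambda>t::real. False) (at_right 0)"
    using eventually_at_right_pos[OF zero_less_one]
    by eventually_elim (use d0 in \<open>simp add: r_def field_simps\<close>)
  then show False by simp
qed

text \<open>Decreasing a coordinate always stays in the orthant, which gives the sign. Increasing
  coordinate \<open>i\<close> is possible for steps below \<open>- w $ i\<close> when the constraint
  is inactive, which gives complementarity.\<close>

lemma regular_normal_cone_nonpos_orthant: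
  assumes v: "v \<in> regular_normal_cone nonpos_orthant w"
  shows "0 \<le> v $ i" "v $ i * w $ i = 0"
proof -
  have w: "w \<in> nonpos_orthant" using v by (simp add: regular_normal_cone_def)
  have "v \<bullet> (- axis i 1) \<le> 0"
  proof (rule regular_normal_cone_direction[OF v, of 1])
    fix t :: real assume "0 < t"
    then show "w + t *\<^sub>R (- axis i 1) \<in> nonpos_orthant"
      using w by (auto simp: nonpos_orthant_def axis_def intro: order_trans[OF _ less_imp_le])
  qed simp
  then show 1: "0 \<le> v $ i" by (simp add: inner_axis)
  show "v $ i * w $ i = 0"
  proof (cases "w $ i = 0")
    case False
    then have wi: "w $ i < 0" using w by (auto simp: nonpos_orthant_def less_le)
    have "v \<bullet> axis i 1 \<le> 0"
    proof (rule regular_normal_cone_direction[OF v, of "- w $ i"])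
      fix t assume "0 < t" "t < - w $ i"
      then show "w + t *\<^sub>R axis i 1 \<in> nonpos_orthant"
        using w by (auto simp: nonpos_orthant_def axis_def)
    qed (use wi in simp)
    then show ?thesis using 1 by (simp add: inner_axis)
  qed simp
qed

lemma limiting_normal_cone_nonpos_orthant:
  assumes v: "v \<in> limiting_normal_cone nonpos_orthant w"
  shows "v \<in> nonneg_orthant" "v \<bullet> w = 0"
proof -
  obtain xs vs where lim: "xs \<longlonglongrightarrow> w" "vs \<longlonglongrightarrow> v" and *: "\<And>k. vs k \<in> regular_normal_cone nonpos_orthant (xs k)"
    using v unfolding limiting_normal_cone_def by blast
  have l: "(\<lambda>k. vs k $ i) \<longlonglongrightarrow> v $ i" "(\<lambda>k. xs k $ i) \<longlonglongrightarrow> w $ i" for i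
    using lim by (auto intro: tendsto_vec_nth)
  have "0 \<le> v $ i" for i
    by (rule LIMSEQ_le_const[OF l(1)]) (use regular_normal_cone_nonpos_orthant[OF *] in auto)
  then show "v \<in> nonneg_orthant" by (simp add: nonneg_orthant_def)
  have "v $ i * w $ i = 0" for i
    using tendsto_mult[OF l(1)[of i] l(2)[of i]] regular_normal_cone_nonpos_orthant(2)[OF *]
    by (simp add: LIMSEQ_const_iff)
  then show "v \<bullet> w = 0" unfolding inner_vec_def by (intro sum.neutral) simp
qed

lemma nonneg_complementary_imp_normal:
  assumes "v \<in> nonneg_orthant" "v \<bullet> w = 0" "w \<in> nonpos_orthant"
  shows "v \<in> limiting_normal_cone nonpos_orthant w"
proof (rule convex_normal[OF assms(3)])
  fix z :: "real^'a" assume "z \<in> nonpos_orthant"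
  then have "v \<bullet> z \<le> 0" using assms(1)
    by (auto simp: inner_vec_def nonneg_orthant_def nonpos_orthant_def intro!: sum_nonpos mult_nonneg_nonpos)
  then show "v \<bullet> (z - w) \<le> 0" using assms(2) by (simp add: inner_diff_right)
qed

section \<open>Finite length from the Kurdyka-Lojasiewicz inequality\<close>

lemma cluster_pointI:
  fixes U :: "nat \<Rightarrow> 'a::metric_space"
  assumes "\<And>e. 0 < e \<Longrightarrow> \<exists>\<^sub>\<infinity>k. dist (U k) z < e"
  shows "z \<in> cluster_points U"
proof -
  have "\<exists>r. \<forall>n. dist (U (r n)) z < inverse (real (Suc n)) \<and> r n < r (Suc n)"
  proof (rule dependent_nat_choice)
    show "\<exists>k. dist (U k) z < inverse (real (Suc 0))"
      using assms[of "inverse (real (Suc 0))"] by (auto simp: INFM_nat)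
    show "\<exists>k'. dist (U k') z < inverse (real (Suc (Suc n))) \<and> k < k'" for k n
      using assms[of "inverse (real (Suc (Suc n)))"] by (auto simp: INFM_nat)
  qed
  then obtain r where r: "\<And>n. dist (U (r n)) z < inverse (real (Suc n))" "\<And>n. r n < r (Suc n)" by blast
  have "(U \<circ> r) \<longlonglongrightarrow> z"
    unfolding tendsto_dist_iff[of "U \<circ> r"]
    by (rule tendsto_sandwich[OF _ _ tendsto_const LIMSEQ_inverse_real_of_nat])
      (use r(1) in \<open>auto intro!: always_eventually less_imp_le\<close>)
  moreover have "strict_mono r" using r(2) by (simp add: strict_mono_Suc_iff)
  ultimately show ?thesis unfolding cluster_points_def by blast
qed

lemma cluster_points_subseq:
  fixes U :: "nat \<Rightarrow> 'a::heine_borel" and s :: "nat \<Rightarrow> nat"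
  assumes "bounded (range U)" "strict_mono s"
  obtains r z where "strict_mono r" "(U \<circ> (s \<circ> r)) \<longlonglongrightarrow> z" "z \<in> cluster_points U"
proof -
  have "bounded (range (U \<circ> s))" using assms(1) by (rule bounded_subset) auto
  then obtain z and r :: "nat \<Rightarrow> nat" where r: "strict_mono r" "((U \<circ> s) \<circ> r) \<longlonglongrightarrow> z"
    using bounded_imp_convergent_subsequence[of "U \<circ> s"] by blast
  moreover have "strict_mono (s \<circ> r)" using assms(2) r(1) by (rule strict_mono_o)
  ultimately have "z \<in> cluster_points U" unfolding cluster_points_def o_assoc[symmetric] by blast
  then show ?thesis using that[of r z] r by (simp add: o_assoc)
qed

text \<open>Every point that is not a cluster point has a neighbourhood which the sequence
  eventually avoids. These neighbourhoods together with the sets \<open>N z\<close> cover the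
  compact closure of the range, and of a finite subcover only the sets \<open>N z\<close> still
  matter for large \<open>k\<close>. This makes properties known only locally at cluster points,
  such as the KL inequality and the BMP, uniform along the sequence.\<close>

lemma cluster_points_finite_cover:
  fixes U :: "nat \<Rightarrow> 'a::heine_borel"
  assumes bdd: "bounded (range U)" and N: "\<And>z. z \<in> cluster_points U \<Longrightarrow> open (N z) \<and> z \<in> N z"
  obtains I where "finite I" "I \<subseteq> cluster_points U" "eventually (\<lambda>k. U k \<in> (\<Union>z\<in>I. N z)) sequentially"
proof -
  have comp: "compact (closure (range U))" using bdd by simp
  have "\<exists>V. open V \<and> z \<in> V \<and> eventually (\<lambda>k. U k \<notin> V) sequentially" if "z \<notin> cluster_points U" for z
  proof -
    have "\<not> (\<forall>e>0. \<exists>\<^sub>\<infinity>k. dist (U k) z < e)" using cluster_pointI[of U z] that by iprover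
    then obtain e where e: "0 < e" "\<not> (\<exists>\<^sub>\<infinity>k. dist (U k) z < e)" by meson
    then have "eventually (\<lambda>k. \<not> dist (U k) z < e) sequentially"
      by (simp only: frequently_def cofinite_eq_sequentially not_not)
    then have "eventually (\<lambda>k. U k \<notin> ball z e) sequentially"
      by (simp only: mem_ball dist_commute[of z] not_False_eq_True)
    then show ?thesis using e(1) by (intro exI[of _ "ball z e"]) simp
  qed
  then have "\<exists>W. \<forall>z. z \<notin> cluster_points U \<longrightarrow> open (W z) \<and> z \<in> W z \<and> eventually (\<lambda>k. U k \<notin> W z) sequentially"
    by (intro choice) simp
  then obtain W where W: "\<And>z. z \<notin> cluster_points U \<Longrightarrow> open (W z) \<and> z \<in> W z \<and> eventually (\<lambda>k. U k \<notin> W z) sequentially"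
    by meson
  define V where "V z = (if z \<in> cluster_points U then N z else W z)" for z
  have V: "\<And>z. open (V z)" "\<And>z. z \<in> V z"
    "\<And>z. z \<in> cluster_points U \<Longrightarrow> V z = N z"
    "\<And>z. z \<notin> cluster_points U \<Longrightarrow> eventually (\<lambda>k. U k \<notin> V z) sequentially"
    using N W by (auto simp: V_def)
  have "closure (range U) \<subseteq> (\<Union>z\<in>closure (range U). V z)" using V(2) by (intro subsetI UN_I)
  then obtain J where J: "J \<subseteq> closure (range U)" "finite J" "closure (range U) \<subseteq> (\<Union>z\<in>J. V z)"
    by (rule compactE_image[OF comp V(1)])
  have "eventually (\<lambda>k. \<forall>z \<in> J - cluster_points U. U k \<notin> V z) sequentially"
    using J(2) V(4) by (intro eventually_ball_finite) auto
  then have "eventually (\<lambda>k. U k \<in> (\<Union>z\<in>J \<inter> cluster_points U. N z)) sequentially"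
  proof eventually_elim
    case (elim k)
    have "U k \<in> closure (range U)" by (rule subsetD[OF closure_subset]) simp
    then have "U k \<in> (\<Union>z\<in>J. V z)" using J(3) by (rule rev_subsetD)
    then obtain z where z: "z \<in> J" "U k \<in> V z" by (rule UN_E)
    with elim have "z \<in> cluster_points U" by auto
    then show ?case using z V(3) by auto
  qed
  then show ?thesis using that[of "J \<inter> cluster_points U"] J(2) by blast
qed

text \<open>By the inequality between geometric and arithmetic mean, \<open>d (Suc k)\<close> is at
  most half of \<open>d k\<close> plus half of \<open>C * (T k - T (Suc k))\<close>. Summation
  absorbs the first half into the left side, and the rest telescopes.\<close>

lemma summable_of_square_le:
  fixes d T :: "nat \<Rightarrow> real"
  assumes d: "\<And>k. 0 \<le> d k" and T: "\<And>k. K \<le> k \<Longrightarrow> 0 \<le> T k" "\<And>k. K \<le> k \<Longrightarrow> T (Suc k) \<le> T k"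
    and C: "0 \<le> C" and sq: "\<And>k. K \<le> k \<Longrightarrow> (d (Suc k))\<^sup>2 \<le> C * d k * (T k - T (Suc k))"
  shows "summable d"
proof -
  have step: "d (Suc k) \<le> d k / 2 + C / 2 * (T k - T (Suc k))" if "K \<le> k" for k
  proof -
    define e where "e = C * (T k - T (Suc k))"
    have e: "0 \<le> e" unfolding e_def using C T(2)[OF that] by simp
    have "4 * (d (Suc k))\<^sup>2 \<le> 4 * (d k * e)"
      using sq[OF that] by (simp add: e_def algebra_simps)
    also have "\<dots> \<le> (d k + e)\<^sup>2"
      using zero_le_power2[of "d k - e"] by (simp add: power2_eq_square algebra_simps)
    finally have "(2 * d (Suc k))\<^sup>2 \<le> (d k + e)\<^sup>2" by (simp add: power_mult_distrib)
    then have "2 * d (Suc k) \<le> d k + e"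
      by (rule power2_le_imp_le) (use d e in simp)
    then show ?thesis by (simp add: e_def field_simps)
  qed
  have sum: "(\<Sum>k<n. d (K + Suc k)) \<le> (\<Sum>k<n. d (K + k)) / 2 + C / 2 * (T K - T (K + n))" for n
  proof (induction n)
    case (Suc n)
    then show ?case using step[of "K + n"] by (simp add: algebra_simps add_divide_distrib)
  qed simp
  have shift: "(\<Sum>k<n. d (K + Suc k)) = (\<Sum>k<n. d (K + k)) - d K + d (K + n)" for n
    by (induction n) simp_all
  \<comment> \<open>Writing S for the sum, the two facts give S - \<open>d K\<close> +
    \<open>d (K + n)\<close> \<le> S/2 + \<open>C / 2 * (T K - T (K + n))\<close>. Solving for S and
    dropping nonpositive terms leaves a bound independent of \<open>n\<close>.\<close>
  have "(\<Sum>k<n. d (K + k)) \<le> 2 * d K + C * T K" for n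
  proof -
    have "0 \<le> C * T (K + n)" using C T(1)[of "K + n"] by simp
    then show ?thesis using sum[of n] shift[of n] d[of "K + n"] by (simp add: algebra_simps)
  qed
  then have "summable (\<lambda>k. d (K + k))"
    by (intro bounded_imp_summable[where B = "2 * d K + C * T K"])
      (simp_all only: d flip: lessThan_Suc_atMost)
  then show ?thesis by (simp add: summable_iff_shift add.commute[of K])
qed

text \<open>The derivative of a concave function decreases, so the slope at the larger point
  \<open>t\<close> bounds the slope at \<open>s\<close> from below, and the tangent at
  \<open>s\<close> does the rest. The lower point \<open>s'\<close> may be 0, where no derivative is
  available; tangents are taken only at positive points. This is the passage from the potential
  value \<open>t\<close> to the values \<open>s\<close> and \<open>s'\<close> of F.\<close>

lemma desingularizing_diff_ge:
  assumes \<phi>: "\<phi> \<in> desingularizing \<eta>" and s: "0 \<le> s'" "s' \<le> s" "0 < s" "s \<le> t" "ereal t < \<eta>"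
  shows "deriv \<phi> t * (s - s') \<le> \<phi> s - \<phi> s'"
proof -
  define A where "A = {t. 0 \<le> t \<and> ereal t < \<eta>}"
  have conv: "convex_on A (\<lambda>t. - \<phi> t)" using \<phi> by (simp add: desingularizing_def A_def concave_on_def)
  have A: "u \<in> A" if "0 \<le> u" "u \<le> t" for u
    using that s(5) by (auto simp: A_def intro: order_le_less_trans[of "ereal u" "ereal t"])
  have conn: "connected A"
    by (rule convex_connected) (use conv in \<open>simp add: convex_on_def\<close>)
  have tangent: "\<phi> u \<le> \<phi> r + deriv \<phi> r * (u - r)" if "0 < r" "r \<le> t" "u \<in> A" for r u
  proof -
    \<comment> \<open>A value strictly between \<open>t\<close> and \<eta> makes \<open>r\<close> an
      interior point of the domain even when \<open>r = t\<close>.\<close>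
    obtain t' where t': "ereal t < ereal t'" "ereal t' < \<eta>"
      using ereal_dense2[OF s(5)] by blast
    have "{0<..<t'} \<subseteq> A"
    proof
      fix u assume "u \<in> {0<..<t'}"
      then have "0 \<le> u" "ereal u < ereal t'" by auto
      then show "u \<in> A" using t'(2) by (simp add: A_def order.strict_trans[of _ "ereal t'"])
    qed
    then have "r \<in> interior A" using that t' by (intro interiorI[of "{0<..<t'}"]) simp_all
    moreover have "\<phi> differentiable (at r)"
      using \<phi> A[of r] that by (auto simp: desingularizing_def A_def)
    then have "(\<phi> has_field_derivative deriv \<phi> r) (at r)"
      by (simp only: DERIV_deriv_iff_real_differentiable)
    then have "((\<lambda>t. - \<phi> t) has_field_derivative - deriv \<phi> r) (at r within A)"
      by (rule DERIV_minus[OF has_field_derivative_at_within])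
    ultimately have "(- deriv \<phi> r) * (u - r) \<le> - \<phi> u - (- \<phi> r)"
      by (rule convex_on_imp_above_tangent[OF conv conn _ that(3)])
    then show ?thesis by simp
  qed
  have "deriv \<phi> t \<le> deriv \<phi> s"
  proof (cases "s = t")
    case False
    then have "0 < t - s" using s by simp
    moreover have "0 \<le> (deriv \<phi> s - deriv \<phi> t) * (t - s)"
      using tangent[of t s] tangent[of s t] A s by (simp add: algebra_simps)
    ultimately show ?thesis by (simp add: zero_le_mult_iff)
  qed simp
  then have "deriv \<phi> t * (s - s') \<le> deriv \<phi> s * (s - s')" using s by (intro mult_right_mono) auto
  also have "\<dots> \<le> \<phi> s - \<phi> s'" using tangent[of s s'] A s by (simp add: algebra_simps)
  finally show ?thesis .
qed

text \<open>Two sequences of values are kept apart: \<open>H k\<close> is the value of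
  \<open>h\<close> at \<open>w k\<close>, where the KL inequality is available, and need not be
  monotone; \<open>F\<close> has the sufficient decrease. They are linked only by
  \<open>F (Suc k) \<le> H k\<close> and by the common limit.\<close>

theorem KL_finite_length:
  fixes h :: "'a::euclidean_space \<Rightarrow> ereal" and w :: "nat \<Rightarrow> 'a" and F d H :: "nat \<Rightarrow> real"
  assumes bdd: "bounded (range w)"
    and KL: "\<And>z. z \<in> cluster_points w \<Longrightarrow> KL_at h z"
    and val: "\<And>z. z \<in> cluster_points w \<Longrightarrow> h z = ereal F\<^sub>0"
    and ab: "0 < a" "0 \<le> b" and d: "\<And>k. 0 \<le> d k"
    and descent: "\<And>k. F (Suc k) \<le> F k - a * (d k)\<^sup>2" and F: "F \<longlonglongrightarrow> F\<^sub>0"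
    and H: "\<And>k. K \<le> k \<Longrightarrow> h (w k) = ereal (H k)" "\<And>k. K \<le> k \<Longrightarrow> F (Suc k) \<le> H k" "H \<longlonglongrightarrow> F\<^sub>0"
    and sub: "\<And>k. K \<le> k \<Longrightarrow> \<exists>p\<in>limiting_subdiff h (w k). norm p \<le> b * d k"
  shows "summable d"
proof -
  have F_Suc: "F (Suc k) \<le> F k" for k
  proof -
    have "0 \<le> a * (d k)\<^sup>2" using ab by simp
    then show ?thesis using descent[of k] by linarith
  qed
  then have "decseq F" by (rule decseq_SucI)
  then have F_ge: "F\<^sub>0 \<le> F k" for k using decseq_ge F by blast
  show ?thesis
  \<comment> \<open>The KL inequality speaks only about values strictly above the limit. If
    \<open>F\<close> reaches its limit, sufficient decrease makes all later steps zero, so this case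
    is separate.\<close>
  proof (cases "\<exists>k. F k = F\<^sub>0")
    case True
    then obtain k where k: "F k = F\<^sub>0" ..
    have "d n = 0" if "k \<le> n" for n
    proof -
      have "F n \<le> F\<^sub>0" using \<open>decseq F\<close> that k by (auto simp: decseq_def)
      then have "a * (d n)\<^sup>2 \<le> 0" using descent[of n] F_ge[of "Suc n"] by linarith
      then show ?thesis using ab by (simp add: mult_le_0_iff)
    qed
    then show ?thesis by (intro summable_finite[of "{..<k}"]) auto
  next
    case False
    then have F_gt: "F\<^sub>0 < F k" for k using F_ge[of k] by (metis less_eq_real_def)
    have "\<exists>\<delta> \<eta> \<phi>. 0 < \<delta> \<and> 0 < \<eta> \<and> \<phi> \<in> desingularizing \<eta> \<and> (\<forall>x. norm (x - z) \<le> \<delta> \<and> h z < h x \<and> h x < h z + \<eta> \<longrightarrow>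
        1 \<le> ereal (deriv \<phi> (real_of_ereal (h x - h z))) * edist_set 0 (limiting_subdiff h x))"
      if "z \<in> cluster_points w" for z
      using KL[OF that] unfolding KL_at_def by blast
    then obtain \<delta> \<eta> \<phi> where kl: "\<And>z. z \<in> cluster_points w \<Longrightarrow> 0 < \<delta> z \<and> 0 < \<eta> z \<and> \<phi> z \<in> desingularizing (\<eta> z) \<and>
        (\<forall>x. norm (x - z) \<le> \<delta> z \<and> h z < h x \<and> h x < h z + \<eta> z \<longrightarrow>
        1 \<le> ereal (deriv (\<phi> z) (real_of_ereal (h x - h z))) * edist_set 0 (limiting_subdiff h x))"
      by metis
    obtain I where I: "finite I" "I \<subseteq> cluster_points w"
      "eventually (\<lambda>k. w k \<in> (\<Union>z\<in>I. ball z (\<delta> z))) sequentially"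
      using cluster_points_finite_cover[OF bdd, of "\<lambda>z. ball z (\<delta> z)"] kl by auto
    have "eventually (\<lambda>k. ereal (H k - F\<^sub>0) < \<eta> z) sequentially" if "z \<in> I" for z
    proof -
      have "(\<lambda>k. ereal (H k - F\<^sub>0)) \<longlonglongrightarrow> ereal (F\<^sub>0 - F\<^sub>0)" by (intro tendsto_intros H)
      moreover have "ereal (F\<^sub>0 - F\<^sub>0) < \<eta> z" using kl[of z] that I(2) by (auto simp: zero_ereal_def[symmetric])
      ultimately show ?thesis by (rule order_tendstoD(2))
    qed
    then have "eventually (\<lambda>k. \<forall>z\<in>I. ereal (H k - F\<^sub>0) < \<eta> z) sequentially"
      using I(1) by (intro eventually_ball_finite) auto
    with I(3) have "eventually (\<lambda>k. w k \<in> (\<Union>z\<in>I. ball z (\<delta> z)) \<and> (\<forall>z\<in>I. ereal (H k - F\<^sub>0) < \<eta> z)) sequentially"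
      by (rule eventually_conj)
    then obtain K' where K': "\<And>k. K' \<le> k \<Longrightarrow> w k \<in> (\<Union>z\<in>I. ball z (\<delta> z))"
      "\<And>k z. K' \<le> k \<Longrightarrow> z \<in> I \<Longrightarrow> ereal (H k - F\<^sub>0) < \<eta> z"
      by (auto simp: eventually_sequentially simp del: UN_iff)
    \<comment> \<open>The centre \<open>z\<close> whose ball contains \<open>w k\<close> changes
      with \<open>k\<close>. Since every summand is nonincreasing in \<open>k\<close>, the drop of
      the whole sum bounds the drop of any single one. The shift to \<open>Suc k\<close> is the
      point where \<open>H k\<close> dominates \<open>F\<close>.\<close>
    define T where "T k = (\<Sum>z\<in>I. \<phi> z (F (Suc k) - F\<^sub>0))" for k
    have diff: "deriv (\<phi> z) t * (F (Suc k) - F (Suc (Suc k))) \<le> \<phi> z (F (Suc k) - F\<^sub>0) - \<phi> z (F (Suc (Suc k)) - F\<^sub>0)"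
      if "max K K' \<le> k" "z \<in> I" "F (Suc k) - F\<^sub>0 \<le> t" "t \<le> H k - F\<^sub>0" for k z t
    proof -
      have "ereal t \<le> ereal (H k - F\<^sub>0)" using that by simp
      also have "\<dots> < \<eta> z" using K'(2) that by simp
      finally show ?thesis
        using desingularizing_diff_ge[of "\<phi> z" "\<eta> z" "F (Suc (Suc k)) - F\<^sub>0" "F (Suc k) - F\<^sub>0" t]
          F_gt[of "Suc k"] F_ge[of "Suc (Suc k)"] F_Suc[of "Suc k"] that kl[of z] I(2) by auto
    qed
    have in_dom: "0 \<le> F (Suc k) - F\<^sub>0 \<and> ereal (F (Suc k) - F\<^sub>0) < \<eta> z" if "max K K' \<le> k" "z \<in> I" for k z
    proof -
      have "ereal (F (Suc k) - F\<^sub>0) \<le> ereal (H k - F\<^sub>0)" using that H(2)[of k] by simp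
      also have "\<dots> < \<eta> z" using K'(2) that by simp
      finally show ?thesis using F_ge[of "Suc k"] by simp
    qed
    have mono: "\<phi> z (F (Suc (Suc k)) - F\<^sub>0) \<le> \<phi> z (F (Suc k) - F\<^sub>0)" if "max K K' \<le> k" "z \<in> I" for k z
    proof -
      have "0 < deriv (\<phi> z) (F (Suc k) - F\<^sub>0)"
        using kl[of z] that I(2) in_dom[OF that] F_gt[of "Suc k"] by (auto simp: desingularizing_def)
      then have "0 \<le> deriv (\<phi> z) (F (Suc k) - F\<^sub>0) * (F (Suc k) - F (Suc (Suc k)))"
        using F_Suc[of "Suc k"] by simp
      also have "\<dots> \<le> \<phi> z (F (Suc k) - F\<^sub>0) - \<phi> z (F (Suc (Suc k)) - F\<^sub>0)"
        using that H(2)[of k] by (intro diff) auto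
      finally show ?thesis by simp
    qed
    show ?thesis
    proof (rule summable_of_square_le[where K = "max K K'" and T = T and C = "b / a"])
      fix k assume k: "max K K' \<le> k"
      show "0 \<le> T k"
        unfolding T_def using kl I(2) in_dom[OF k] by (intro sum_nonneg) (auto simp: desingularizing_def)
      show "T (Suc k) \<le> T k"
        unfolding T_def by (intro sum_mono mono[OF k])
      obtain z where z: "z \<in> I" "w k \<in> ball z (\<delta> z)" using K'(1)[of k] k by auto
      have zW: "z \<in> cluster_points w" using z I(2) by blast
      obtain p where p: "p \<in> limiting_subdiff h (w k)" "norm p \<le> b * d k" using sub[of k] k by auto
      define t where "t = H k - F\<^sub>0"
      have t: "F (Suc k) - F\<^sub>0 \<le> t" "0 < t" "ereal t < \<eta> z"
        using H(2)[of k] K'(2)[of k z] F_gt[of "Suc k"] k z by (auto simp: t_def)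
      have pos: "0 < deriv (\<phi> z) t"
        using kl[OF zW] t by (auto simp: desingularizing_def)
      have "h (w k) < h z + \<eta> z"
        using H(1)[of k] k val[OF zW] t(3) by (cases "\<eta> z") (auto simp: t_def)
      then have "1 \<le> ereal (deriv (\<phi> z) (real_of_ereal (h (w k) - h z))) * edist_set 0 (limiting_subdiff h (w k))"
        using kl[OF zW, THEN conjunct2, THEN conjunct2, THEN conjunct2, rule_format, of "w k"]
          z(2) val[OF zW] H(1)[of k] k t(2)
        by (simp add: t_def dist_norm norm_minus_commute)
      also have "\<dots> = ereal (deriv (\<phi> z) t) * edist_set 0 (limiting_subdiff h (w k))"
        using H(1)[of k] k val[OF zW] by (simp add: t_def)
      also have "\<dots> \<le> ereal (deriv (\<phi> z) t) * ereal (b * d k)"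
      proof (rule ereal_mult_left_mono)
        have "edist_set 0 (limiting_subdiff h (w k)) \<le> ereal (dist 0 p)"
          unfolding edist_set_def by (rule INF_lower[OF p(1)])
        also have "\<dots> \<le> ereal (b * d k)" using p(2) by simp
        finally show "edist_set 0 (limiting_subdiff h (w k)) \<le> ereal (b * d k)" .
      qed (use pos in simp)
      finally have one: "1 \<le> deriv (\<phi> z) t * (b * d k)" by (simp add: one_ereal_def)
      have drop: "a * (d (Suc k))\<^sup>2 \<le> F (Suc k) - F (Suc (Suc k))" using descent[of "Suc k"] by simp
      \<comment> \<open>The KL inequality together with the subgradient bound says that the product
        \<open>deriv (\<phi> z) t * (b * d k)\<close> is at least 1. Multiplying the decrease by it
        brings in the slope, which concavity converts into a difference of desingularizing
        values.\<close>
      have "a * (d (Suc k))\<^sup>2 \<le> (deriv (\<phi> z) t * (b * d k)) * (a * (d (Suc k))\<^sup>2)"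
        using mult_right_mono[OF one, of "a * (d (Suc k))\<^sup>2"] ab by simp
      also have "\<dots> \<le> (deriv (\<phi> z) t * (b * d k)) * (F (Suc k) - F (Suc (Suc k)))"
        using pos ab d by (intro mult_left_mono[OF drop]) simp
      also have "\<dots> = b * d k * (deriv (\<phi> z) t * (F (Suc k) - F (Suc (Suc k))))" by simp
      also have "\<dots> \<le> b * d k * (\<phi> z (F (Suc k) - F\<^sub>0) - \<phi> z (F (Suc (Suc k)) - F\<^sub>0))"
        using ab d t(1) by (intro mult_left_mono diff[OF k z(1)]) (auto simp: t_def)
      also have "\<dots> \<le> b * d k * (T k - T (Suc k))"
      proof (rule mult_left_mono)
        show "\<phi> z (F (Suc k) - F\<^sub>0) - \<phi> z (F (Suc (Suc k)) - F\<^sub>0) \<le> T k - T (Suc k)"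
          unfolding T_def sum_subtractf[symmetric]
          by (rule member_le_sum[OF z(1)]) (use mono[OF k] I(1) in auto)
      qed (use ab d in simp)
      finally show "(d (Suc k))\<^sup>2 \<le> b / a * d k * (T k - T (Suc k))"
        using ab(1) by (simp add: field_simps)
    qed (use d ab in auto)
  qed
qed

section \<open>Derivatives\<close>

text \<open>\<open>grad\<close> is a definite description, so existence and uniqueness are both
  owed. The representing vector of the derivative \<open>T\<close> is
  \<open>adjoint T 1\<close>.\<close>

lemma differentiable_imp_GDERIV_grad:
  fixes h :: "'a::euclidean_space \<Rightarrow> real"
  assumes "h differentiable (at x)"
  shows "GDERIV h x :> grad h x"
proof -
  obtain T where T: "(h has_derivative T) (at x)" using assms by (auto simp: differentiable_def)
  then interpret T: bounded_linear T by (rule has_derivative_bounded_linear)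
  have "T z = z \<bullet> adjoint T 1" for z
    using adjoint_works[OF T.linear, of z 1] by simp
  then have ex: "GDERIV h x :> adjoint T 1" using T unfolding gderiv_def by (metis ext)
  have "p = q" if "GDERIV h x :> p" "GDERIV h x :> q" for p q
  proof -
    have "(\<lambda>h. h \<bullet> p) = (\<lambda>h. h \<bullet> q)"
      using has_derivative_unique that unfolding gderiv_def by blast
    then show ?thesis by (metis euclidean_eqI inner_commute)
  qed
  then show ?thesis unfolding grad_def using ex by (rule_tac theI') auto
qed

text \<open>Evaluating the derivative at the gradient itself gives the squared norm. The size of a
  gradient on a product space is thus estimated without computing its components.\<close>

lemma norm_grad_le:
  fixes h :: "'a::euclidean_space \<Rightarrow> real"
  assumes "(h has_derivative T) (at x)" "\<And>z. T z \<le> C * norm z" "0 \<le> C"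
  shows "GDERIV h x :> grad h x" "norm (grad h x) \<le> C"
proof -
  show g: "GDERIV h x :> grad h x"
    using assms(1) by (intro differentiable_imp_GDERIV_grad) (auto simp: differentiable_def)
  then have "T = (\<lambda>z. z \<bullet> grad h x)"
    using has_derivative_unique assms(1) unfolding gderiv_def by blast
  then have "grad h x \<bullet> grad h x \<le> C * norm (grad h x)"
    using assms(2)[of "grad h x"] by simp
  then show "norm (grad h x) \<le> C"
    using assms(3) by (cases "grad h x = 0") (simp_all add: dot_square_norm power2_eq_square)
qed

text \<open>The derivative is compared with a difference quotient along a short multiple of
  \<open>h\<close>. Applied to the derivative of \<open>g\<close>, it bounds the second derivative
  at all iterates by one Lipschitz constant, with no continuity of the second derivative.\<close>

lemma has_derivative_norm_le:
  assumes F: "(F has_derivative B) (at s)" and lip: "K-lipschitz_on S F" and s: "s \<in> interior S"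
  shows "norm (B h) \<le> K * norm h"
proof (cases "h = 0")
  case True
  then show ?thesis using linear_0[OF has_derivative_linear[OF F]] by simp
next
  case False
  interpret B: bounded_linear B using F by (rule has_derivative_bounded_linear)
  show ?thesis
  proof (rule field_le_epsilon)
    fix e :: real assume e: "0 < e"
    then have "0 < e / norm h" using False by simp
    then obtain \<delta> where \<delta>: "0 < \<delta>" "\<And>z. norm (z - s) < \<delta> \<Longrightarrow> norm (F z - F s - B (z - s)) \<le> e / norm h * norm (z - s)"
      using F unfolding has_derivative_at_alt by blast
    obtain r where r: "0 < r" "ball s r \<subseteq> S" using s by (auto simp: mem_interior)
    \<comment> \<open>Half of the admissible length, so that \<open>z\<close> lies both where the
      linearization error is small and where the Lipschitz bound holds.\<close>
    define t where "t = min \<delta> r / (2 * norm h)"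
    have t: "0 < t" "t * norm h < \<delta>" "t * norm h < r"
      using \<delta>(1) r(1) False by (auto simp: t_def)
    define z where "z = s + t *\<^sub>R h"
    have nz: "norm (z - s) = t * norm h" using t by (simp add: z_def)
    have "z \<in> ball s r" using t nz by (simp add: dist_norm norm_minus_commute)
    then have "z \<in> S" "s \<in> S" using r by auto
    then have "norm (F z - F s) \<le> K * norm (z - s)"
      using lipschitz_onD[OF lip, of z s] by (simp add: dist_norm)
    moreover have "norm (F z - F s - B (z - s)) \<le> e / norm h * norm (z - s)"
      using \<delta>(2)[of z] nz t by simp
    moreover have "norm (B (z - s)) \<le> norm (F z - F s) + norm (F z - F s - B (z - s))"
      using norm_triangle_sub[of "B (z - s)" "F z - F s"] by (simp add: norm_minus_commute)
    ultimately have "norm (B (z - s)) \<le> (K + e / norm h) * (t * norm h)"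
      using nz by (simp add: algebra_simps)
    moreover have "norm (B (z - s)) = t * norm (B h)" using t by (simp add: z_def B.scaleR)
    moreover have "(K + e / norm h) * (t * norm h) = t * (K * norm h + e)"
      using False by (simp add: field_simps)
    ultimately have "t * norm (B h) \<le> t * (K * norm h + e)" by linarith
    then show "norm (B h) \<le> K * norm h + e" using t by simp
  qed
qed

lemma convex_norm_square:
  fixes p q :: "'a::real_inner"
  assumes "0 \<le> u" "u \<le> 1"
  shows "(norm ((1 - u) *\<^sub>R p + u *\<^sub>R q))\<^sup>2 \<le> (1 - u) * (norm p)\<^sup>2 + u * (norm q)\<^sup>2"
proof -
  have "(1 - u) * (norm p)\<^sup>2 + u * (norm q)\<^sup>2 - (norm ((1 - u) *\<^sub>R p + u *\<^sub>R q))\<^sup>2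
    = u * (1 - u) * (norm (p - q))\<^sup>2"
    by (simp add: power2_norm_eq_inner inner_simps inner_commute algebra_simps)
  moreover have "0 \<le> u * (1 - u) * (norm (p - q))\<^sup>2" using assms by simp
  ultimately show ?thesis by linarith
qed

text \<open>By the mean value theorem the increment is governed by the gradient at a point of the
  segment from \<open>a\<close> to \<open>b\<close>, and the distance of that point to
  \<open>s\<close> is at most \<open>norm (b - a) + norm (a - s)\<close>. The reference point
  \<open>s\<close> of the linearization is free: the model is linearized at the old iterate, while
  the increment of interest runs between two other points.\<close>

lemma mean_value_gradient:
  fixes h :: "'a::euclidean_space \<Rightarrow> real"
  assumes D: "convex D" "a \<in> D" "b \<in> D" "s \<in> D"
    and h: "\<And>z. z \<in> D \<Longrightarrow> GDERIV h z :> h' z" and lip: "K-lipschitz_on D h'"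
  shows "\<bar>h b - h a - h' s \<bullet> (b - a)\<bar> \<le> K * (norm (b - a) + norm (a - s)) * norm (b - a)"
proof -
  have seg: "a + t *\<^sub>R (b - a) \<in> D" if "0 \<le> t" "t \<le> 1" for t
    using convexD_alt[OF D(1-3) that] by (simp add: algebra_simps)
  have "\<exists>t\<in>{0..1}. h (a + 1 *\<^sub>R (b - a)) - h (a + 0 *\<^sub>R (b - a)) = ((1 - 0) *\<^sub>R (b - a)) \<bullet> h' (a + t *\<^sub>R (b - a))"
  proof (rule mvt_very_simple)
    fix t :: real assume "0 \<le> t" "t \<le> 1"
    then have "(h has_derivative (\<lambda>z. z \<bullet> h' (a + t *\<^sub>R (b - a)))) (at (a + t *\<^sub>R (b - a)))"
      using h seg unfolding gderiv_def by blast
    moreover have "((\<lambda>t. a + t *\<^sub>R (b - a)) has_derivative (\<lambda>r. r *\<^sub>R (b - a))) (at t within {0..1})"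
      by (auto intro!: derivative_eq_intros)
    ultimately show "((\<lambda>t. h (a + t *\<^sub>R (b - a))) has_derivative (\<lambda>r. (r *\<^sub>R (b - a)) \<bullet> h' (a + t *\<^sub>R (b - a)))) (at t within {0..1})"
      by (rule has_derivative_compose[rotated])
  qed simp
  then obtain t where t: "0 \<le> t" "t \<le> 1" "h b - h a = (b - a) \<bullet> h' (a + t *\<^sub>R (b - a))" by auto
  define p where "p = a + t *\<^sub>R (b - a)"
  have "h b - h a - h' s \<bullet> (b - a) = (h' p - h' s) \<bullet> (b - a)"
    using t(3) unfolding p_def[symmetric] by (simp add: inner_diff_left inner_diff_right inner_commute)
  then have "\<bar>h b - h a - h' s \<bullet> (b - a)\<bar> \<le> norm (h' p - h' s) * norm (b - a)"
    by (simp add: Cauchy_Schwarz_ineq2)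
  also have "\<dots> \<le> (K * (norm (b - a) + norm (a - s))) * norm (b - a)"
  proof (rule mult_right_mono)
    have "norm (h' p - h' s) \<le> K * norm (p - s)"
      using lipschitz_onD[OF lip, of p s] seg[of t] t D(4) by (simp add: p_def dist_norm)
    also have "norm (p - s) \<le> norm (p - a) + norm (a - s)"
      using norm_triangle_ineq[of "p - a" "a - s"] by simp
    also have "norm (p - a) \<le> norm (b - a)"
      using t by (simp add: p_def mult_left_le_one_le)
    finally show "norm (h' p - h' s) \<le> K * (norm (b - a) + norm (a - s))"
      using lipschitz_on_nonneg[OF lip] by (simp add: mult_left_mono)
  qed simp
  finally show ?thesis .
qed

section \<open>The constraint model\<close>

lemma derivative_map_has_derivative:
  assumes "h differentiable (at s)"
  shows "blinfun_apply (derivative_map h s) = frechet_derivative h (at s)"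
    "(h has_derivative blinfun_apply (derivative_map h s)) (at s)"
proof -
  have d: "(h has_derivative frechet_derivative h (at s)) (at s)"
    using assms by (simp add: frechet_derivative_works)
  then show eq: "blinfun_apply (derivative_map h s) = frechet_derivative h (at s)"
    by (simp add: derivative_map_def bounded_linear_Blinfun_apply has_derivative_bounded_linear)
  show "(h has_derivative blinfun_apply (derivative_map h s)) (at s)" using d eq by simp
qed

lemma C11_on_lipschitz_cball:
  fixes h :: "'a::euclidean_space \<Rightarrow> 'b::euclidean_space"
  assumes "C11_on UNIV h"
  obtains K where "K-lipschitz_on (cball 0 R) (derivative_map h)"
proof -
  \<comment> \<open>The time variable of \<open>local_lipschitz\<close> is a dummy, frozen on a
    one-point set. Compactness of the ball then turns local constants into a single one.\<close>
  have "local_lipschitz {0::real} (cball 0 R) (\<lambda>_. derivative_map h)"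
  proof (rule local_lipschitzI)
    fix x :: 'a assume "x \<in> cball 0 R"
    have "\<exists>e>0. \<exists>K. K-lipschitz_on (ball x e) (derivative_map h)"
      using assms by (simp add: C11_on_def locally_lipschitz_on_def)
    then obtain e K where "0 < e" "K-lipschitz_on (ball x e) (derivative_map h)" by blast
    then have "0 < e / 2" "K-lipschitz_on (cball x (e / 2) \<inter> cball 0 R) (derivative_map h)"
      by (auto intro: lipschitz_on_subset)
    then show "\<exists>u>0. \<exists>K. \<forall>t\<in>cball t u \<inter> {0}. K-lipschitz_on (cball x u \<inter> cball 0 R) (derivative_map h)" for t :: real
      by blast
  qed
  from local_lipschitz_compact_implies_lipschitz[OF this compact_cball compact_sing]
  obtain K where "\<And>t. t \<in> {0::real} \<Longrightarrow> K-lipschitz_on (cball 0 R) (derivative_map h)" by auto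
  then show ?thesis using that[of K] by simp
qed

lemma C11_on_linearization:
  assumes h: "C11_on UNIV h" and lip: "K-lipschitz_on (cball 0 R) (derivative_map h)"
    and "norm s \<le> R" "norm z \<le> R"
  shows "norm (h z - h s - derivative_map h s (z - s)) \<le> K * (norm (z - s))\<^sup>2"
proof -
  have diff: "h differentiable (at p)" for p using h unfolding C11_on_def by blast
  have "norm (h z - h s - derivative_map h s (z - s)) \<le> norm (z - s) * (K * norm (z - s))"
  proof (rule differentiable_bound_linearization[where S = "closed_segment s z" and f' = "\<lambda>z. blinfun_apply (derivative_map h z)"])
    fix t :: real assume "t \<in> {0..1}"
    then show "s + t *\<^sub>R (z - s) \<in> closed_segment s z"
      by (auto simp: in_segment algebra_simps intro!: exI[of _ t])
  next
    fix p assume "p \<in> closed_segment s z"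
    show "(h has_derivative blinfun_apply (derivative_map h p)) (at p within closed_segment s z)"
      by (rule has_derivative_at_withinI[OF derivative_map_has_derivative(2)[OF diff]])
  next
    fix p assume p: "p \<in> closed_segment s z"
    have "closed_segment s z \<subseteq> cball 0 R"
      by (rule closed_segment_subset) (use assms(3,4) in simp_all)
    then have pR: "p \<in> cball 0 R" using p by (rule subsetD)
    have sR: "s \<in> cball 0 R" using assms(3) by simp
    have "onorm (blinfun_apply (derivative_map h p) - blinfun_apply (derivative_map h s))
      = norm (derivative_map h p - derivative_map h s)"
      unfolding norm_blinfun.rep_eq minus_blinfun.rep_eq fun_diff_def ..
    also have "\<dots> \<le> K * norm (p - s)"
      using lipschitz_onD[OF lip pR sR] unfolding dist_norm .
    also have "\<dots> \<le> K * norm (z - s)"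
      using segment_bound1[OF p] lipschitz_on_nonneg[OF lip] by (rule mult_left_mono)
    finally show "onorm (blinfun_apply (derivative_map h p) - blinfun_apply (derivative_map h s)) \<le> K * norm (z - s)" .
  qed simp
  then show ?thesis by (simp add: power2_eq_square mult.commute mult.left_commute)
qed

context mba_problem
begin

lemma g_differentiable: "g differentiable (at s)"
  using g_C11 by (simp add: C11_on_def)

text \<open>With the derivative written as a point of the space of bounded linear maps, the
  expression can also be differentiated and passed to the limit in \<open>s\<close>.\<close>

lemma mba_G_eq: "mba_G g z s l = g s + derivative_map g s (z - s) + ((norm (z - s))\<^sup>2 / 2) *\<^sub>R l"
  by (simp add: mba_G_def derivative_map_has_derivative(1)[OF g_differentiable])

lemma mba_G_self: "mba_G g s s l = g s"
  by (simp add: mba_G_eq)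

lemma mba_G_has_derivative:
  "((\<lambda>z. mba_G g z s l) has_derivative (\<lambda>h. derivative_map g s h + ((z - s) \<bullet> h) *\<^sub>R l)) (at z)"
proof -
  have zs: "((\<lambda>z. z - s) has_derivative (\<lambda>h. h)) (at z)" by (auto intro!: derivative_eq_intros)
  have 1: "((\<lambda>z. derivative_map g s (z - s)) has_derivative (\<lambda>h. derivative_map g s h)) (at z)"
    by (rule bounded_linear.has_derivative[OF blinfun.bounded_linear_right zs])
  have "((\<lambda>z. ((z - s) \<bullet> (z - s)) / 2) has_derivative (\<lambda>h. (z - s) \<bullet> h)) (at z)"
    by (rule has_derivative_eq_rhs[OF has_derivative_divide'[OF has_derivative_inner[OF zs zs] has_derivative_const]])
      (simp_all add: inner_commute)
  note 2 = has_derivative_scaleR[OF this has_derivative_const[of l]]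
  show ?thesis
    unfolding mba_G_eq power2_norm_eq_inner
    by (rule has_derivative_eq_rhs[OF has_derivative_add[OF has_derivative_add[OF has_derivative_const 1] 2]]) simp
qed

lemma nabla_mba_G:
  "nabla (\<lambda>z. mba_G g z s l) z p \<bullet> h = p \<bullet> (derivative_map g s h + ((z - s) \<bullet> h) *\<^sub>R l)"
proof -
  have "nabla (\<lambda>z. mba_G g z s l) z = adjoint (\<lambda>h. derivative_map g s h + ((z - s) \<bullet> h) *\<^sub>R l)"
    unfolding nabla_def using frechet_derivative_at[OF mba_G_has_derivative] by metis
  then show ?thesis
    using adjoint_works[OF has_derivative_linear[OF mba_G_has_derivative[of s l z]], of h p]
    by (simp add: inner_commute)
qed

lemma nabla_g: "nabla g s p \<bullet> h = p \<bullet> derivative_map g s h"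
proof -
  have "nabla g s = adjoint (blinfun_apply (derivative_map g s))"
    by (simp add: nabla_def derivative_map_has_derivative(1)[OF g_differentiable])
  then show ?thesis
    using adjoint_works[OF bounded_linear.linear[OF blinfun.bounded_linear_right], of h "derivative_map g s" p]
    by (simp add: inner_commute)
qed

lemma convex_mba_Gamma:
  assumes "l \<in> nonneg_orthant"
  shows "convex (mba_Gamma g s l)"
  unfolding convex_alt
proof (intro ballI allI impI)
  fix a b u assume a: "a \<in> mba_Gamma g s l" and b: "b \<in> mba_Gamma g s l" and u: "(0::real) \<le> u \<and> u \<le> 1"
  have "mba_G g ((1 - u) *\<^sub>R a + u *\<^sub>R b) s l $ i \<le> 0" for i
  proof -
    have l: "0 \<le> l $ i" using assms by (simp add: nonneg_orthant_def)
    define N where "N z = (norm (z - s))\<^sup>2 / 2 * l $ i" for z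
    define T where "T z = derivative_map g s (z - s) $ i" for z
    have G: "mba_G g z s l $ i = g s $ i + T z + N z" for z
      by (simp add: mba_G_eq N_def T_def)
    have z: "(1 - u) *\<^sub>R a + u *\<^sub>R b - s = (1 - u) *\<^sub>R (a - s) + u *\<^sub>R (b - s)"
      by (simp add: algebra_simps)
    have "(norm ((1 - u) *\<^sub>R a + u *\<^sub>R b - s))\<^sup>2 * (l $ i / 2)
      \<le> ((1 - u) * (norm (a - s))\<^sup>2 + u * (norm (b - s))\<^sup>2) * (l $ i / 2)"
      unfolding z using u l by (intro mult_right_mono convex_norm_square) auto
    also have "\<dots> = (1 - u) * N a + u * N b" unfolding N_def by algebra
    finally have "N ((1 - u) *\<^sub>R a + u *\<^sub>R b) \<le> (1 - u) * N a + u * N b" by (simp add: N_def)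
    moreover have "T ((1 - u) *\<^sub>R a + u *\<^sub>R b) = (1 - u) * T a + u * T b"
      unfolding T_def z by (simp add: blinfun.add_right blinfun.scaleR_right)
    ultimately have "mba_G g ((1 - u) *\<^sub>R a + u *\<^sub>R b) s l $ i
      \<le> (1 - u) * mba_G g a s l $ i + u * mba_G g b s l $ i"
      unfolding G by (simp add: left_diff_distrib distrib_left)
    also have "\<dots> \<le> 0"
      using a b u by (intro add_nonpos_nonpos mult_nonneg_nonpos) (auto simp: mba_Gamma_def nonpos_orthant_def)
    finally show ?thesis .
  qed
  then show "(1 - u) *\<^sub>R a + u *\<^sub>R b \<in> mba_Gamma g s l"
    by (simp add: mba_Gamma_def nonpos_orthant_def)
qed

text \<open>The variation of \<open>g (S w)\<close> cancels against the variation of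
  \<open>S\<close> inside \<open>X w - S w\<close>. What remains in the \<open>S\<close> and
  \<open>L\<close> directions carries a factor \<open>X w - s\<close>, and this makes the
  corresponding part of the subgradient small.\<close>

lemma mba_G_joint_has_derivative:
  assumes B: "(derivative_map g has_derivative B) (at s)"
    and X: "(X has_derivative X') (at w)" and S: "(S has_derivative S') (at w)" and L: "(L has_derivative L') (at w)"
    and s: "S w = s"
  shows "((\<lambda>w. mba_G g (X w) (S w) (L w)) has_derivative
    (\<lambda>h. derivative_map g s (X' h) + B (S' h) (X w - s)
      + ((X w - s) \<bullet> (X' h - S' h)) *\<^sub>R L w + ((norm (X w - s))\<^sup>2 / 2) *\<^sub>R L' h)) (at w)"
proof -
  have 1: "((\<lambda>w. g (S w)) has_derivative (\<lambda>h. derivative_map g s (S' h))) (at w)"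
    using has_derivative_compose[OF S] derivative_map_has_derivative(2)[OF g_differentiable] s by blast
  have "((\<lambda>w. derivative_map g (S w)) has_derivative (\<lambda>h. B (S' h))) (at w)"
    using has_derivative_compose[OF S] B s by blast
  then have 2: "((\<lambda>w. derivative_map g (S w) (X w - S w)) has_derivative
    (\<lambda>h. derivative_map g (S w) (X' h - S' h) + B (S' h) (X w - S w))) (at w)"
    by (rule bounded_bilinear.FDERIV[OF bounded_bilinear_blinfun_apply _ has_derivative_diff[OF X S]])
  note XS = has_derivative_diff[OF X S]
  have "((\<lambda>w. ((X w - S w) \<bullet> (X w - S w)) / 2) has_derivative (\<lambda>h. (X w - S w) \<bullet> (X' h - S' h))) (at w)"
    by (rule has_derivative_eq_rhs[OF has_derivative_divide'[OF has_derivative_inner[OF XS XS] has_derivative_const]])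
      (simp_all add: inner_commute)
  note 3 = has_derivative_scaleR[OF this L]
  show ?thesis
    unfolding mba_G_eq power2_norm_eq_inner
    by (rule has_derivative_eq_rhs[OF has_derivative_add[OF has_derivative_add[OF 1 2] 3]])
      (simp add: s blinfun.diff_right fun_eq_iff)
qed

lemma f_GDERIV: "z \<in> \<O> \<Longrightarrow> GDERIV (\<lambda>x. real_of_ereal (f x)) z :> egrad f z"
  unfolding egrad_def using f_C11 by (intro differentiable_imp_GDERIV_grad) (simp add: C11_on_def)

lemma f_real: "z \<in> \<O> \<Longrightarrow> f z = ereal (real_of_ereal (f z))"
  using f_finite[of z] f_proper by (cases "f z") (auto simp: proper_fun_def)

lemma f_continuous: "z \<in> \<O> \<Longrightarrow> isCont (\<lambda>x. real_of_ereal (f x)) z"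
  using f_GDERIV unfolding gderiv_def by (blast intro: has_derivative_continuous)

definition objective_real :: "real^'n \<Rightarrow> real" where
  "objective_real z = real_of_ereal (f z) + \<phi> z - \<psi> z"

lemma objective_eq:
  assumes "z \<in> feasible g"
  shows "objective f \<phi> \<psi> g z = ereal (objective_real z)"
proof -
  have "f z = ereal (real_of_ereal (f z))" using assms feasible_subset by (intro f_real) auto
  then show ?thesis using assms
    by (cases "f z") (auto simp: objective_def objective_real_def feasible_def ind_fun_def)
qed

lemma objective_real_bounded_below: "\<exists>b. \<forall>z\<in>feasible g. b \<le> objective_real z"
proof -
  have "\<exists>b::real. ereal b < (INF x\<in>feasible g. objective f \<phi> \<psi> g x)"
    using ereal_dense2[OF objective_bdd_below] by blast
  then obtain b where b: "ereal b < (INF x\<in>feasible g. objective f \<phi> \<psi> g x)" ..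
  have "b \<le> objective_real z" if "z \<in> feasible g" for z
  proof -
    have "ereal b \<le> objective f \<phi> \<psi> g z"
      using less_imp_le[OF b] INF_lower[OF that] by (rule order_trans)
    then show ?thesis using objective_eq[OF that] by simp
  qed
  then show ?thesis by blast
qed

end

section \<open>The iterates\<close>

lemma bounded_range_tail:
  fixes U :: "nat \<Rightarrow> 'a::real_normed_vector"
  assumes "\<And>k. K \<le> k \<Longrightarrow> norm (U k) \<le> B"
  shows "bounded (range U)"
proof (rule bounded_subset)
  show "bounded (U ` {..<K} \<union> cball 0 B)" by (simp add: finite_imp_bounded)
  show "range U \<subseteq> U ` {..<K} \<union> cball 0 B"
  proof
    fix z assume "z \<in> range U"
    then obtain k where "z = U k" by blast
    then show "z \<in> U ` {..<K} \<union> cball 0 B" using assms[of k] by (cases "K \<le> k") auto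
  qed
qed

locale mba_run = inexact_mba f \<phi> \<psi> g \<O> \<mu>min \<mu>max Lmin Lmax M \<beta>R \<beta>F \<alpha> \<tau> x \<xi> jk \<mu> L Q xbar y v lam
  for f :: "real^'n \<Rightarrow> ereal"
    and \<phi> \<psi> :: "real^'n \<Rightarrow> real"
    and g :: "real^'n \<Rightarrow> real^'m"
    and \<O> :: "(real^'n) set"
    and \<mu>min \<mu>max Lmin Lmax M \<beta>R \<beta>F \<alpha> \<tau> :: real
    and x \<xi> :: "nat \<Rightarrow> real^'n"
    and jk :: "nat \<Rightarrow> nat"
    and \<mu> :: "nat \<Rightarrow> nat \<Rightarrow> real"
    and L :: "nat \<Rightarrow> nat \<Rightarrow> real^'m"
    and Q :: "nat \<Rightarrow> nat \<Rightarrow> (real^'n) \<Rightarrow>\<^sub>L (real^'n)"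
    and xbar y v :: "nat \<Rightarrow> nat \<Rightarrow> real^'n"
    and lam :: "nat \<Rightarrow> nat \<Rightarrow> real^'m" +
  fixes D :: "(real^'n) set" and \<beta>Q \<gamma> Lf c :: real and khat kbar :: nat
  assumes x_bounded: "bounded (range x)"
    and BMP: "\<And>u z. (u, z) \<in> cluster_points
            (\<lambda>k. ((L k (jk k), Q k (jk k), \<xi> k, x k), xbar k (jk k))) \<Longrightarrow> partial_BMP g u z"
    and g_twice: "twice_differentiable g"
    and Q_bound: "0 < \<beta>Q" "\<And>k. norm (Q k (jk k)) \<le> \<beta>Q"
    and \<gamma>: "0 < \<gamma>" "\<And>k. khat \<le> k \<Longrightarrow>
          norm (x (Suc k) - xbar k (jk k)) \<le> \<gamma> * sqrt (\<beta>R / 2) * norm (x (Suc k) - x k)"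
    and D: "compact D" "convex D" "D \<subseteq> \<O>" "khat \<le> kbar"
           "\<And>k. kbar \<le> k \<Longrightarrow> x k \<in> D \<and> xbar k (jk k) \<in> D"
    and Lf: "Lf-lipschitz_on D (egrad f)"
    and c: "c = (Lf + \<beta>Q + \<beta>F / 2) + (Lf + \<beta>Q / 2) * \<gamma>\<^sup>2 * \<beta>R"
begin

abbreviation (input) "Lk k \<equiv> L k (jk k)"
abbreviation (input) "Qk k \<equiv> Q k (jk k)"
abbreviation (input) "xb k \<equiv> xbar k (jk k)"
abbreviation (input) "step k \<equiv> norm (x (Suc k) - x k)"

section \<open>Sufficient decrease and vanishing steps\<close>

lemma x_feasible: "x k \<in> feasible g"
proof (induction k)
  case (Suc k)
  show ?case using inner_exit[of k] by (simp add: mba_accept_def x_Suc feasible_def)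
qed (rule x_0)

lemma objective_descent: "objective_real (x (Suc k)) \<le> objective_real (x k) - \<alpha> / 2 * (step k)\<^sup>2"
  using inner_exit[of k] objective_eq[OF x_feasible[of k]] objective_eq[OF x_feasible[of "Suc k"]]
  by (simp add: mba_accept_def x_Suc)

lemma objective_convergent: "convergent (\<lambda>k. objective_real (x k))"
proof -
  obtain b where b: "\<forall>z\<in>feasible g. b \<le> objective_real z"
    using objective_real_bounded_below by blast
  have "decseq (\<lambda>k. objective_real (x k))"
  proof (rule decseq_SucI)
    fix k
    have "0 \<le> \<alpha> / 2 * (step k)\<^sup>2" using params_pos by simp
    then show "objective_real (x (Suc k)) \<le> objective_real (x k)" using objective_descent[of k] by linarith
  qed
  moreover have "b \<le> objective_real (x k)" for k using b x_feasible by blast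
  ultimately show ?thesis using decseq_convergent[of "\<lambda>k. objective_real (x k)" b] by (metis convergentI)
qed

definition objective_limit :: real where
  "objective_limit = lim (\<lambda>k. objective_real (x k))"

lemma objective_tendsto: "(\<lambda>k. objective_real (x k)) \<longlonglongrightarrow> objective_limit"
  unfolding objective_limit_def using objective_convergent convergent_LIMSEQ_iff by blast

lemma step_tendsto: "(\<lambda>k. step k) \<longlonglongrightarrow> 0"
proof -
  have "(\<lambda>k. 2 / \<alpha> * (objective_real (x k) - objective_real (x (Suc k)))) \<longlonglongrightarrow> 2 / \<alpha> * (objective_limit - objective_limit)"
    by (intro tendsto_intros objective_tendsto LIMSEQ_Suc)
  then have lim: "(\<lambda>k. 2 / \<alpha> * (objective_real (x k) - objective_real (x (Suc k)))) \<longlonglongrightarrow> 0" by simp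
  have "(step k)\<^sup>2 \<le> 2 / \<alpha> * (objective_real (x k) - objective_real (x (Suc k)))" for k
    using objective_descent[of k] params_pos by (simp add: field_simps)
  then have "(\<lambda>k. (step k)\<^sup>2) \<longlonglongrightarrow> 0"
    by (intro tendsto_sandwich[OF _ _ tendsto_const lim]) (auto intro!: always_eventually)
  from tendsto_real_sqrt[OF this] show ?thesis by simp
qed

section \<open>Lower bounds for the proximal and curvature parameters\<close>

lemma \<mu>_ge: "j \<le> jk k \<Longrightarrow> \<mu>min \<le> \<mu> k j"
proof (induction j)
  case 0
  show ?case using \<mu>_init[of k] by simp
next
  case (Suc j)
  have 1: "\<mu>min \<le> \<mu> k j" using Suc by simp
  then have "\<mu> k j \<le> \<tau> * \<mu> k j" using params_pos \<mu>_bounds by simp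
  with 1 show ?case
    using update_infeasible[of j k] update_feasible[of j k] Suc.prems
    by (cases "g (y k j) \<in> nonpos_orthant") auto
qed

lemma Q_coercive:
  assumes "j \<le> jk k"
  shows "\<mu>min * (norm z)\<^sup>2 \<le> z \<bullet> Q k j z"
proof -
  have "\<mu>min * (norm z)\<^sup>2 \<le> \<mu> k j * (norm z)\<^sup>2" using \<mu>_ge[OF assms] by (simp add: mult_right_mono)
  also have "\<dots> \<le> z \<bullet> Q k j z"
    using Q_lower[OF assms] by (simp add: loewner_le_def scaleR_blinfun.rep_eq power2_norm_eq_inner)
  finally show ?thesis .
qed

lemma L_multiple: "j \<le> jk k \<Longrightarrow> \<exists>t\<ge>1. L k j = t *\<^sub>R L k 0"
proof (induction j)
  case 0
  show ?case by (intro exI[of _ 1]) simp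
next
  case (Suc j)
  then obtain t where t: "1 \<le> t" "L k j = t *\<^sub>R L k 0" by auto
  have "1 \<le> \<tau> * t" using mult_mono[of 1 \<tau> 1 t] t params_pos by simp
  with t show ?case
    using update_infeasible[of j k] update_feasible[of j k] Suc.prems
    by (cases "g (y k j) \<in> nonpos_orthant") auto
qed

lemma L_ge:
  assumes "j \<le> jk k"
  shows "Lmin \<le> L k j $ i"
proof -
  obtain t where t: "1 \<le> t" "L k j = t *\<^sub>R L k 0" using L_multiple[OF assms] by blast
  have "Lmin \<le> L k 0 $ i" using L_init[of k i] by simp
  also have "\<dots> \<le> t * L k 0 $ i" using t(1) \<open>Lmin \<le> L k 0 $ i\<close> L_bounds by simp
  finally show ?thesis using t(2) by simp
qed

lemma L_nonneg: "j \<le> jk k \<Longrightarrow> L k j \<in> nonneg_orthant"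
  using L_ge L_bounds by (fastforce simp: nonneg_orthant_def intro: order_trans[of 0 Lmin])

section \<open>Boundedness of the data along the run\<close>

lemma \<xi>_convex_subgradient: "convex_subgradient \<psi> (x k) (- \<xi> k)"
  by (rule limiting_subdiff_concave[OF \<psi>_convex \<xi>_subgrad])

lemma x_\<xi>_bound: "\<exists>R\<ge>0. \<forall>k. norm (x k) \<le> R \<and> norm (\<xi> k) \<le> R"
proof -
  obtain r where r: "\<And>k. norm (x k) \<le> r" using x_bounded by (auto simp: bounded_iff)
  obtain b where b: "\<And>z v. norm z \<le> r \<Longrightarrow> convex_subgradient \<psi> z v \<Longrightarrow> norm v \<le> b"
    using convex_subgradient_bounded[OF \<psi>_convex] by metis
  have "norm (\<xi> k) \<le> b" for k using b[OF r \<xi>_convex_subgradient] by simp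
  moreover have "0 \<le> r" using order_trans[OF norm_ge_zero r] .
  ultimately show ?thesis using r by (intro exI[of _ "max r b"]) (auto simp: le_max_iff_disj)
qed

lemma D_bound: "\<exists>B\<ge>0. \<forall>z\<in>D. norm z \<le> B \<and> norm (egrad f z) \<le> B"
proof -
  obtain a where a: "\<forall>z\<in>D. norm z \<le> a" using compact_imp_bounded[OF D(1)] by (auto simp: bounded_iff)
  have "compact (egrad f ` D)"
    by (rule compact_continuous_image[OF lipschitz_on_continuous_on[OF Lf] D(1)])
  then obtain b where b: "\<forall>z\<in>D. norm (egrad f z) \<le> b"
    using compact_imp_bounded by (fastforce simp: bounded_iff)
  show ?thesis using a b by (intro exI[of _ "max 0 (max a b)"]) (auto simp: le_max_iff_disj)
qed

lemma model_eq: "mba_model f \<phi> \<psi> s p A z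
  = real_of_ereal (f s) - \<psi> s + (egrad f s + p) \<bullet> (z - s) + (z - s) \<bullet> A (z - s) / 2 + \<phi> z"
  by (simp add: mba_model_def mba_vartheta_def)

text \<open>The model does not increase from \<open>x k\<close> to \<open>y k j\<close>, its
  quadratic part has modulus at least \<open>\<mu>min\<close>, and all remaining terms decrease at
  most linearly. The bound covers rejected trial points and uses no upper bound on \<mu> or
  \<open>L\<close>, so it can serve to bound \<open>L\<close>: all trial points lie in one ball, on
  which the derivative of \<open>g\<close> is Lipschitz.\<close>

lemma y_bound: "\<exists>R. \<forall>k\<ge>kbar. norm (x k) \<le> R \<and> (\<forall>j\<le>jk k. norm (y k j) \<le> R)"
proof -
  obtain r where r: "0 \<le> r" "\<And>k. norm (x k) \<le> r" "\<And>k. norm (\<xi> k) \<le> r" using x_\<xi>_bound by blast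
  obtain a where a: "0 \<le> a" "\<And>z. z \<in> D \<Longrightarrow> norm (egrad f z) \<le> a" using D_bound by blast
  obtain b where b: "0 \<le> b" "\<And>z w. norm z \<le> r \<Longrightarrow> 1 \<le> norm (w - z) \<Longrightarrow> - b * norm (w - z) \<le> \<phi> w - \<phi> z"
    using convex_on_lower_linear[OF \<phi>_convex] by metis
  \<comment> \<open>Linear rates: \<open>a\<close> bounds the gradient of \<open>f\<close>,
    \<open>r\<close> bounds \<xi>, and \<open>b\<close> bounds the decrease of \<phi>. The 1 is
    needed because the linear lower bound for \<phi> holds only from distance one on.\<close>
  define C where "C = max 1 (2 * (a + r + b) / \<mu>min)"
  have "norm (y k j - x k) \<le> C" if k: "kbar \<le> k" and j: "j \<le> jk k" for k j
  proof (cases "norm (y k j - x k) \<le> 1")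
    case False
    define n where "n = norm (y k j - x k)"
    have n: "1 < n" using False by (simp add: n_def)
    have "(egrad f (x k) + \<xi> k) \<bullet> (y k j - x k) + (y k j - x k) \<bullet> Q k j (y k j - x k) / 2 + \<phi> (y k j) \<le> \<phi> (x k)"
      using inexact_descent[OF j] by (simp add: model_eq)
    moreover have "\<mu>min * n\<^sup>2 \<le> (y k j - x k) \<bullet> Q k j (y k j - x k)"
      unfolding n_def by (rule Q_coercive[OF j])
    moreover have "- b * n \<le> \<phi> (y k j) - \<phi> (x k)"
      unfolding n_def by (rule b(2)[OF r(2)]) (use n n_def in simp)
    moreover have "- ((a + r) * n) \<le> (egrad f (x k) + \<xi> k) \<bullet> (y k j - x k)"
    proof -
      have "norm (egrad f (x k) + \<xi> k) \<le> a + r"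
        using norm_triangle_ineq[of "egrad f (x k)" "\<xi> k"] a(2)[of "x k"] D(5)[OF k] r(3)[of k] by simp
      then have "norm (egrad f (x k) + \<xi> k) * n \<le> (a + r) * n" using n by (intro mult_right_mono) auto
      then show ?thesis
        using Cauchy_Schwarz_ineq2[of "egrad f (x k) + \<xi> k" "y k j - x k"] unfolding n_def by linarith
    qed
    ultimately have "\<mu>min * n\<^sup>2 / 2 \<le> (a + r) * n + b * n" by linarith
    then have "n * (\<mu>min * n) \<le> n * (2 * (a + r + b))" by (simp add: power2_eq_square algebra_simps)
    then have "\<mu>min * n \<le> 2 * (a + r + b)" using n by simp
    then have "n \<le> 2 * (a + r + b) / \<mu>min" using \<mu>_bounds by (simp add: field_simps)
    then show ?thesis by (simp add: C_def n_def)
  qed (simp add: C_def)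
  then have "norm (y k j) \<le> r + C" if "kbar \<le> k" "j \<le> jk k" for k j
    using norm_triangle_sub[of "y k j" "x k"] r(2)[of k] that by (meson add_mono order_trans)
  moreover have "norm (x k) \<le> r + C" for k using r(2)[of k] by (simp add: C_def add_increasing2)
  ultimately show ?thesis by blast
qed

lemma G_y_le:
  assumes "j \<le> jk k"
  shows "mba_G g (y k j) (x k) (L k j) $ i \<le> \<beta>R / 2 * (norm (y k j - x k))\<^sup>2"
proof -
  let ?p = "pos_part (mba_G g (y k j) (x k) (L k j))"
  have "mba_G g (y k j) (x k) (L k j) $ i \<le> ?p $ i" by (simp add: pos_part_def)
  also have "\<dots> \<le> \<bar>?p \<bullet> axis i 1\<bar>" by (simp add: inner_axis)
  also have "\<dots> \<le> infnorm ?p" by (rule Basis_le_infnorm) simp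
  also have "\<dots> \<le> mba_residual f \<psi> g (x k) (\<xi> k) (Q k j) (L k j) (y k j) (v k j) (lam k j)"
    by (simp add: mba_residual_def Let_def)
  also have "\<dots> \<le> \<beta>R / 2 * (norm (y k j - x k))\<^sup>2" by (rule inexact_residual[OF assms])
  finally show ?thesis .
qed

text \<open>\<open>L\<close> grows only after a trial point violating some constraint
  \<open>i\<close>. There the linearization error \<open>K * n\<^sup>2\<close> and the residual must
  outweigh the curvature term, which forces \<open>L k j $ i < \<beta>R + 2 * K\<close>. So only a
  scaling factor that is already bounded is ever multiplied by \<tau>.\<close>

lemma L_upper: "\<exists>B. \<forall>k\<ge>kbar. \<forall>i. Lk k $ i \<le> B"
proof -
  obtain R where R: "\<And>k. kbar \<le> k \<Longrightarrow> norm (x k) \<le> R" "\<And>k j. kbar \<le> k \<Longrightarrow> j \<le> jk k \<Longrightarrow> norm (y k j) \<le> R"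
    using y_bound by blast
  obtain K where K: "K-lipschitz_on (cball 0 R) (derivative_map g)"
    using C11_on_lipschitz_cball[OF g_C11] by metis
  \<comment> \<open>\<open>(\<beta>R + 2 * K) / Lmin\<close> bounds the factor before an increase,
    and one further multiplication by \<tau> may follow. The 1 accounts for the initial
    value.\<close>
  define T where "T = max 1 (\<tau> * ((\<beta>R + 2 * K) / Lmin))"
  have "\<exists>t. 1 \<le> t \<and> t \<le> T \<and> L k j = t *\<^sub>R L k 0" if k: "kbar \<le> k" and "j \<le> jk k" for k j
    using that(2)
  proof (induction j)
    case 0
    show ?case by (intro exI[of _ 1]) (simp add: T_def)
  next
    case (Suc j)
    then have j: "j \<le> jk k" "j < jk k" by auto
    obtain t where t: "1 \<le> t" "t \<le> T" "L k j = t *\<^sub>R L k 0" using Suc j by auto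
    show ?case
    proof (cases "g (y k j) \<in> nonpos_orthant")
      case True
      then show ?thesis using t update_feasible[OF j(2)] by auto
    next
      case False
      then obtain i where i: "0 < g (y k j) $ i" by (auto simp: nonpos_orthant_def not_le)
      define n where "n = norm (y k j - x k)"
      have "norm (g (y k j) - g (x k) - derivative_map g (x k) (y k j - x k)) \<le> K * n\<^sup>2"
        unfolding n_def by (rule C11_on_linearization[OF g_C11 K R(1)[OF k] R(2)[OF k j(1)]])
      then have "(g (y k j) - g (x k) - derivative_map g (x k) (y k j - x k)) $ i \<le> K * n\<^sup>2"
        using component_le_norm_cart[of "g (y k j) - g (x k) - derivative_map g (x k) (y k j - x k)" i] by linarith
      moreover have "g (x k) $ i + derivative_map g (x k) (y k j - x k) $ i + n\<^sup>2 / 2 * L k j $ i \<le> \<beta>R / 2 * n\<^sup>2"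
        using G_y_le[OF j(1), of i] by (simp add: mba_G_eq n_def)
      ultimately have "g (y k j) $ i + n\<^sup>2 / 2 * L k j $ i \<le> K * n\<^sup>2 + \<beta>R / 2 * n\<^sup>2" by simp
      then have "n\<^sup>2 * L k j $ i < n\<^sup>2 * (\<beta>R + 2 * K)" using i by (simp add: field_simps)
      \<comment> \<open>The strict inequality excludes \<open>n = 0\<close>, so the factor
        \<open>n\<^sup>2\<close> can be cancelled.\<close>
      then have "L k j $ i < \<beta>R + 2 * K" by (simp add: mult_less_cancel_left)
      moreover have "t * Lmin \<le> L k j $ i" using t L_init[of k i] by simp
      ultimately have "t * Lmin \<le> \<beta>R + 2 * K" by linarith
      then have "t \<le> (\<beta>R + 2 * K) / Lmin" using L_bounds by (simp add: field_simps)
      then have "\<tau> * t \<le> \<tau> * ((\<beta>R + 2 * K) / Lmin)" using params_pos by (intro mult_left_mono) auto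
      then have "\<tau> * t \<le> T" by (simp add: T_def)
      moreover have "1 \<le> \<tau> * t" using mult_mono[of 1 \<tau> 1 t] t params_pos by simp
      ultimately show ?thesis using update_infeasible[OF j(2) False] t(3) by (intro exI[of _ "\<tau> * t"]) simp
    qed
  qed
  note tT = this
  have "Lk k $ i \<le> T * Lmax" if k: "kbar \<le> k" for k i
  proof -
    obtain t where t: "1 \<le> t" "t \<le> T" "Lk k = t *\<^sub>R L k 0" using tT[OF k] by blast
    have "t * L k 0 $ i \<le> T * Lmax" using t L_init[of k i] L_bounds by (intro mult_mono) auto
    then show ?thesis using t(3) by simp
  qed
  then show ?thesis by blast
qed

lemma L_bound: "\<exists>B\<ge>0. \<forall>k\<ge>kbar. norm (Lk k) \<le> B"
proof -
  obtain B where B: "\<And>k i. kbar \<le> k \<Longrightarrow> Lk k $ i \<le> B" using L_upper by blast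
  have "norm (Lk k) \<le> real CARD('m) * \<bar>B\<bar>" if k: "kbar \<le> k" for k
  proof -
    have "norm (Lk k) \<le> (\<Sum>i\<in>UNIV. \<bar>Lk k $ i\<bar>)" by (rule norm_le_l1_cart)
    also have "\<dots> \<le> (\<Sum>i\<in>(UNIV::'m set). \<bar>B\<bar>)"
    proof (rule sum_mono)
      fix i
      have "0 \<le> Lk k $ i" using L_ge[of "jk k" k i] L_bounds by simp
      then show "\<bar>Lk k $ i\<bar> \<le> \<bar>B\<bar>" using B[OF k, of i] by linarith
    qed
    finally show ?thesis by simp
  qed
  then show ?thesis by (intro exI[of _ "real CARD('m) * \<bar>B\<bar>"]) simp
qed

section \<open>Exact minimizers of the models and their multipliers\<close>

lemma xb_x_le:
  assumes "kbar \<le> k"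
  shows "norm (xb k - x k) \<le> (1 + \<gamma> * sqrt (\<beta>R / 2)) * step k"
  using norm_triangle_ineq4[of "x (Suc k) - x k" "x (Suc k) - xb k"] \<gamma>(2)[of k] assms D(4)
  by (simp add: algebra_simps)

lemma xb_x_tendsto: "(\<lambda>k. xb k - x k) \<longlonglongrightarrow> 0"
proof (rule Lim_null_comparison)
  show "\<forall>\<^sub>F k in sequentially. norm (xb k - x k) \<le> (1 + \<gamma> * sqrt (\<beta>R / 2)) * step k"
    using xb_x_le eventually_sequentially by blast
  show "(\<lambda>k. (1 + \<gamma> * sqrt (\<beta>R / 2)) * step k) \<longlonglongrightarrow> 0"
    using tendsto_mult_right_zero[OF step_tendsto] .
qed

lemma xb_in_Gamma: "xb k \<in> mba_Gamma g (x k) (Lk k)"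
  using xbar_minimizer[of "jk k" k] by (simp add: is_arg_min_def)

lemma xb_minimal:
  "z \<in> mba_Gamma g (x k) (Lk k) \<Longrightarrow>
    mba_model f \<phi> \<psi> (x k) (\<xi> k) (Qk k) (xb k) \<le> mba_model f \<phi> \<psi> (x k) (\<xi> k) (Qk k) z"
  using xbar_minimizer[of "jk k" k] by (auto simp: is_arg_min_def not_less)

lemma x_in_Gamma: "x k \<in> mba_Gamma g (x k) (Lk k)"
  using x_feasible[of k] by (simp add: mba_Gamma_def mba_G_self feasible_def)

text \<open>The gradient of the smooth part of the accepted model at its exact minimizer, with
  \<open>Q\<close> self-adjoint.\<close>

definition model_grad :: "nat \<Rightarrow> real^'n" where
  "model_grad k = egrad f (x k) + \<xi> k + Qk k (xb k - x k)"

text \<open>Minimality is tested on the segment from \<open>xb k\<close> to a point \<open>z\<close>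
  of the convex feasible set. Convexity replaces a derivative of \<phi>; after division by
  \<open>t\<close> the quadratic contribution vanishes as \<open>t\<close> tends to 0, and
  separation then extracts a subgradient of \<phi>.\<close>

lemma optimality:
  "\<exists>p. convex_subgradient \<phi> (xb k) p \<and> (\<forall>z \<in> mba_Gamma g (x k) (Lk k). 0 \<le> (model_grad k + p) \<bullet> (z - xb k))"
proof -
  have conv: "convex (mba_Gamma g (x k) (Lk k))" by (rule convex_mba_Gamma[OF L_nonneg]) simp
  have "0 \<le> model_grad k \<bullet> (z - xb k) + \<phi> z - \<phi> (xb k)" if z: "z \<in> mba_Gamma g (x k) (Lk k)" for z
  proof -
    define h where "h = z - xb k"
    define p where "p = xb k - x k"
    have le: "0 \<le> (model_grad k \<bullet> h + \<phi> z - \<phi> (xb k)) + t * (h \<bullet> Qk k h / 2)" if t: "0 < t" "t \<le> 1" for t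
    proof -
      have w: "xb k + t *\<^sub>R h = (1 - t) *\<^sub>R xb k + t *\<^sub>R z" by (simp add: h_def algebra_simps)
      have "xb k + t *\<^sub>R h \<in> mba_Gamma g (x k) (Lk k)"
        unfolding w by (rule convexD_alt[OF conv xb_in_Gamma z]) (use t in auto)
      then have "mba_model f \<phi> \<psi> (x k) (\<xi> k) (Qk k) (xb k) \<le> mba_model f \<phi> \<psi> (x k) (\<xi> k) (Qk k) (xb k + t *\<^sub>R h)"
        by (rule xb_minimal)
      moreover have "xb k + t *\<^sub>R h - x k = p + t *\<^sub>R h" by (simp add: p_def)
      ultimately have "p \<bullet> Qk k p / 2 + \<phi> (xb k)
        \<le> t * ((egrad f (x k) + \<xi> k) \<bullet> h) + (p + t *\<^sub>R h) \<bullet> Qk k (p + t *\<^sub>R h) / 2 + \<phi> (xb k + t *\<^sub>R h)"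
        by (simp add: model_eq inner_add_right flip: p_def)
      moreover have "(p + t *\<^sub>R h) \<bullet> Qk k (p + t *\<^sub>R h) = p \<bullet> Qk k p + 2 * t * (Qk k p \<bullet> h) + t * t * (h \<bullet> Qk k h)"
      proof -
        have "p \<bullet> Qk k h = Qk k p \<bullet> h" using Q_self_adjoint[of "jk k" k] by (simp add: self_adjoint_def)
        then show ?thesis
          by (simp add: blinfun.add_right blinfun.scaleR_right inner_add_left inner_add_right inner_commute[of h] algebra_simps)
      qed
      moreover have "\<phi> (xb k + t *\<^sub>R h) \<le> (1 - t) * \<phi> (xb k) + t * \<phi> z"
        unfolding w using convex_onD[OF \<phi>_convex, of t "xb k" z] t by simp
      ultimately have "0 \<le> t * ((egrad f (x k) + \<xi> k) \<bullet> h) + t * (Qk k p \<bullet> h) + t * t * (h \<bullet> Qk k h) / 2 + (t * \<phi> z - t * \<phi> (xb k))"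
        by (simp add: left_diff_distrib add_divide_distrib)
      also have "\<dots> = t * ((model_grad k \<bullet> h + \<phi> z - \<phi> (xb k)) + t * (h \<bullet> Qk k h / 2))"
        by (simp add: model_grad_def inner_add_left algebra_simps flip: p_def)
      finally show ?thesis using t(1) by (simp add: zero_le_mult_iff)
    qed
    have "(\<lambda>n. (model_grad k \<bullet> h + \<phi> z - \<phi> (xb k)) + inverse (real (Suc n)) * (h \<bullet> Qk k h / 2))
      \<longlonglongrightarrow> (model_grad k \<bullet> h + \<phi> z - \<phi> (xb k)) + 0 * (h \<bullet> Qk k h / 2)"
      by (intro tendsto_intros LIMSEQ_inverse_real_of_nat)
    then have "0 \<le> (model_grad k \<bullet> h + \<phi> z - \<phi> (xb k)) + 0 * (h \<bullet> Qk k h / 2)"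
      by (rule LIMSEQ_le_const) (use le in \<open>auto simp: inverse_le_1_iff\<close>)
    then show ?thesis by (simp add: h_def)
  qed
  then show ?thesis by (rule convex_optimality[OF \<phi>_convex conv xb_in_Gamma])
qed

definition parameters :: "nat \<Rightarrow> ((real^'m) \<times> ((real^'n) \<Rightarrow>\<^sub>L (real^'n)) \<times> (real^'n) \<times> (real^'n)) \<times> (real^'n)" where
  "parameters k = ((Lk k, Qk k, \<xi> k, x k), xb k)"

lemma parameters_bounded: "bounded (range parameters)"
proof -
  obtain R where R: "\<And>k. norm (x k) \<le> R" "\<And>k. norm (\<xi> k) \<le> R" using x_\<xi>_bound by blast
  obtain B where B: "\<And>k. kbar \<le> k \<Longrightarrow> norm (Lk k) \<le> B" using L_bound by blast
  obtain A where A: "\<And>z. z \<in> D \<Longrightarrow> norm z \<le> A" using D_bound by blast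
  show ?thesis
  proof (rule bounded_range_tail)
    fix k assume k: "kbar \<le> k"
    have "norm (parameters k) \<le> norm (Lk k) + (norm (Qk k) + (norm (\<xi> k) + norm (x k))) + norm (xb k)"
      unfolding parameters_def by (intro order_trans[OF norm_Pair_le] add_mono order_refl)
    also have "\<dots> \<le> B + (\<beta>Q + (R + R)) + A"
      by (intro add_mono B k Q_bound(2) R A) (use D(5)[OF k] in blast)
    finally show "norm (parameters k) \<le> B + (\<beta>Q + (R + R)) + A" .
  qed
qed

lemma parameters_in_bmp_U: "(Lk k, Qk k, \<xi> k, x k) \<in> bmp_U"
proof -
  have "0 < z \<bullet> Qk k z" if "z \<noteq> 0" for z
  proof -
    have "0 < \<mu>min * (norm z)\<^sup>2" using that \<mu>_bounds by simp
    also have "\<dots> \<le> z \<bullet> Qk k z" by (rule Q_coercive) simp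
    finally show ?thesis .
  qed
  then show ?thesis
    using L_nonneg[of "jk k" k] Q_self_adjoint[of "jk k" k] by (simp add: bmp_U_def pos_def_maps_def)
qed

text \<open>The negative of \<open>model_grad k + p k\<close> is normal to the feasible set of the
  model, so the BMP represents it with a multiplier. The BMP is local at cluster points, which is
  why the result holds from some index on. Stationarity is tested against every direction
  \<open>h\<close>, so no adjoint has to be handled later.\<close>

lemma multipliers: "\<exists>p \<zeta> C K. kbar \<le> K \<and> 0 \<le> C \<and> (\<forall>k\<ge>K.
    convex_subgradient \<phi> (xb k) (p k) \<and> norm (p k) \<le> C \<and>
    \<zeta> k \<in> nonneg_orthant \<and> \<zeta> k \<bullet> mba_G g (xb k) (x k) (Lk k) = 0 \<and> norm (\<zeta> k) \<le> C \<and>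
    (\<forall>h. (model_grad k + p k) \<bullet> h + \<zeta> k \<bullet> (derivative_map g (x k) h + ((xb k - x k) \<bullet> h) *\<^sub>R Lk k) = 0))"
proof -
  obtain p where p: "\<And>k. convex_subgradient \<phi> (xb k) (p k)"
    "\<And>k z. z \<in> mba_Gamma g (x k) (Lk k) \<Longrightarrow> 0 \<le> (model_grad k + p k) \<bullet> (z - xb k)"
    using optimality by metis
  have "\<exists>\<kappa> \<U> \<V>. 0 < \<kappa> \<and> open \<U> \<and> fst w \<in> \<U> \<and> open \<V> \<and> snd w \<in> \<V> \<and>
        (\<forall>u \<in> \<U> \<inter> bmp_U. \<forall>z \<in> \<V> \<inter> bmp_S g u. \<forall>q \<in> limiting_normal_cone (bmp_S g u) z.
           \<exists>\<zeta> \<in> limiting_normal_cone nonpos_orthant (bmp_H g u z).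
             nabla (bmp_H g u) z \<zeta> = q \<and> norm \<zeta> \<le> \<kappa> * norm q)"
    if "w \<in> cluster_points parameters" for w
    using BMP[of "fst w" "snd w"] that unfolding parameters_def[abs_def] partial_BMP_def by auto
  then obtain \<kappa> \<U> \<V> where bmp: "\<And>w. w \<in> cluster_points parameters \<Longrightarrow>
      0 < \<kappa> w \<and> open (\<U> w) \<and> fst w \<in> \<U> w \<and> open (\<V> w) \<and> snd w \<in> \<V> w \<and>
        (\<forall>u \<in> \<U> w \<inter> bmp_U. \<forall>z \<in> \<V> w \<inter> bmp_S g u. \<forall>q \<in> limiting_normal_cone (bmp_S g u) z.
           \<exists>\<zeta> \<in> limiting_normal_cone nonpos_orthant (bmp_H g u z).
             nabla (bmp_H g u) z \<zeta> = q \<and> norm \<zeta> \<le> \<kappa> w * norm q)"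
    by metis
  have "open (\<U> w \<times> \<V> w) \<and> w \<in> \<U> w \<times> \<V> w" if "w \<in> cluster_points parameters" for w
    using bmp[OF that] by (simp add: open_Times mem_Times_iff)
  from cluster_points_finite_cover[OF parameters_bounded this]
  obtain I where I: "finite I" "I \<subseteq> cluster_points parameters"
    "eventually (\<lambda>k. parameters k \<in> (\<Union>w\<in>I. \<U> w \<times> \<V> w)) sequentially" by blast
  then obtain K where K: "\<And>k. K \<le> k \<Longrightarrow> parameters k \<in> (\<Union>w\<in>I. \<U> w \<times> \<V> w)"
    unfolding eventually_sequentially by blast
  obtain A where A: "0 \<le> A" "\<And>z. z \<in> D \<Longrightarrow> norm z \<le> A" "\<And>z. z \<in> D \<Longrightarrow> norm (egrad f z) \<le> A" using D_bound by blast
  obtain R where R: "\<And>k. norm (\<xi> k) \<le> R" using x_\<xi>_bound by blast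
  obtain B where B: "\<And>z v. norm z \<le> A \<Longrightarrow> convex_subgradient \<phi> z v \<Longrightarrow> norm v \<le> B"
    using convex_subgradient_bounded[OF \<phi>_convex] by metis
  define Y where "Y = A + R + \<beta>Q * (A + A) + B"
  have pB: "norm (p k) \<le> B" if "kbar \<le> k" for k
    using D(5)[OF that] by (intro B[OF A(2) p(1)]) blast
  have q_bound: "norm (model_grad k + p k) \<le> Y" if k: "kbar \<le> k" for k
  proof -
    have "norm (Qk k (xb k - x k)) \<le> norm (Qk k) * norm (xb k - x k)" by (rule norm_blinfun)
    also have "\<dots> \<le> \<beta>Q * (A + A)"
    proof (rule mult_mono)
      have "norm (xb k - x k) \<le> norm (xb k) + norm (x k)" by (rule norm_triangle_ineq4)
      also have "\<dots> \<le> A + A" using D(5)[OF k] by (intro add_mono A(2)) auto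
      finally show "norm (xb k - x k) \<le> A + A" .
    qed (use Q_bound(1) Q_bound(2)[of k] in auto)
    finally have Qb: "norm (Qk k (xb k - x k)) \<le> \<beta>Q * (A + A)" .
    have "norm (egrad f (x k)) \<le> A" using D(5)[OF k] by (intro A(3)) auto
    then show ?thesis unfolding model_grad_def Y_def
      by (intro norm_triangle_le add_mono R Qb pB k) auto
  qed
  have \<kappa>_nonneg: "0 \<le> \<kappa> w" if "w \<in> I" for w
    by (rule less_imp_le) (use bmp[of w] that I(2) in blast)
  \<comment> \<open>The first entry bounds the subgradients of \<phi>, and its absolute value makes
    \<open>C\<close> nonnegative. In the second, the sum of all \<kappa> dominates whichever one
    belongs to the neighbourhood containing the current data, and \<open>Y\<close> bounds the normal
    vectors.\<close>
  define C where "C = max \<bar>B\<bar> ((\<Sum>w\<in>I. \<kappa> w) * Y)"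
  have "\<exists>\<zeta>. \<zeta> \<in> nonneg_orthant \<and> \<zeta> \<bullet> mba_G g (xb k) (x k) (Lk k) = 0 \<and> norm \<zeta> \<le> C \<and>
    (\<forall>h. (model_grad k + p k) \<bullet> h + \<zeta> \<bullet> (derivative_map g (x k) h + ((xb k - x k) \<bullet> h) *\<^sub>R Lk k) = 0)"
    if k: "max K kbar \<le> k" for k
  proof -
    define u where "u = (Lk k, Qk k, \<xi> k, x k)"
    have S: "bmp_S g u = mba_Gamma g (x k) (Lk k)" and H: "bmp_H g u = (\<lambda>z. mba_G g z (x k) (Lk k))"
      by (auto simp: u_def bmp_S_def bmp_H_def mba_Gamma_def fun_eq_iff)
    obtain w where w: "w \<in> I" "u \<in> \<U> w" "xb k \<in> \<V> w"
      using K[of k] k by (auto simp: parameters_def u_def)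
    have "- (model_grad k + p k) \<in> limiting_normal_cone (bmp_S g u) (xb k)"
      unfolding S by (rule convex_normal[OF xb_in_Gamma]) (use p(2)[of _ k] in \<open>simp only: inner_minus_left neg_le_0_iff_le\<close>)
    moreover have "u \<in> \<U> w \<inter> bmp_U" using w parameters_in_bmp_U by (simp add: u_def)
    moreover have "xb k \<in> \<V> w \<inter> bmp_S g u" using w xb_in_Gamma by (simp add: S)
    ultimately obtain \<zeta> where \<zeta>: "\<zeta> \<in> limiting_normal_cone nonpos_orthant (bmp_H g u (xb k))"
      "nabla (bmp_H g u) (xb k) \<zeta> = - (model_grad k + p k)" "norm \<zeta> \<le> \<kappa> w * norm (- (model_grad k + p k))"
      using bmp[of w] w(1) I(2) by blast
    have "norm \<zeta> \<le> \<kappa> w * norm (model_grad k + p k)" using \<zeta>(3) by (simp only: norm_minus_cancel)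
    also have "\<dots> \<le> (\<Sum>w\<in>I. \<kappa> w) * Y"
    proof (rule mult_mono)
      show "\<kappa> w \<le> (\<Sum>w\<in>I. \<kappa> w)"
        by (rule member_le_sum[OF w(1) _ I(1)]) (use \<kappa>_nonneg in blast)
      show "norm (model_grad k + p k) \<le> Y" using k by (intro q_bound) auto
      show "0 \<le> (\<Sum>w\<in>I. \<kappa> w)" by (rule sum_nonneg) (rule \<kappa>_nonneg)
    qed simp
    also have "\<dots> \<le> C" by (simp add: C_def)
    finally have "norm \<zeta> \<le> C" .
    moreover have "(model_grad k + p k) \<bullet> h + \<zeta> \<bullet> (derivative_map g (x k) h + ((xb k - x k) \<bullet> h) *\<^sub>R Lk k) = 0" for h
      using nabla_mba_G[of "x k" "Lk k" "xb k" \<zeta> h] \<zeta>(2) unfolding H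
      by (simp only: inner_minus_left)
    ultimately show ?thesis
      using limiting_normal_cone_nonpos_orthant[OF \<zeta>(1)] unfolding H by blast
  qed
  then obtain \<zeta> where "\<And>k. max K kbar \<le> k \<Longrightarrow> \<zeta> k \<in> nonneg_orthant \<and> \<zeta> k \<bullet> mba_G g (xb k) (x k) (Lk k) = 0 \<and> norm (\<zeta> k) \<le> C \<and>
    (\<forall>h. (model_grad k + p k) \<bullet> h + \<zeta> k \<bullet> (derivative_map g (x k) h + ((xb k - x k) \<bullet> h) *\<^sub>R Lk k) = 0)"
    by metis
  moreover have "norm (p k) \<le> C" if "kbar \<le> k" for k
    using pB[OF that] by (auto simp: C_def le_max_iff_disj)
  moreover have "0 \<le> C" by (simp add: C_def le_max_iff_disj)
  ultimately show ?thesis using p(1)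
    by (intro exI[of _ p] exI[of _ \<zeta>] exI[of _ C] exI[of _ "max K kbar"]) simp
qed

end

section \<open>The potential along the iterates\<close>

lemma conjugate_fun_ge: "ereal (v \<bullet> z - h z) \<le> conjugate_fun h v"
  unfolding conjugate_fun_def by (rule SUP_upper) simp

text \<open>The equality case of the Fenchel-Young inequality. It makes the conjugate finite and
  explicit at \<open>- \<xi> k\<close>.\<close>

lemma conjugate_fun_subgradient:
  assumes "convex_subgradient h z v"
  shows "conjugate_fun h v = ereal (v \<bullet> z - h z)"
proof (rule antisym[OF _ conjugate_fun_ge])
  have "v \<bullet> u - h u \<le> v \<bullet> z - h z" for u
    using assms[unfolded convex_subgradient_def, rule_format, of u] by (simp add: inner_diff_right)
  then show "conjugate_fun h v \<le> ereal (v \<bullet> z - h z)"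
    unfolding conjugate_fun_def by (intro SUP_least) simp
qed

lemma norm_fst_le': "norm (fst w) \<le> norm w" and norm_snd_le': "norm (snd w) \<le> norm w"
  by (cases w, simp add: norm_fst_le norm_snd_le)+

lemma abs_inner_le:
  assumes "norm u \<le> a" "norm v \<le> b"
  shows "\<bar>u \<bullet> v\<bar> \<le> a * b"
proof -
  have "\<bar>u \<bullet> v\<bar> \<le> norm u * norm v" by (rule Cauchy_Schwarz_ineq2)
  also have "\<dots> \<le> a * b" using assms order_trans[OF norm_ge_zero assms(1)] by (intro mult_mono) auto
  finally show ?thesis .
qed

context mba_run
begin

definition state :: "nat \<Rightarrow> ((real^'n) \<times> (real^'n) \<times> (real^'m) \<times> (real^'n)) \<times> (real^'n)" where
  "state k = ((xb k, x k, Lk k, \<xi> k), x (Suc k) - x k)"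

text \<open>The finite value of the potential at the iterate: the constraint indicator vanishes
  there, and Fenchel-Young equality at \<open>x k\<close> turns the last two terms of the potential
  into \<open>(xb k - x k) \<bullet> \<xi> k - \<psi> (x k)\<close>.\<close>

definition pot :: "nat \<Rightarrow> real" where
  "pot k = real_of_ereal (f (xb k)) + \<phi> (xb k) + (xb k - x k) \<bullet> \<xi> k - \<psi> (x k) + c * (step k)\<^sup>2"

lemma potential_state:
  assumes "kbar \<le> k"
  shows "potential_c f \<phi> \<psi> g c (state k) = ereal (pot k)"
proof -
  have "f (xb k) = ereal (real_of_ereal (f (xb k)))" using D(3) D(5)[OF assms] by (intro f_real) auto
  then obtain a where a: "f (xb k) = ereal a" ..
  moreover have "Lk k \<in> pos_orthant"
    using L_ge[of "jk k" k] L_bounds by (auto simp: pos_orthant_def intro: less_le_trans[of 0 Lmin])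
  moreover have "mba_G g (xb k) (x k) (Lk k) \<in> nonpos_orthant"
    using xb_in_Gamma by (simp add: mba_Gamma_def)
  moreover have "conjugate_fun \<psi> (- \<xi> k) = ereal ((- \<xi> k) \<bullet> x k - \<psi> (x k))"
    by (rule conjugate_fun_subgradient[OF \<xi>_convex_subgradient])
  ultimately show ?thesis
    by (simp add: potential_c_def potential_def state_def pot_def ind_fun_def inner_diff_left inner_diff_right inner_commute)
qed

lemma quadratic_le: "(xb k - x k) \<bullet> Qk k (xb k - x k) \<le> \<beta>Q * (norm (xb k - x k))\<^sup>2"
proof -
  have "(xb k - x k) \<bullet> Qk k (xb k - x k) \<le> norm (xb k - x k) * norm (Qk k (xb k - x k))"
    by (rule norm_cauchy_schwarz)
  also have "\<dots> \<le> norm (xb k - x k) * (\<beta>Q * norm (xb k - x k))"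
    by (intro mult_left_mono order_trans[OF norm_blinfun] mult_right_mono Q_bound(2)) auto
  finally show ?thesis by (simp add: power2_eq_square mult.left_commute)
qed

lemma quadratic_nonneg: "0 \<le> z \<bullet> Qk k z"
  using Q_coercive[of "jk k" k z] \<mu>_bounds by (smt (verit) mult_nonneg_nonneg order_refl zero_le_power2)

text \<open>The mean value inequality is applied on the segment from \<open>x (Suc k)\<close> to the exact
  minimizer; comparing with the linearization at \<open>x k\<close> there is what makes the constant \<open>c\<close> suffice.\<close>

lemma objective_le_pot:
  assumes k: "kbar \<le> k"
  shows "objective_real (x (Suc k)) \<le> pot k"
proof -
  define d where "d = step k"
  define e where "e = norm (xb k - x (Suc k))"
  let ?f = "\<lambda>z. real_of_ereal (f z)"
  let ?q = "egrad f (x k)"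
  have Lf0: "0 \<le> Lf" by (rule lipschitz_on_nonneg[OF Lf])
  have de: "0 \<le> d" "0 \<le> e" by (simp_all add: d_def e_def)
  have "\<bar>?f (xb k) - ?f (x (Suc k)) - ?q \<bullet> (xb k - x (Suc k))\<bar>
    \<le> Lf * (norm (xb k - x (Suc k)) + norm (x (Suc k) - x k)) * norm (xb k - x (Suc k))"
    using D(3) D(5)[OF k] D(5)[of "Suc k"] k by (intro mean_value_gradient[OF D(2) _ _ _ f_GDERIV Lf]) auto
  then have 1: "?f (x (Suc k)) \<le> ?f (xb k) + ?q \<bullet> (x (Suc k) - xb k) + Lf * (e + d) * e"
    by (simp add: e_def d_def inner_diff_right abs_le_iff)
  have "(?q + \<xi> k) \<bullet> (x (Suc k) - x k) + (x (Suc k) - x k) \<bullet> Qk k (x (Suc k) - x k) / 2 + \<phi> (x (Suc k))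
      - ((?q + \<xi> k) \<bullet> (xb k - x k) + (xb k - x k) \<bullet> Qk k (xb k - x k) / 2 + \<phi> (xb k)) \<le> \<beta>F / 2 * d\<^sup>2"
    using inexact_gap[of "jk k" k] by (simp add: model_eq d_def x_Suc)
  moreover have "(xb k - x k) \<bullet> Qk k (xb k - x k) \<le> \<beta>Q * (e + d)\<^sup>2"
  proof -
    have "norm (xb k - x k) \<le> e + d"
      using norm_triangle_ineq[of "xb k - x (Suc k)" "x (Suc k) - x k"] by (simp add: e_def d_def)
    then have "\<beta>Q * (norm (xb k - x k))\<^sup>2 \<le> \<beta>Q * (e + d)\<^sup>2"
      using Q_bound(1) by (intro mult_left_mono power_mono) auto
    then show ?thesis using quadratic_le[of k] by linarith
  qed
  ultimately have 2: "(?q + \<xi> k) \<bullet> (x (Suc k) - x k) + \<phi> (x (Suc k))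
      - ((?q + \<xi> k) \<bullet> (xb k - x k) + \<phi> (xb k)) \<le> \<beta>F / 2 * d\<^sup>2 + \<beta>Q * (e + d)\<^sup>2 / 2"
    using quadratic_nonneg[of "x (Suc k) - x k" k] by linarith
  have 3: "\<psi> (x k) - \<xi> k \<bullet> (x (Suc k) - x k) \<le> \<psi> (x (Suc k))"
    using \<xi>_convex_subgradient[of k, unfolded convex_subgradient_def, rule_format, of "x (Suc k)"] by simp
  have "e\<^sup>2 \<le> (\<gamma> * sqrt (\<beta>R / 2) * d)\<^sup>2"
    using \<gamma>(2)[of k] k D(4) by (intro power_mono) (simp_all add: e_def d_def norm_minus_commute)
  then have e2: "e\<^sup>2 \<le> \<gamma>\<^sup>2 * \<beta>R / 2 * d\<^sup>2" using params_pos by (simp add: power_mult_distrib)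
  have ed: "2 * (e * d) \<le> e\<^sup>2 + d\<^sup>2" using sum_squares_bound[of e d] by simp
  \<comment> \<open>The product \<open>e * d\<close> is split by the arithmetic mean and
    \<open>e\<close> is then traded for \<open>d\<close> through \<gamma>. The estimate is looser
    than necessary so that it matches the prescribed constant.\<close>
  have "Lf * (e + d) * e = Lf * (e\<^sup>2 + e * d)" by (simp add: power2_eq_square algebra_simps)
  also have "\<dots> \<le> Lf * (2 * e\<^sup>2 + d\<^sup>2)"
    using ed zero_le_power2[of e] zero_le_power2[of d] by (intro mult_left_mono[OF _ Lf0]) linarith
  also have "\<dots> \<le> Lf * (\<gamma>\<^sup>2 * \<beta>R * d\<^sup>2 + d\<^sup>2)" using e2 Lf0 by (intro mult_left_mono) auto
  finally have 4: "Lf * (e + d) * e \<le> Lf * (\<gamma>\<^sup>2 * \<beta>R * d\<^sup>2 + d\<^sup>2)" .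
  have "\<beta>Q * (e + d)\<^sup>2 / 2 = \<beta>Q / 2 * (e\<^sup>2 + d\<^sup>2 + 2 * (e * d))" by (simp add: power2_sum)
  also have "\<dots> \<le> \<beta>Q / 2 * (2 * (\<gamma>\<^sup>2 * \<beta>R / 2 * d\<^sup>2) + 2 * d\<^sup>2)"
    using ed e2 Q_bound(1) by (intro mult_left_mono) auto
  finally have 5: "\<beta>Q * (e + d)\<^sup>2 / 2 \<le> \<beta>Q / 2 * (2 * (\<gamma>\<^sup>2 * \<beta>R / 2 * d\<^sup>2) + 2 * d\<^sup>2)" .
  \<comment> \<open>The three parts of \<open>c\<close>: the linearization error of
    \<open>f\<close>, the tolerance on the model value, and the quadratic term of the model at the
    exact minimizer.\<close>
  have 6: "c * d\<^sup>2 = Lf * (\<gamma>\<^sup>2 * \<beta>R * d\<^sup>2 + d\<^sup>2) + \<beta>F / 2 * d\<^sup>2 + \<beta>Q / 2 * (2 * (\<gamma>\<^sup>2 * \<beta>R / 2 * d\<^sup>2) + 2 * d\<^sup>2)"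
    unfolding c by (simp add: field_simps)
  have 7: "(?q + \<xi> k) \<bullet> (x (Suc k) - x k) - (?q + \<xi> k) \<bullet> (xb k - x k)
    = ?q \<bullet> (x (Suc k) - xb k) + \<xi> k \<bullet> (x (Suc k) - x k) - (xb k - x k) \<bullet> \<xi> k"
    by (simp add: inner_add_left inner_diff_right inner_commute[of "xb k - x k"])
  show ?thesis
    unfolding objective_real_def pot_def d_def[symmetric] using 1 2 3 4 5 6 7 by linarith
qed

text \<open>The old iterate is feasible for its own model, so the exact minimizer does not exceed
  its model value. Dropping the nonnegative quadratic term and replacing the linear part by
  \<open>f\<close> costs only \<open>Lf\<close> times a squared distance.\<close>

lemma pot_le_objective:
  assumes k: "kbar \<le> k"
  shows "pot k \<le> objective_real (x k) + Lf * (norm (xb k - x k))\<^sup>2 + c * (step k)\<^sup>2"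
proof -
  let ?f = "\<lambda>z. real_of_ereal (f z)"
  have "\<bar>?f (xb k) - ?f (x k) - egrad f (x k) \<bullet> (xb k - x k)\<bar>
    \<le> Lf * (norm (xb k - x k) + norm (x k - x k)) * norm (xb k - x k)"
    using D(3) D(5)[OF k] by (intro mean_value_gradient[OF D(2) _ _ _ f_GDERIV Lf]) auto
  then have "?f (xb k) \<le> ?f (x k) + egrad f (x k) \<bullet> (xb k - x k) + Lf * (norm (xb k - x k))\<^sup>2"
    by (simp add: power2_eq_square)
  moreover have "(egrad f (x k) + \<xi> k) \<bullet> (xb k - x k) + (xb k - x k) \<bullet> Qk k (xb k - x k) / 2 + \<phi> (xb k) \<le> \<phi> (x k)"
    using xb_minimal[OF x_in_Gamma, of k] by (simp add: model_eq)
  moreover have "(egrad f (x k) + \<xi> k) \<bullet> (xb k - x k) = egrad f (x k) \<bullet> (xb k - x k) + (xb k - x k) \<bullet> \<xi> k"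
    by (simp add: inner_add_left inner_commute[of "xb k - x k"])
  ultimately show ?thesis
    unfolding objective_real_def pot_def using quadratic_nonneg[of "xb k - x k" k] by linarith
qed

lemma pot_tendsto: "pot \<longlonglongrightarrow> objective_limit"
proof (rule tendsto_sandwich)
  show "\<forall>\<^sub>F k in sequentially. objective_real (x (Suc k)) \<le> pot k"
    using objective_le_pot eventually_sequentially by blast
  show "\<forall>\<^sub>F k in sequentially. pot k \<le> objective_real (x k) + Lf * (norm (xb k - x k))\<^sup>2 + c * (step k)\<^sup>2"
    using pot_le_objective eventually_sequentially by blast
  show "(\<lambda>k. objective_real (x (Suc k))) \<longlonglongrightarrow> objective_limit"
    by (rule LIMSEQ_Suc[OF objective_tendsto])
  have "(\<lambda>k. objective_real (x k) + Lf * (norm (xb k - x k))\<^sup>2 + c * (step k)\<^sup>2) \<longlonglongrightarrow> objective_limit + Lf * 0\<^sup>2 + c * 0\<^sup>2"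
    by (intro tendsto_intros objective_tendsto step_tendsto tendsto_norm_zero[OF xb_x_tendsto])
  then show "(\<lambda>k. objective_real (x k) + Lf * (norm (xb k - x k))\<^sup>2 + c * (step k)\<^sup>2) \<longlonglongrightarrow> objective_limit"
    by simp
qed

lemma state_bounded: "bounded (range state)"
proof -
  obtain R where R: "\<And>k. norm (x k) \<le> R" "\<And>k. norm (\<xi> k) \<le> R" using x_\<xi>_bound by blast
  obtain B where B: "\<And>k. kbar \<le> k \<Longrightarrow> norm (Lk k) \<le> B" using L_bound by blast
  obtain A where A: "\<And>z. z \<in> D \<Longrightarrow> norm z \<le> A" using D_bound by blast
  show ?thesis
  proof (rule bounded_range_tail)
    fix k assume k: "kbar \<le> k"
    have "norm (state k) \<le> (norm (xb k) + (norm (x k) + (norm (Lk k) + norm (\<xi> k)))) + (norm (x (Suc k)) + norm (x k))"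
      unfolding state_def by (intro order_trans[OF norm_Pair_le] add_mono norm_triangle_ineq4 order_refl)
    also have "\<dots> \<le> (A + (R + (B + R))) + (R + R)"
      by (intro add_mono B k R A) (use D(5)[OF k] in blast)
    finally show "norm (state k) \<le> (A + (R + (B + R))) + (R + R)" .
  qed
qed

section \<open>Values at the cluster points\<close>

lemma limit_feasible:
  assumes "(x \<circ> r) \<longlonglongrightarrow> s"
  shows "s \<in> feasible g"
proof -
  have "isCont g s" using g_differentiable differentiable_imp_continuous_within by blast
  then have "(\<lambda>n. g ((x \<circ> r) n)) \<longlonglongrightarrow> g s" using assms by (rule isCont_tendsto_compose)
  then have lim: "(\<lambda>n. g ((x \<circ> r) n) $ i) \<longlonglongrightarrow> g s $ i" for i by (rule tendsto_vec_nth)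
  have "g s $ i \<le> 0" for i
    by (rule LIMSEQ_le_const2[OF lim]) (use x_feasible in \<open>auto simp: feasible_def nonpos_orthant_def\<close>)
  then show ?thesis by (simp add: feasible_def nonpos_orthant_def)
qed

lemma objective_real_limit:
  assumes r: "strict_mono r" and lim: "(x \<circ> r) \<longlonglongrightarrow> s"
  shows "objective_real s = objective_limit"
proof -
  have s: "s \<in> \<O>" using limit_feasible[OF lim] feasible_subset by blast
  have cont: "isCont h s" if "convex_on UNIV h" for h :: "real^'n \<Rightarrow> real"
    using continuous_convex[OF that] by (simp add: continuous_on_eq_continuous_at)
  have "isCont objective_real s"
    unfolding objective_real_def[abs_def]
    by (intro continuous_intros f_continuous[OF s] cont \<phi>_convex \<psi>_convex)
  then have "(\<lambda>n. objective_real ((x \<circ> r) n)) \<longlonglongrightarrow> objective_real s" using lim by (rule isCont_tendsto_compose)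
  moreover have "((\<lambda>k. objective_real (x k)) \<circ> r) \<longlonglongrightarrow> objective_limit"
    by (rule LIMSEQ_subseq_LIMSEQ[OF objective_tendsto r])
  ultimately show ?thesis using LIMSEQ_unique by (force simp: o_def)
qed

text \<open>The potential contains an indicator and a conjugate and so is not continuous; its value
  at a cluster point is computed directly. The two primal components coincide there and the step
  component is 0, so the constraint model reduces to \<open>g s\<close>, while the limit of
  \<open>- \<xi>\<close> is again a subgradient of \<psi> and the Fenchel-Young equality
  applies.\<close>

lemma potential_cluster_point:
  assumes "w \<in> cluster_points state"
  shows "potential_c f \<phi> \<psi> g c w = ereal objective_limit"
proof -
  obtain r where r: "strict_mono r" "(state \<circ> r) \<longlonglongrightarrow> w" using assms by (auto simp: cluster_points_def)
  obtain a s l p d where w: "w = ((a, s, l, p), d)" by (metis prod.exhaust)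
  have "(\<lambda>n. fst (fst ((state \<circ> r) n))) \<longlonglongrightarrow> fst (fst w)"
    "(\<lambda>n. fst (snd (fst ((state \<circ> r) n)))) \<longlonglongrightarrow> fst (snd (fst w))"
    "(\<lambda>n. fst (snd (snd (fst ((state \<circ> r) n))))) \<longlonglongrightarrow> fst (snd (snd (fst w)))"
    "(\<lambda>n. snd (snd (snd (fst ((state \<circ> r) n))))) \<longlonglongrightarrow> snd (snd (snd (fst w)))"
    "(\<lambda>n. snd ((state \<circ> r) n)) \<longlonglongrightarrow> snd w"
    by (intro tendsto_intros r(2))+
  then have lims: "(\<lambda>n. xb (r n)) \<longlonglongrightarrow> a" "(\<lambda>n. x (r n)) \<longlonglongrightarrow> s" "(\<lambda>n. Lk (r n)) \<longlonglongrightarrow> l" "(\<lambda>n. \<xi> (r n)) \<longlonglongrightarrow> p"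
    "(\<lambda>n. x (Suc (r n)) - x (r n)) \<longlonglongrightarrow> d"
    by (simp_all add: state_def w)
  have "(\<lambda>n. xb (r n) - x (r n)) \<longlonglongrightarrow> 0"
    using LIMSEQ_subseq_LIMSEQ[OF xb_x_tendsto r(1)] by (simp add: o_def)
  then have a: "a = s" using LIMSEQ_unique[OF _ tendsto_diff[OF lims(1,2)]] by force
  have "(\<lambda>n. x (Suc (r n)) - x (r n)) \<longlonglongrightarrow> 0"
    using LIMSEQ_subseq_LIMSEQ[OF tendsto_norm_zero_cancel[OF step_tendsto] r(1)] by (simp add: o_def)
  then have d: "d = 0" using LIMSEQ_unique lims(5) by blast
  have xr: "(x \<circ> r) \<longlonglongrightarrow> s" using lims(2) by (simp add: o_def)
  have s: "s \<in> feasible g" by (rule limit_feasible[OF xr])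
  have "Lmin \<le> l $ i" for i
    by (rule LIMSEQ_le_const[OF tendsto_vec_nth[OF lims(3)]]) (use L_ge in auto)
  then have l: "l \<in> pos_orthant" using L_bounds by (auto simp: pos_orthant_def intro: less_le_trans[of 0 Lmin])
  have "convex_subgradient \<psi> s (- p)"
    by (rule convex_subgradient_limit[OF continuous_convex[OF \<psi>_convex] \<xi>_convex_subgradient lims(2) tendsto_minus[OF lims(4)]])
  then have conj: "conjugate_fun \<psi> (- p) = ereal ((- p) \<bullet> s - \<psi> s)" by (rule conjugate_fun_subgradient)
  have "f s = ereal (real_of_ereal (f s))" using s feasible_subset by (intro f_real) auto
  then obtain b where b: "f s = ereal b" ..
  have "potential_c f \<phi> \<psi> g c w = ereal (objective_real s)"
    using s l conj b
    by (simp add: w a d potential_c_def potential_def ind_fun_def mba_G_self feasible_def objective_real_def inner_commute)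
  then show ?thesis using objective_real_limit[OF r(1) xr] by simp
qed

text \<open>The subgradient is the gradient of a smooth minorant that touches the potential at the
  iterate: the multiplier term replaces the indicator function, and the affine function
  \<open>- \<xi> \<bullet> x k - \<psi> (x k)\<close> of \<open>\<xi>\<close> replaces the conjugate.\<close>

lemma potential_subgradient:
  "\<exists>b\<ge>0. \<exists>K. \<forall>k\<ge>K. \<exists>q\<in>limiting_subdiff (potential_c f \<phi> \<psi> g c) (state k). norm q \<le> b * step k"
proof -
  obtain p \<zeta> C K where K: "kbar \<le> K" "0 \<le> C" and mult: "\<And>k. K \<le> k \<Longrightarrow>
    convex_subgradient \<phi> (xb k) (p k) \<and> norm (p k) \<le> C \<and>
    \<zeta> k \<in> nonneg_orthant \<and> \<zeta> k \<bullet> mba_G g (xb k) (x k) (Lk k) = 0 \<and> norm (\<zeta> k) \<le> C \<and>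
    (\<forall>h. (model_grad k + p k) \<bullet> h + \<zeta> k \<bullet> (derivative_map g (x k) h + ((xb k - x k) \<bullet> h) *\<^sub>R Lk k) = 0)"
    using multipliers by blast
  obtain B where B: "0 \<le> B" "\<And>k. kbar \<le> k \<Longrightarrow> norm (Lk k) \<le> B" using L_bound by blast
  obtain R where R: "\<And>k. norm (x k) \<le> R" using x_\<xi>_bound by blast
  obtain A where A: "0 \<le> A" "\<And>z. z \<in> D \<Longrightarrow> norm z \<le> A" using D_bound by blast
  \<comment> \<open>The radius exceeds the bound for the iterates by one, so that every
    \<open>x k\<close> is an interior point, as the bound for the second derivative
    requires.\<close>
  obtain K2 where K2: "K2-lipschitz_on (cball 0 (R + 1)) (derivative_map g)"
    using C11_on_lipschitz_cball[OF g_C11] by metis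
  have K20: "0 \<le> K2" and Lf0: "0 \<le> Lf" using lipschitz_on_nonneg K2 Lf by auto
  \<comment> \<open>\<open>C1\<close> converts the distance from \<open>x k\<close> to the exact
    minimizer into the step length. \<open>E\<close> adds up the coefficients of that distance:
    gradient difference of \<open>f\<close>, quadratic term of the model, second derivative of
    \<open>g\<close>, curvature in the \<open>S\<close> direction, the \<open>L\<close> direction,
    and the \<xi> direction. The last term of \<open>b\<close> comes from the squared step in the
    potential.\<close>
  define C1 where "C1 = 1 + \<gamma> * sqrt (\<beta>R / 2)"
  define E where "E = Lf + \<beta>Q + C * K2 + B * C + A * C + 1"
  define b where "b = E * C1 + 2 * \<bar>c\<bar>"
  have E0: "0 \<le> E" using K20 Lf0 K(2) B(1) A(1) Q_bound(1) by (simp add: E_def)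
  have C10: "0 \<le> C1" using \<gamma>(1) params_pos by (simp add: C1_def)
  have b0: "0 \<le> b" using E0 C10 by (simp add: b_def)
  have "\<exists>q\<in>limiting_subdiff (potential_c f \<phi> \<psi> g c) (state k). norm q \<le> b * step k" if k: "K \<le> k" for k
  proof -
    have kb: "kbar \<le> k" using k K(1) by simp
    define a s l e d0 n where "a = xb k" and "s = x k" and "l = Lk k" and "e = \<xi> k"
      and "d0 = x (Suc k) - x k" and "n = norm (xb k - x k)"
    note defs = a_def s_def l_def e_def d0_def
    obtain B' where B': "(derivative_map g has_derivative B') (at s)"
      using g_twice by (auto simp: twice_differentiable_def differentiable_def)
    have B'_le: "norm (B' h) \<le> K2 * norm h" for h
      by (rule has_derivative_norm_le[OF B' K2]) (use R[of k] in \<open>simp add: s_def\<close>)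
    define X S LL EE where "X = (\<lambda>w::((real^'n) \<times> (real^'n) \<times> (real^'m) \<times> (real^'n)) \<times> (real^'n). fst (fst w))"
      and "S = (\<lambda>w::((real^'n) \<times> (real^'n) \<times> (real^'m) \<times> (real^'n)) \<times> (real^'n). fst (snd (fst w)))"
      and "LL = (\<lambda>w::((real^'n) \<times> (real^'n) \<times> (real^'m) \<times> (real^'n)) \<times> (real^'n). fst (snd (snd (fst w))))"
      and "EE = (\<lambda>w::((real^'n) \<times> (real^'n) \<times> (real^'m) \<times> (real^'n)) \<times> (real^'n). snd (snd (snd (fst w))))"
    have at: "X (state k) = a" "S (state k) = s" "LL (state k) = l" "EE (state k) = e" "snd (state k) = d0"
      by (simp_all add: X_def S_def LL_def EE_def state_def defs)
    have derX: "(X has_derivative X) (at w)" and derS: "(S has_derivative S) (at w)"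
      and derL: "(LL has_derivative LL) (at w)" and derE: "(EE has_derivative EE) (at w)" for w
      unfolding X_def S_def LL_def EE_def by (intro has_derivative_fst has_derivative_snd has_derivative_ident)+
    define m where "m w = real_of_ereal (f (X w)) + (\<phi> a + p k \<bullet> (X w - a)) + \<zeta> k \<bullet> mba_G g (X w) (S w) (LL w)
      + X w \<bullet> EE w + ((- EE w) \<bullet> s - \<psi> s) + c * (norm (snd w))\<^sup>2" for w
    define DG where "DG h = derivative_map g s (X h) + B' (S h) (a - s)
      + ((a - s) \<bullet> (X h - S h)) *\<^sub>R l + ((norm (a - s))\<^sup>2 / 2) *\<^sub>R LL h" for h
    define T where "T h = X h \<bullet> egrad f a + p k \<bullet> X h + \<zeta> k \<bullet> DG h + (a \<bullet> EE h + X h \<bullet> e) - EE h \<bullet> s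
      + 2 * c * (d0 \<bullet> snd h)" for h
    have aO: "a \<in> \<O>" using D(3) D(5)[OF kb] by (auto simp: a_def)
    have "((\<lambda>w. mba_G g (X w) (S w) (LL w)) has_derivative DG) (at (state k))"
      using mba_G_joint_has_derivative[OF B' derX derS derL, of "state k"] at by (simp add: DG_def[abs_def])
    note derG = has_derivative_inner_right[OF this, of "\<zeta> k"]
    have "GDERIV (\<lambda>z. real_of_ereal (f z)) (X (state k)) :> egrad f a" using f_GDERIV[OF aO] at by simp
    then have derf: "((\<lambda>w. real_of_ereal (f (X w))) has_derivative (\<lambda>h. X h \<bullet> egrad f a)) (at (state k))"
      unfolding gderiv_def by (rule has_derivative_compose[OF derX])
    have derp: "((\<lambda>w. \<phi> a + p k \<bullet> (X w - a)) has_derivative (\<lambda>h. p k \<bullet> X h)) (at (state k))"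
      by (rule has_derivative_eq_rhs, (rule derivative_intros derX)+) simp
    have derXE: "((\<lambda>w. X w \<bullet> EE w) has_derivative (\<lambda>h. a \<bullet> EE h + X h \<bullet> e)) (at (state k))"
      using has_derivative_inner[OF derX derE, of "state k"] at by simp
    have derEs: "((\<lambda>w. (- EE w) \<bullet> s - \<psi> s) has_derivative (\<lambda>h. - (EE h \<bullet> s))) (at (state k))"
      by (rule has_derivative_eq_rhs, (rule derivative_intros derE)+) simp
    have derd: "((\<lambda>w. c * (norm (snd w))\<^sup>2) has_derivative (\<lambda>h. 2 * c * (d0 \<bullet> snd h))) (at (state k))"
      unfolding power2_norm_eq_inner
      by (rule has_derivative_eq_rhs, (rule derivative_intros)+) (simp add: at inner_commute algebra_simps)
    have der: "(m has_derivative T) (at (state k))"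
      unfolding m_def[abs_def] T_def[abs_def]
      by (rule has_derivative_eq_rhs[OF has_derivative_add[OF has_derivative_add[OF has_derivative_add[OF has_derivative_add[OF
          has_derivative_add[OF derf derp] derG] derXE] derEs] derd]]) (simp add: algebra_simps)
    have n: "n = norm (a - s)" "0 \<le> n" by (simp_all add: n_def defs)
    have nA: "n \<le> 2 * A"
      using norm_triangle_ineq4[of "xb k" "x k"] A(2)[of "xb k"] A(2)[of "x k"] D(5)[OF kb] by (simp add: n_def)
    have nC: "n \<le> C1 * step k" unfolding n_def C1_def by (rule xb_x_le[OF kb])
    have T_le: "T h \<le> (b * step k) * norm h" for h
    proof -
      define N where "N = norm h"
      have N: "norm (X h) \<le> N" "norm (S h) \<le> N" "norm (LL h) \<le> N" "norm (EE h) \<le> N" "norm (snd h) \<le> N"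
        unfolding N_def X_def S_def LL_def EE_def
        by (intro order_trans[OF norm_fst_le'] order_trans[OF norm_snd_le'] order_refl)+
      have N0: "0 \<le> N" by (simp add: N_def)
      have kkt: "(model_grad k + p k) \<bullet> X h + \<zeta> k \<bullet> (derivative_map g s (X h) + ((a - s) \<bullet> X h) *\<^sub>R l) = 0"
        using mult[OF k] by (simp add: defs)
      \<comment> \<open>The optimality condition of the model is split off as the last line, where
        it vanishes. Each remaining term has a factor tending to zero, namely a difference between
        \<open>a\<close> and \<open>s\<close> or the step \<open>d0\<close>.\<close>
      have "T h = (egrad f a - egrad f s - Qk k (a - s)) \<bullet> X h + \<zeta> k \<bullet> B' (S h) (a - s)
        - ((a - s) \<bullet> S h) * (l \<bullet> \<zeta> k) + n\<^sup>2 / 2 * (\<zeta> k \<bullet> LL h) + (a - s) \<bullet> EE h + 2 * c * (d0 \<bullet> snd h)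
        + ((model_grad k + p k) \<bullet> X h + \<zeta> k \<bullet> (derivative_map g s (X h) + ((a - s) \<bullet> X h) *\<^sub>R l))"
        unfolding T_def DG_def n(1)
        by (simp add: model_grad_def inner_add_left inner_add_right inner_diff_left inner_diff_right inner_commute
            algebra_simps flip: defs)
      then have Th: "T h = (egrad f a - egrad f s - Qk k (a - s)) \<bullet> X h + \<zeta> k \<bullet> B' (S h) (a - s)
        - ((a - s) \<bullet> S h) * (l \<bullet> \<zeta> k) + n\<^sup>2 / 2 * (\<zeta> k \<bullet> LL h) + (a - s) \<bullet> EE h + 2 * c * (d0 \<bullet> snd h)"
        unfolding kkt by simp
      have zC: "norm (\<zeta> k) \<le> C" using mult[OF k] by blast
      have t1: "(egrad f a - egrad f s - Qk k (a - s)) \<bullet> X h \<le> (Lf * n + \<beta>Q * n) * N"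
      proof -
        have "norm (egrad f a - egrad f s) \<le> Lf * n"
          using lipschitz_onD[OF Lf, of a s] D(5)[OF kb] by (simp add: dist_norm n defs)
        moreover have "norm (Qk k (a - s)) \<le> \<beta>Q * n"
          unfolding n by (intro order_trans[OF norm_blinfun] mult_right_mono Q_bound(2)) simp
        ultimately have "norm (egrad f a - egrad f s - Qk k (a - s)) \<le> Lf * n + \<beta>Q * n"
          using norm_triangle_ineq4[of "egrad f a - egrad f s" "Qk k (a - s)"] by linarith
        from abs_inner_le[OF this N(1)] show ?thesis by linarith
      qed
      have t2: "\<zeta> k \<bullet> B' (S h) (a - s) \<le> C * (K2 * N * n)"
      proof -
        have "norm (B' (S h) (a - s)) \<le> norm (B' (S h)) * n" unfolding n by (rule norm_blinfun)
        also have "\<dots> \<le> K2 * N * n"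
          using n(2) K20 N(2) by (intro mult_right_mono order_trans[OF B'_le] mult_left_mono)
        finally show ?thesis using abs_inner_le[OF zC] by fastforce
      qed
      have t3: "- (((a - s) \<bullet> S h) * (l \<bullet> \<zeta> k)) \<le> (n * N) * (B * C)"
      proof -
        have "\<bar>(a - s) \<bullet> S h\<bar> * \<bar>l \<bullet> \<zeta> k\<bar> \<le> (n * N) * (B * C)"
          using B(2)[OF kb] zC N(2) n N0 by (intro mult_mono abs_inner_le) (auto simp: l_def)
        then show ?thesis by (simp add: abs_mult[symmetric])
      qed
      have t4: "n\<^sup>2 / 2 * (\<zeta> k \<bullet> LL h) \<le> (A * n) * (C * N)"
      proof -
        \<comment> \<open>Boundedness of \<open>n\<close> trades the square for a linear bound,
          since the subgradient estimate must be linear in the step.\<close>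
        have "n\<^sup>2 / 2 \<le> A * n" using mult_right_mono[OF nA n(2)] by (simp add: power2_eq_square)
        then have "n\<^sup>2 / 2 * (C * N) \<le> (A * n) * (C * N)" using K(2) N0 by (intro mult_right_mono) auto
        moreover have "n\<^sup>2 / 2 * (\<zeta> k \<bullet> LL h) \<le> n\<^sup>2 / 2 * (C * N)"
          using abs_inner_le[OF zC N(3)] by (intro mult_left_mono) auto
        ultimately show ?thesis by linarith
      qed
      have t5: "(a - s) \<bullet> EE h \<le> n * N" using abs_inner_le[of "a - s" n "EE h" N] N(4) n by simp
      have t6: "2 * c * (d0 \<bullet> snd h) \<le> 2 * \<bar>c\<bar> * (step k * N)"
      proof -
        have "\<bar>2 * c\<bar> * \<bar>d0 \<bullet> snd h\<bar> \<le> \<bar>2 * c\<bar> * (step k * N)"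
          by (intro mult_left_mono abs_inner_le N) (auto simp: d0_def)
        then show ?thesis by (simp add: abs_mult[symmetric])
      qed
      have "T h \<le> (Lf * n + \<beta>Q * n) * N + C * (K2 * N * n) + (n * N) * (B * C) + (A * n) * (C * N) + n * N + 2 * \<bar>c\<bar> * (step k * N)"
        unfolding Th using t1 t2 t3 t4 t5 t6 by linarith
      also have "\<dots> = E * n * N + 2 * \<bar>c\<bar> * step k * N" by (simp add: E_def algebra_simps)
      also have "\<dots> \<le> E * (C1 * step k) * N + 2 * \<bar>c\<bar> * step k * N"
        using nC E0 N0 by (intro add_right_mono mult_right_mono mult_left_mono) auto
      finally show ?thesis by (simp add: b_def N_def algebra_simps)
    qed
    have bs: "0 \<le> b * step k" using b0 by simp
    note g = norm_grad_le[OF der T_le bs]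
    have "m (state k) = pot k"
      using mult[OF k] unfolding m_def pot_def at
      by (simp add: defs inner_diff_left inner_commute[of "\<xi> k"])
    then have eq: "potential_c f \<phi> \<psi> g c (state k) = ereal (m (state k))"
      using potential_state[OF kb] by simp
    \<comment> \<open>The minorant uses the real value of \<open>f\<close>, which agrees with
      \<open>f\<close> only where \<open>f\<close> is finite. Near the iterate the first component
      stays in \<O>.\<close>
    have "open (X -` \<O>)"
      using \<O>_open has_derivative_continuous[OF derX]
      by (intro open_vimage) (auto simp: continuous_on_eq_continuous_at)
    moreover have "state k \<in> X -` \<O>" using aO at by simp
    ultimately have "eventually (\<lambda>w. w \<in> X -` \<O>) (at (state k))"
      by (auto simp: eventually_at_topological)
    then have "eventually (\<lambda>w. ereal (m w) \<le> potential_c f \<phi> \<psi> g c w) (at (state k))"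
    proof eventually_elim
      case (elim w)
      have pc: "potential_c f \<phi> \<psi> g c w = (if LL w \<in> pos_orthant then
          f (X w) + ereal (\<phi> (X w)) + ind_fun nonpos_orthant (mba_G g (X w) (S w) (LL w)) + ereal (X w \<bullet> EE w)
            + conjugate_fun \<psi> (- EE w)
        else \<infinity>) + ereal (c * (norm (snd w))\<^sup>2)"
        by (simp add: potential_c_def potential_def X_def S_def LL_def EE_def case_prod_unfold)
      show ?case
      proof (cases "LL w \<in> pos_orthant \<and> mba_G g (X w) (S w) (LL w) \<in> nonpos_orthant")
        case True
        have fX: "f (X w) = ereal (real_of_ereal (f (X w)))" using elim by (intro f_real) simp
        have "\<zeta> k \<bullet> mba_G g (X w) (S w) (LL w) \<le> 0"
          using True mult[OF k]
          by (auto simp: inner_vec_def nonneg_orthant_def nonpos_orthant_def intro!: sum_nonpos mult_nonneg_nonpos)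
        moreover have "\<phi> a + p k \<bullet> (X w - a) \<le> \<phi> (X w)"
          using mult[OF k] by (simp add: convex_subgradient_def a_def)
        ultimately have "m w \<le> (real_of_ereal (f (X w)) + \<phi> (X w) + X w \<bullet> EE w) + ((- EE w) \<bullet> s - \<psi> s) + c * (norm (snd w))\<^sup>2"
          unfolding m_def by linarith
        then have "ereal (m w) \<le> ereal (real_of_ereal (f (X w)) + \<phi> (X w) + X w \<bullet> EE w) + ereal ((- EE w) \<bullet> s - \<psi> s) + ereal (c * (norm (snd w))\<^sup>2)"
          by simp
        also have "\<dots> \<le> ereal (real_of_ereal (f (X w)) + \<phi> (X w) + X w \<bullet> EE w) + conjugate_fun \<psi> (- EE w) + ereal (c * (norm (snd w))\<^sup>2)"
          by (intro add_mono order_refl conjugate_fun_ge)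
        also have "\<dots> = f (X w) + ereal (\<phi> (X w)) + 0 + ereal (X w \<bullet> EE w) + conjugate_fun \<psi> (- EE w) + ereal (c * (norm (snd w))\<^sup>2)"
          by (subst (2) fX) simp
        also have "\<dots> = potential_c f \<phi> \<psi> g c w"
          using True by (simp add: pc ind_fun_def)
        finally show ?thesis .
      next
        case False
        have "f (X w) \<noteq> - \<infinity>" using f_proper by (simp add: proper_fun_def)
        moreover have "conjugate_fun \<psi> (- EE w) \<noteq> - \<infinity>"
          using conjugate_fun_ge[of "- EE w" 0 \<psi>] by auto
        ultimately have "potential_c f \<phi> \<psi> g c w = \<infinity>"
          using False by (auto simp: pc ind_fun_def)
        then show ?thesis by simp
      qed
    qed
    from regular_subdiff_minorant[OF this eq g(1)]
    have "grad m (state k) \<in> limiting_subdiff (potential_c f \<phi> \<psi> g c) (state k)"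
      using regular_subset_limiting_subdiff by blast
    then show ?thesis using g(2) by blast
  qed
  then show ?thesis using b0 by blast
qed

section \<open>Stationarity of the cluster points\<close>

lemma cluster_point_strong_stationary:
  assumes "s \<in> cluster_points x"
  shows "s \<in> strong_stationary f \<phi> \<psi> g"
proof -
  obtain r where r: "strict_mono r" "(x \<circ> r) \<longlonglongrightarrow> s" using assms by (auto simp: cluster_points_def)
  obtain p \<zeta> C K where K: "kbar \<le> K" "0 \<le> C" and mult: "\<And>k. K \<le> k \<Longrightarrow>
    convex_subgradient \<phi> (xb k) (p k) \<and> norm (p k) \<le> C \<and>
    \<zeta> k \<in> nonneg_orthant \<and> \<zeta> k \<bullet> mba_G g (xb k) (x k) (Lk k) = 0 \<and> norm (\<zeta> k) \<le> C \<and>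
    (\<forall>h. (model_grad k + p k) \<bullet> h + \<zeta> k \<bullet> (derivative_map g (x k) h + ((xb k - x k) \<bullet> h) *\<^sub>R Lk k) = 0)"
    using multipliers by blast
  \<comment> \<open>Multipliers and subgradients of \<phi> are bundled with the data, so that a
    single further subsequence makes all of them converge.\<close>
  define W where "W k = (parameters k, (p k, \<zeta> k))" for k
  obtain P where P: "\<And>k. norm (parameters k) \<le> P"
    using parameters_bounded by (auto simp: bounded_iff)
  have "bounded (range W)"
  proof (rule bounded_range_tail)
    fix k assume "K \<le> k"
    have "norm (W k) \<le> norm (parameters k) + (norm (p k) + norm (\<zeta> k))"
      unfolding W_def by (intro order_trans[OF norm_Pair_le] add_mono order_refl)
    also have "\<dots> \<le> P + (C + C)" using mult[OF \<open>K \<le> k\<close>] by (intro add_mono P) auto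
    finally show "norm (W k) \<le> P + (C + C)" .
  qed
  from cluster_points_subseq[OF this r(1)]
  obtain r' w where r': "strict_mono r'" "(W \<circ> (r \<circ> r')) \<longlonglongrightarrow> w" by metis
  \<comment> \<open>The shift by \<open>K\<close> places every index where the multipliers satisfy
    their conditions, so that these hold for all \<open>n\<close> and not just eventually.\<close>
  define t where "t n = r (r' (n + K))" for n
  have tK: "K \<le> t n" for n
    using seq_suble[OF strict_mono_o[OF r(1) r'(1)], of "n + K"] by (simp add: t_def)
  have t_mono: "strict_mono t"
    using r(1) r'(1) by (auto simp: t_def strict_mono_def)
  have "(\<lambda>n. (x \<circ> r) (r' (n + K))) \<longlonglongrightarrow> s"
    using LIMSEQ_ignore_initial_segment[OF LIMSEQ_subseq_LIMSEQ[OF r(2) r'(1)], of K] by (simp add: o_def)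
  then have xt: "(\<lambda>n. x (t n)) \<longlonglongrightarrow> s" by (simp add: t_def)
  have Wt: "(\<lambda>n. W (t n)) \<longlonglongrightarrow> w"
    using LIMSEQ_ignore_initial_segment[OF r'(2), of K] by (simp add: o_def t_def)
  obtain l A e s' a p0 \<zeta>0 where w: "w = (((l, A, e, s'), a), (p0, \<zeta>0))" by (metis prod.exhaust)
  have "(\<lambda>n. fst (fst (fst (W (t n))))) \<longlonglongrightarrow> fst (fst (fst w))"
    "(\<lambda>n. fst (snd (fst (fst (W (t n)))))) \<longlonglongrightarrow> fst (snd (fst (fst w)))"
    "(\<lambda>n. fst (snd (snd (fst (fst (W (t n))))))) \<longlonglongrightarrow> fst (snd (snd (fst (fst w))))"
    "(\<lambda>n. fst (snd (W (t n)))) \<longlonglongrightarrow> fst (snd w)"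
    "(\<lambda>n. snd (snd (W (t n)))) \<longlonglongrightarrow> snd (snd w)"
    by (intro tendsto_intros Wt)+
  then have lims: "(\<lambda>n. Lk (t n)) \<longlonglongrightarrow> l" "(\<lambda>n. Qk (t n)) \<longlonglongrightarrow> A" "(\<lambda>n. \<xi> (t n)) \<longlonglongrightarrow> e"
    "(\<lambda>n. p (t n)) \<longlonglongrightarrow> p0" "(\<lambda>n. \<zeta> (t n)) \<longlonglongrightarrow> \<zeta>0"
    by (simp_all add: W_def parameters_def w)
  have diff: "(\<lambda>n. xb (t n) - x (t n)) \<longlonglongrightarrow> 0"
    using LIMSEQ_subseq_LIMSEQ[OF xb_x_tendsto t_mono] by (simp add: o_def)
  have xbt: "(\<lambda>n. xb (t n)) \<longlonglongrightarrow> s" using tendsto_add[OF diff xt] by simp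
  have s_feas: "s \<in> feasible g" using limit_feasible[OF r(2)] .
  have tD: "x (t n) \<in> D" for n using D(5)[of "t n"] tK[of n] K(1) by auto
  have sD: "s \<in> D" by (rule closed_sequentially[OF compact_imp_closed[OF D(1)] _ xt]) (use tD in blast)
  have eg: "(\<lambda>n. egrad f (x (t n))) \<longlonglongrightarrow> egrad f s"
    by (rule continuous_on_tendsto_compose[OF lipschitz_on_continuous_on[OF Lf] xt sD]) (use tD in auto)
  have "isCont (derivative_map g) s"
    using g_twice differentiable_imp_continuous_within unfolding twice_differentiable_def by blast
  then have dg: "(\<lambda>n. derivative_map g (x (t n))) \<longlonglongrightarrow> derivative_map g s" using xt by (rule isCont_tendsto_compose)
  have "isCont g s" using g_differentiable differentiable_imp_continuous_within by blast
  then have gt: "(\<lambda>n. g (x (t n))) \<longlonglongrightarrow> g s" using xt by (rule isCont_tendsto_compose)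
  note blin = bounded_bilinear.tendsto[OF bounded_bilinear_blinfun_apply]
  have "\<zeta>0 $ i \<ge> 0" for i
    by (rule LIMSEQ_le_const[OF tendsto_vec_nth[OF lims(5)]])
      (use mult[OF tK] in \<open>auto simp: nonneg_orthant_def\<close>)
  then have \<zeta>_nonneg: "\<zeta>0 \<in> nonneg_orthant" by (simp add: nonneg_orthant_def)
  \<comment> \<open>Iterate and exact minimizer have the same limit and \<open>L\<close> stays
    bounded, so the linear and curvature parts of the constraint model vanish and complementarity
    passes to \<open>g s\<close>.\<close>
  have "(\<lambda>n. \<zeta> (t n) \<bullet> mba_G g (xb (t n)) (x (t n)) (Lk (t n))) \<longlonglongrightarrow>
    \<zeta>0 \<bullet> (g s + derivative_map g s 0 + ((norm (0::real^'n))\<^sup>2 / 2) *\<^sub>R l)"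
    unfolding mba_G_eq by (intro tendsto_intros blin lims gt dg diff) simp
  then have comp: "\<zeta>0 \<bullet> g s = 0"
    using mult[OF tK] by (simp add: blinfun.zero_right LIMSEQ_const_iff)
  have "\<zeta>0 \<in> limiting_normal_cone nonpos_orthant (g s)"
    using nonneg_complementary_imp_normal[OF \<zeta>_nonneg comp] s_feas by (simp add: feasible_def)
  moreover have "p0 \<in> limiting_subdiff (\<lambda>x. ereal (\<phi> x)) s"
    by (rule convex_subgradient_imp_limiting_subdiff,
        rule convex_subgradient_limit[OF continuous_convex[OF \<phi>_convex] _ xbt lims(4)])
      (use mult[OF tK] in blast)
  moreover have "e \<in> limiting_subdiff (\<lambda>x. ereal (- \<psi> x)) s"
    by (rule limiting_subdiff_closed[OF _ \<xi>_subgrad xt lims(3)])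
      (intro continuous_on_minus continuous_convex \<psi>_convex)
  moreover have "0 = egrad f s + p0 + e + nabla g s \<zeta>0"
  proof -
    \<comment> \<open>The equation is obtained in the limit against each fixed direction, and then
      evaluated at the residual vector itself.\<close>
    have "(egrad f s + p0 + e + nabla g s \<zeta>0) \<bullet> h = 0" for h
    proof -
      have "(\<lambda>n. (model_grad (t n) + p (t n)) \<bullet> h + \<zeta> (t n) \<bullet> (derivative_map g (x (t n)) h + ((xb (t n) - x (t n)) \<bullet> h) *\<^sub>R Lk (t n)))
        \<longlonglongrightarrow> (egrad f s + e + A 0 + p0) \<bullet> h + \<zeta>0 \<bullet> (derivative_map g s h + (0 \<bullet> h) *\<^sub>R l)"
        unfolding model_grad_def by (intro tendsto_intros blin lims eg dg diff)
      then have "(egrad f s + e + p0) \<bullet> h + \<zeta>0 \<bullet> derivative_map g s h = 0"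
        using mult[OF tK] by (simp add: blinfun.zero_right LIMSEQ_const_iff)
      then show ?thesis by (simp add: inner_add_left nabla_g)
    qed
    from this[of "egrad f s + p0 + e + nabla g s \<zeta>0"] show ?thesis by simp
  qed
  ultimately show ?thesis using s_feas unfolding strong_stationary_def by blast
qed

end

theorem theorem7:
  fixes f :: "real^'n \<Rightarrow> ereal"
    and \<phi> \<psi> :: "real^'n \<Rightarrow> real"
    and g :: "real^'n \<Rightarrow> real^'m"
    and \<O> D :: "(real^'n) set"
    and \<mu>min \<mu>max Lmin Lmax M \<beta>R \<beta>F \<alpha> \<tau> :: real
    and x \<xi> :: "nat \<Rightarrow> real^'n"
    and jk :: "nat \<Rightarrow> nat"
    and \<mu> :: "nat \<Rightarrow> nat \<Rightarrow> real"
    and L :: "nat \<Rightarrow> nat \<Rightarrow> real^'m"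
    and Q :: "nat \<Rightarrow> nat \<Rightarrow> (real^'n) \<Rightarrow>\<^sub>L (real^'n)"
    and xbar y v :: "nat \<Rightarrow> nat \<Rightarrow> real^'n"
    and lam :: "nat \<Rightarrow> nat \<Rightarrow> real^'m"
    and \<beta>Q \<gamma> Lf c :: real
    and khat kbar :: nat
  assumes run: "inexact_mba f \<phi> \<psi> g \<O> \<mu>min \<mu>max Lmin Lmax M \<beta>R \<beta>F \<alpha> \<tau>
                  x \<xi> jk \<mu> L Q xbar y v lam"
    and subregular: "\<And>k j. j \<le> jk k \<Longrightarrow>
          metrically_subregular (\<lambda>z. {mba_G g z (x k) (L k j) - w | w. w \<in> nonpos_orthant})
            (xbar k j) 0"
    and bounded: "bounded (range x)"
    and BMP: "\<And>u z. (u, z) \<in> cluster_points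
            (\<lambda>k. ((L k (jk k), Q k (jk k), \<xi> k, x k), xbar k (jk k))) \<Longrightarrow> partial_BMP g u z"
    and g_twice: "twice_differentiable g"
    and \<beta>Q: "0 < \<beta>Q" "\<And>k. norm (Q k (jk k)) \<le> \<beta>Q"
    and \<gamma>: "0 < \<gamma>" "\<And>k. khat \<le> k \<Longrightarrow>
          norm (x (Suc k) - xbar k (jk k)) \<le> \<gamma> * sqrt (\<beta>R / 2) * norm (x (Suc k) - x k)"
    and D: "compact D" "convex D" "D \<subseteq> \<O>" "khat \<le> kbar"
           "\<And>k. kbar \<le> k \<Longrightarrow> x k \<in> D \<and> xbar k (jk k) \<in> D"
    and Lf: "Lf-lipschitz_on D (egrad f)"
    and c: "c = (Lf + \<beta>Q + \<beta>F / 2) + (Lf + \<beta>Q / 2) * \<gamma>\<^sup>2 * \<beta>R"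
    and KL: "\<And>w. w \<in> cluster_points
            (\<lambda>k. ((xbar k (jk k), x k, L k (jk k), \<xi> k), x (Suc k) - x k)) \<Longrightarrow>
          KL_at (potential_c f \<phi> \<psi> g c) w"
  shows "summable (\<lambda>k. norm (x (Suc k) - x k)) \<and>
         (\<exists>xs \<in> cluster_points x. x \<longlonglongrightarrow> xs) \<and>
         cluster_points x \<subseteq> strong_stationary f \<phi> \<psi> g"
proof -
  interpret inexact_mba f \<phi> \<psi> g \<O> \<mu>min \<mu>max Lmin Lmax M \<beta>R \<beta>F \<alpha> \<tau> x \<xi> jk \<mu> L Q xbar y v lam
    by (rule run)
  interpret mba_run f \<phi> \<psi> g \<O> \<mu>min \<mu>max Lmin Lmax M \<beta>R \<beta>F \<alpha> \<tau> x \<xi> jk \<mu> L Q xbar y v lam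
    D \<beta>Q \<gamma> Lf c khat kbar
    by unfold_locales (fact bounded BMP g_twice \<beta>Q \<gamma> D Lf c)+
  obtain b K where b: "0 \<le> b" "\<And>k. K \<le> k \<Longrightarrow> \<exists>q\<in>limiting_subdiff (potential_c f \<phi> \<psi> g c) (state k).
      norm q \<le> b * norm (x (Suc k) - x k)"
    using potential_subgradient by blast
  have sum: "summable (\<lambda>k. norm (x (Suc k) - x k))"
  proof (rule KL_finite_length[where w = state and F = "\<lambda>k. objective_real (x k)" and H = pot
        and K = "max K kbar" and a = "\<alpha> / 2" and b = b])
    show "KL_at (potential_c f \<phi> \<psi> g c) z" if "z \<in> cluster_points state" for z
      using KL that by (simp add: state_def[abs_def])
  qed (use b params_pos state_bounded potential_cluster_point objective_descent objective_tendsto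
      potential_state objective_le_pot pot_tendsto in auto)
  \<comment> \<open>The partial sums of the increments telescope to \<open>x n - x 0\<close>, and
    norm summability makes the series converge.\<close>
  have "convergent (\<lambda>n. x n - x 0)"
    using summable_norm_cancel[OF sum] unfolding summable_iff_convergent sum_lessThan_telescope .
  then obtain z where "(\<lambda>n. x n - x 0) \<longlonglongrightarrow> z" by (auto simp: convergent_def)
  from tendsto_add[OF this tendsto_const[of "x 0"]] have lim: "x \<longlonglongrightarrow> z + x 0" by simp
  then have "z + x 0 \<in> cluster_points x"
    unfolding cluster_points_def by (intro CollectI exI[of _ id]) (simp add: strict_mono_id)
  then show ?thesis using sum lim cluster_point_strong_stationary by blast
qed

end
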